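(* Let $G$ be a discrete group acting from the left on a set $S$, let $\Lambda\subseteq S$ be a set containing exactly one point of each $G$-orbit, and for $x\in\Lambda$ let $H_x=\mathrm{Stab}_G(x)$. Regard $\ell^1(S)$ as a Banach $\ell^1(G)$-bimodule with left action $e_g\cdot\delta_s=\delta_{g\cdot s}$ and right action $\delta_s\cdot e_g=\delta_s$. Then for each $n\ge0$, $H^n(\ell^1(G),\ell^1(S)')$ is topologically isomorphic to the $n$-th cohomology group of the cochain complex \[0\to\bigoplus^{\ell^\infty}_{x\in\Lambda}C^0(\ell^1(H_x),\mathbb C)\to\bigoplus^{\ell^\infty}_{x\in\Lambda}C^1(\ell^1(H_x),\mathbb C)\to\cdots\] whose coboundary maps are the coordinatewise $\ell^\infty$-sums of the Hochschild coboundaries of the complexes $C^*(\ell^1(H_x),\mathbb C)$, where $\mathbb C$ is the $\ell^1(H_x)$-bimodule with both actions given by the augmentation character.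
   Context: For a discrete group $G$, $\ell^1(G)$ is its convolution algebra with basis $(e_g)$; the augmentation character sends each $e_g$ to $1$. For a Banach algebra $A$ and Banach bimodule $M$, $C^n(A,M)$ is the Banach space of bounded $n$-linear maps $A^n\to M$ with the Hochschild coboundary $(\delta\psi)(a_1,\dots,a_{n+1})=a_1\psi(a_2,\dots)+\sum_{j=1}^n(-1)^j\psi(\dots,a_ja_{j+1},\dots)+(-1)^{n+1}\psi(a_1,\dots,a_n)a_{n+1}$, and $H^n(A,M)$ is its cohomology. $M'$ carries the adjoint bimodule structure. $\bigoplus^{\ell^\infty}_{x}E(x)$ is the space of bounded families $(v_x)$ with sup norm. Two seminormed quotient spaces are topologically isomorphic if there is a linear bijection which is a homeomorphism. *)

theory Defs
  imports "HOL-Analysis.Analysis" "HOL-Algebra.Group_Action"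
begin

record 'a balg =
  acar :: "'a set"
  aadd :: "'a \<Rightarrow> 'a \<Rightarrow> 'a"
  asmult :: "complex \<Rightarrow> 'a \<Rightarrow> 'a"
  amult :: "'a \<Rightarrow> 'a \<Rightarrow> 'a"
  anorm :: "'a \<Rightarrow> real"

record ('a, 'm) bimod =
  mcar :: "'m set"
  madd :: "'m \<Rightarrow> 'm \<Rightarrow> 'm"
  msmult :: "complex \<Rightarrow> 'm \<Rightarrow> 'm"
  mzero :: "'m"
  mnorm :: "'m \<Rightarrow> real"
  lact :: "'a \<Rightarrow> 'm \<Rightarrow> 'm"
  ract :: "'m \<Rightarrow> 'a \<Rightarrow> 'm"

definition l1 :: "'b set \<Rightarrow> ('b \<Rightarrow> complex) set" where
  "l1 X = {f. (\<forall>x. x \<notin> X \<longrightarrow> f x = 0) \<and> (\<lambda>x. norm (f x)) summable_on X}"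

definition l1norm :: "'b set \<Rightarrow> ('b \<Rightarrow> complex) \<Rightarrow> real" where
  "l1norm X f = (\<Sum>\<^sub>\<infinity>x\<in>X. norm (f x))"

definition conv :: "('g, 'z) monoid_scheme \<Rightarrow> ('g \<Rightarrow> complex) \<Rightarrow> ('g \<Rightarrow> complex) \<Rightarrow> ('g \<Rightarrow> complex)" where
  "conv G a b = (\<lambda>g. if g \<in> carrier G
      then (\<Sum>\<^sub>\<infinity>h\<in>carrier G. a h * b (inv\<^bsub>G\<^esub> h \<otimes>\<^bsub>G\<^esub> g)) else 0)"

text \<open>The convolution algebra l^1(H) of a subgroup H of G (H = carrier G gives l^1(G)).\<close>
definition l1alg :: "('g, 'z) monoid_scheme \<Rightarrow> 'g set \<Rightarrow> ('g \<Rightarrow> complex) balg" where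
  "l1alg G H = \<lparr> acar = l1 H, aadd = (\<lambda>f g x. f x + g x), asmult = (\<lambda>c f x. c * f x),
                 amult = conv G, anorm = l1norm H \<rparr>"

definition augm :: "'g set \<Rightarrow> ('g \<Rightarrow> complex) \<Rightarrow> complex" where
  "augm H a = (\<Sum>\<^sub>\<infinity>h\<in>H. a h)"

definition Cmod :: "'g set \<Rightarrow> ('g \<Rightarrow> complex, complex) bimod" where
  "Cmod H = \<lparr> mcar = UNIV, madd = (+), msmult = (*), mzero = 0, mnorm = norm,
              lact = (\<lambda>a z. augm H a * z), ract = (\<lambda>z a. z * augm H a) \<rparr>"

text \<open>The l^1(G)-bimodule l^1(S): left action e_g . delta_s = delta_(g.s), right action trivial,
  extended linearly and continuously.\<close>
definition l1S_lact :: "('g, 'z) monoid_scheme \<Rightarrow> 'b set \<Rightarrow> ('g \<Rightarrow> 'b \<Rightarrow> 'b)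
    \<Rightarrow> ('g \<Rightarrow> complex) \<Rightarrow> ('b \<Rightarrow> complex) \<Rightarrow> ('b \<Rightarrow> complex)" where
  "l1S_lact G S \<phi> a \<xi> = (\<lambda>t. if t \<in> S then (\<Sum>\<^sub>\<infinity>g\<in>carrier G. a g * \<xi> (\<phi> (inv\<^bsub>G\<^esub> g) t)) else 0)"

definition l1S_ract :: "('g, 'z) monoid_scheme \<Rightarrow> ('b \<Rightarrow> complex) \<Rightarrow> ('g \<Rightarrow> complex) \<Rightarrow> ('b \<Rightarrow> complex)" where
  "l1S_ract G \<xi> a = (\<lambda>t. augm (carrier G) a * \<xi> t)"

definition dual_l1S :: "('g, 'z) monoid_scheme \<Rightarrow> 'b set \<Rightarrow> ('g \<Rightarrow> 'b \<Rightarrow> 'b)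
    \<Rightarrow> ('g \<Rightarrow> complex, ('b \<Rightarrow> complex) \<Rightarrow> complex) bimod" where
  "dual_l1S G S \<phi> = \<lparr>
     mcar = {f. (\<forall>x\<in>l1 S. \<forall>y\<in>l1 S. \<forall>c. f (\<lambda>t. x t + c * y t) = f x + c * f y)
               \<and> (\<exists>C. \<forall>x\<in>l1 S. norm (f x) \<le> C * l1norm S x)
               \<and> (\<forall>x. x \<notin> l1 S \<longrightarrow> f x = 0)},
     madd = (\<lambda>f g x. f x + g x),
     msmult = (\<lambda>c f x. c * f x),
     mzero = (\<lambda>x. 0),
     mnorm = (\<lambda>f. Sup (insert 0 {norm (f x) |x. x \<in> l1 S \<and> l1norm S x \<le> 1})),
     lact = (\<lambda>a f \<xi>. if \<xi> \<in> l1 S then f (l1S_ract G \<xi> a) else 0),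
     ract = (\<lambda>f a \<xi>. if \<xi> \<in> l1 S then f (l1S_lact G S \<phi> a \<xi>) else 0) \<rparr>"

section \<open>Hochschild cochains (n-tuples are functions nat => 'a, only entries i < n matter)\<close>

definition tuples :: "'a set \<Rightarrow> nat \<Rightarrow> (nat \<Rightarrow> 'a) set" where
  "tuples A n = {a. \<forall>i<n. a i \<in> A}"

definition cochains :: "'a balg \<Rightarrow> ('a, 'm) bimod \<Rightarrow> nat \<Rightarrow> ((nat \<Rightarrow> 'a) \<Rightarrow> 'm) set" where
  "cochains A M n = {\<psi>.
     (\<forall>a\<in>tuples (acar A) n. \<psi> a \<in> mcar M)
   \<and> (\<forall>a. a \<notin> tuples (acar A) n \<longrightarrow> \<psi> a = mzero M)
   \<and> (\<forall>a b. (\<forall>i<n. a i = b i) \<longrightarrow> \<psi> a = \<psi> b)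
   \<and> (\<forall>a\<in>tuples (acar A) n. \<forall>i<n. \<forall>x\<in>acar A. \<forall>y\<in>acar A. \<forall>c.
        \<psi> (a(i := aadd A x (asmult A c y))) = madd M (\<psi> (a(i := x))) (msmult M c (\<psi> (a(i := y)))))
   \<and> (\<exists>C. \<forall>a\<in>tuples (acar A) n. mnorm M (\<psi> a) \<le> C * (\<Prod>i<n. anorm A (a i)))}"

definition cochain_norm :: "'a balg \<Rightarrow> ('a, 'm) bimod \<Rightarrow> nat \<Rightarrow> ((nat \<Rightarrow> 'a) \<Rightarrow> 'm) \<Rightarrow> real" where
  "cochain_norm A M n \<psi> =
     Sup (insert 0 {mnorm M (\<psi> a) |a. a \<in> tuples (acar A) n \<and> (\<forall>i<n. anorm A (a i) \<le> 1)})"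

definition msum :: "('a, 'm) bimod \<Rightarrow> (nat \<Rightarrow> 'm) \<Rightarrow> nat list \<Rightarrow> 'm" where
  "msum M f js = foldr (\<lambda>j acc. madd M (f j) acc) js (mzero M)"

text \<open>(a_0,...,a_n) \<mapsto> (a_0,...,a_(j-1) a_j,...,a_n), for 1 \<le> j \<le> n.\<close>
definition merge_at :: "'a balg \<Rightarrow> (nat \<Rightarrow> 'a) \<Rightarrow> nat \<Rightarrow> (nat \<Rightarrow> 'a)" where
  "merge_at A a j = (\<lambda>i. if i < j - 1 then a i
                        else if i = j - 1 then amult A (a (j - 1)) (a j) else a (Suc i))"

text \<open>Hochschild coboundary C^n \<rightarrow> C^(n+1) (arguments a_1..a_(n+1) of the paper are a 0..a n).\<close>
definition hoch_d :: "'a balg \<Rightarrow> ('a, 'm) bimod \<Rightarrow> nat \<Rightarrow> ((nat \<Rightarrow> 'a) \<Rightarrow> 'm) \<Rightarrow> ((nat \<Rightarrow> 'a) \<Rightarrow> 'm)" where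
  "hoch_d A M n \<psi> = (\<lambda>a. if a \<in> tuples (acar A) (Suc n) then
      madd M (lact M (a 0) (\<psi> (\<lambda>i. a (Suc i))))
        (madd M (msum M (\<lambda>j. msmult M ((-1) ^ j) (\<psi> (merge_at A a j))) [1..<Suc n])
                (msmult M ((-1) ^ Suc n) (ract M (\<psi> a) (a n))))
    else mzero M)"

record 'c cochain_cx =
  ccar :: "nat \<Rightarrow> 'c set"
  cdiff :: "nat \<Rightarrow> 'c \<Rightarrow> 'c"
  cadd :: "'c \<Rightarrow> 'c \<Rightarrow> 'c"
  csmult :: "complex \<Rightarrow> 'c \<Rightarrow> 'c"
  czero :: "'c"
  cnorm :: "nat \<Rightarrow> 'c \<Rightarrow> real"

definition hoch_cx :: "'a balg \<Rightarrow> ('a, 'm) bimod \<Rightarrow> ((nat \<Rightarrow> 'a) \<Rightarrow> 'm) cochain_cx" where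
  "hoch_cx A M = \<lparr> ccar = cochains A M, cdiff = hoch_d A M,
     cadd = (\<lambda>\<psi> \<theta> a. madd M (\<psi> a) (\<theta> a)), csmult = (\<lambda>c \<psi> a. msmult M c (\<psi> a)),
     czero = (\<lambda>a. mzero M), cnorm = cochain_norm A M \<rparr>"

definition linf_sum_cx :: "'x set \<Rightarrow> ('x \<Rightarrow> 'a balg) \<Rightarrow> ('x \<Rightarrow> ('a, 'm) bimod)
    \<Rightarrow> ('x \<Rightarrow> ((nat \<Rightarrow> 'a) \<Rightarrow> 'm)) cochain_cx" where
  "linf_sum_cx L A M = \<lparr>
     ccar = (\<lambda>n. {\<Phi>. (\<forall>x\<in>L. \<Phi> x \<in> cochains (A x) (M x) n)
                   \<and> (\<forall>x. x \<notin> L \<longrightarrow> \<Phi> x = (\<lambda>a. mzero (M x)))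
                   \<and> bdd_above ((\<lambda>x. cochain_norm (A x) (M x) n (\<Phi> x)) ` L)}),
     cdiff = (\<lambda>n \<Phi> x. if x \<in> L then hoch_d (A x) (M x) n (\<Phi> x) else (\<lambda>a. mzero (M x))),
     cadd = (\<lambda>\<Phi> \<Psi> x a. madd (M x) (\<Phi> x a) (\<Psi> x a)),
     csmult = (\<lambda>c \<Phi> x a. msmult (M x) c (\<Phi> x a)),
     czero = (\<lambda>x a. mzero (M x)),
     cnorm = (\<lambda>n \<Phi>. Sup (insert 0 ((\<lambda>x. cochain_norm (A x) (M x) n (\<Phi> x)) ` L))) \<rparr>"

definition cocycles :: "'c cochain_cx \<Rightarrow> nat \<Rightarrow> 'c set" where
  "cocycles X n = {z \<in> ccar X n. cdiff X n z = czero X}"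

definition coboundaries :: "'c cochain_cx \<Rightarrow> nat \<Rightarrow> 'c set" where
  "coboundaries X n = (if n = 0 then {czero X} else cdiff X (n - 1) ` ccar X (n - 1))"

definition coh_coset :: "'c cochain_cx \<Rightarrow> nat \<Rightarrow> 'c \<Rightarrow> 'c set" where
  "coh_coset X n z = (\<lambda>b. cadd X z b) ` coboundaries X n"

definition cohom :: "'c cochain_cx \<Rightarrow> nat \<Rightarrow> 'c set set" where
  "cohom X n = coh_coset X n ` cocycles X n"

definition qadd :: "'c cochain_cx \<Rightarrow> 'c set \<Rightarrow> 'c set \<Rightarrow> 'c set" where
  "qadd X c d = {cadd X x y |x y. x \<in> c \<and> y \<in> d}"

definition qsmult :: "'c cochain_cx \<Rightarrow> nat \<Rightarrow> complex \<Rightarrow> 'c set \<Rightarrow> 'c set" where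
  "qsmult X n k c = {cadd X (csmult X k x) b |x b. x \<in> c \<and> b \<in> coboundaries X n}"

definition qdist :: "'c cochain_cx \<Rightarrow> nat \<Rightarrow> 'c set \<Rightarrow> 'c set \<Rightarrow> real" where
  "qdist X n c d = Inf {cnorm X n (cadd X x (csmult X (-1) y)) |x y. x \<in> c \<and> y \<in> d}"

definition top_iso :: "'c cochain_cx \<Rightarrow> 'd cochain_cx \<Rightarrow> nat \<Rightarrow> ('c set \<Rightarrow> 'd set) \<Rightarrow> bool" where
  "top_iso X Y n T \<longleftrightarrow>
     bij_betw T (cohom X n) (cohom Y n)
   \<and> (\<forall>c\<in>cohom X n. \<forall>d\<in>cohom X n. T (qadd X c d) = qadd Y (T c) (T d))
   \<and> (\<forall>k. \<forall>c\<in>cohom X n. T (qsmult X n k c) = qsmult Y n k (T c))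
   \<and> (\<forall>c\<in>cohom X n. \<forall>e>0. \<exists>\<delta>>0. \<forall>d\<in>cohom X n. qdist X n d c < \<delta> \<longrightarrow> qdist Y n (T d) (T c) < e)
   \<and> (\<forall>c\<in>cohom X n. \<forall>e>0. \<exists>\<delta>>0. \<forall>d\<in>cohom X n. qdist Y n (T d) (T c) < \<delta> \<longrightarrow> qdist X n d c < e)"

end

theory Submission
  imports Defs
begin

text \<open>By density of the point masses, a cochain in \<open>C\<^sup>n(\<ell>\<^sup>1(G), \<ell>\<^sup>1(S)')\<close> is a bounded function of
  \<open>(g\<^sub>1, \<dots>, g\<^sub>n; s)\<close>, that is, a bounded \<open>n\<close>-cochain on the nerve of the action groupoid of \<open>G\<close> on
  \<open>S\<close>, and the target complex consists of the bounded cochains on the disjoint union of the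
  stabilizers \<open>H\<^sub>x\<close>, which is a full subgroupoid meeting every component. Restriction along the
  inclusion is \<open>\<psi> \<mapsto> (\<psi>(\<dots>)(\<delta>\<^sub>x))\<^sub>x\<close>. Choosing \<open>t\<^sub>s \<in> G\<close> with \<open>t\<^sub>s \<cdot> x = s\<close> for the representative \<open>x\<close>
  of the orbit of \<open>s\<close> gives a retraction of groupoids \<open>g \<mapsto> t\<^bsub>gs\<^esub>\<^sup>-\<^sup>1 g t\<^sub>s\<close>, hence a contractive
  section of the restriction map. The prism operator is a bounded cochain homotopy between the
  identity and the composite in the other order.\<close>

section \<open>Retracts of cochain complexes\<close>

text \<open>On bar tuples of arrows the retraction twists each entry by the transports at both of
  its ends, and these cancel only when adjacent entries are multiplied. Therefore cochains are
  rewritten homogeneously, as bounded functions of \<open>k 0, \<dots>, k n\<close> in G and a base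
  point s that are invariant under replacing each \<open>k i\<close> by \<open>k i\<close> times the
  inverse of c, and s by c.s. The points \<open>k i\<close>.s are the vertices and the quotients of
  consecutive \<open>k i\<close> the labels of the edges. The Hochschild coboundary becomes the
  alternating sum over deleted vertices, the retraction becomes a map applied to each vertex
  separately, and the homotopy becomes a combinatorial identity for an arbitrary self-map of the
  vertices. Taking the transport to be 1 on \<Lambda> makes restriction after spreading the identity
  on cochains, not only up to homotopy. As \<Lambda> may be infinite, bounds must be uniform in x;
  they are, because a value of a spread cochain at s involves a single coordinate. The resulting
  isomorphism even preserves the quotient distances.\<close>

locale seminormed_cx =
  fixes X :: "'c cochain_cx"
  assumes add_assoc: "cadd X (cadd X x y) z = cadd X x (cadd X y z)"
    and add_commute: "cadd X x y = cadd X y x"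
    and add_zero: "cadd X x (czero X) = x"
    and add_neg: "cadd X x (csmult X (-1) x) = czero X"
    and smult_add: "csmult X k (cadd X x y) = cadd X (csmult X k x) (csmult X k y)"
    and add_closed: "x \<in> ccar X n \<Longrightarrow> y \<in> ccar X n \<Longrightarrow> cadd X x y \<in> ccar X n"
    and smult_closed: "x \<in> ccar X n \<Longrightarrow> csmult X k x \<in> ccar X n"
    and zero_closed: "czero X \<in> ccar X n"
    and d_closed: "x \<in> ccar X n \<Longrightarrow> cdiff X n x \<in> ccar X (Suc n)"
    and d_add: "cdiff X n (cadd X x y) = cadd X (cdiff X n x) (cdiff X n y)"
    and d_smult: "cdiff X n (csmult X k x) = csmult X k (cdiff X n x)"
    and norm_nonneg: "x \<in> ccar X n \<Longrightarrow> cnorm X n x \<ge> 0"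
begin

lemma add_left_commute: "cadd X x (cadd X y z) = cadd X y (cadd X x z)"
  by (metis add_assoc add_commute)

lemma d_zero: "cdiff X n (czero X) = czero X"
  by (metis add_neg d_add d_smult)

lemma smult_zero: "csmult X k (czero X) = czero X"
proof -
  have "cadd X (csmult X k (czero X)) (csmult X k (czero X)) = csmult X k (czero X)"
    by (metis add_zero smult_add)
  then show ?thesis
    by (metis add_assoc add_neg add_zero)
qed

lemma coboundaries_closed: "b \<in> coboundaries X n \<Longrightarrow> b \<in> ccar X n"
  by (cases n) (auto simp: coboundaries_def zero_closed d_closed)

lemma coboundaries_zero: "czero X \<in> coboundaries X n"
  using d_zero zero_closed by (auto simp: coboundaries_def image_iff) metis

lemma coboundaries_add:
  "a \<in> coboundaries X n \<Longrightarrow> b \<in> coboundaries X n \<Longrightarrow> cadd X a b \<in> coboundaries X n"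
  by (auto simp: coboundaries_def add_zero add_closed simp flip: d_add split: if_splits)

lemma coboundaries_smult:
  "a \<in> coboundaries X n \<Longrightarrow> csmult X k a \<in> coboundaries X n"
  by (auto simp: coboundaries_def smult_zero smult_closed simp flip: d_smult split: if_splits)

lemma coh_coset_absorb:
  assumes "b \<in> coboundaries X n"
  shows "coh_coset X n (cadd X z b) = coh_coset X n z"
proof -
  have "\<exists>b'\<in>coboundaries X n. cadd X z a = cadd X (cadd X z b) b'" if "a \<in> coboundaries X n" for a
  proof (rule bexI)
    show "cadd X z a = cadd X (cadd X z b) (cadd X a (csmult X (-1) b))"
      by (metis add_assoc add_left_commute add_neg add_zero)
  qed (use that assms in \<open>auto intro: coboundaries_add coboundaries_smult\<close>)
  moreover have "\<exists>b'\<in>coboundaries X n. cadd X (cadd X z b) a = cadd X z b'" if "a \<in> coboundaries X n" for a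
    using that assms by (metis add_assoc coboundaries_add)
  ultimately show ?thesis
    unfolding coh_coset_def image_def by blast
qed

lemma coh_coset_self: "z \<in> coh_coset X n z"
  unfolding coh_coset_def by (rule image_eqI[of _ _ "czero X"]) (simp_all add: add_zero coboundaries_zero)

lemma coh_coset_eq: "z \<in> coh_coset X n x \<Longrightarrow> coh_coset X n z = coh_coset X n x"
  using coh_coset_absorb unfolding coh_coset_def image_def by blast

lemma cohom_closed: "c \<in> cohom X n \<Longrightarrow> x \<in> c \<Longrightarrow> x \<in> ccar X n"
  unfolding cohom_def coh_coset_def cocycles_def
  using add_closed coboundaries_closed by blast

lemma diff_closed: "x \<in> ccar X n \<Longrightarrow> y \<in> ccar X n \<Longrightarrow> cadd X x (csmult X (-1) y) \<in> ccar X n"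
  by (simp add: add_closed smult_closed)

end

lemma qadd_eq_UN: "qadd X c d = (\<Union>x\<in>c. cadd X x ` d)"
  by (auto simp: qadd_def)

lemma qsmult_eq_UN: "qsmult X n k c = (\<Union>x\<in>c. cadd X (csmult X k x) ` coboundaries X n)"
  by (auto simp: qsmult_def)

text \<open>The induced map is the direct image under \<open>F\<close>, so no representatives are
  chosen. Injectivity and the reverse norm estimate come from \<open>R\<close>, which inverts
  \<open>F\<close> exactly on one side and, on cocycles, up to a coboundary on the other. The linear
  laws for \<open>R\<close> are asked for on cochains only: spreading is compared through values on
  point masses, and these determine an element only when it is a cochain.\<close>

lemma top_iso_retract:
  fixes X :: "'c cochain_cx" and Y :: "'d cochain_cx"
  assumes "seminormed_cx X" and "seminormed_cx Y"
    and F_closed: "\<And>n x. x \<in> ccar X n \<Longrightarrow> F n x \<in> ccar Y n"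
    and F_add: "\<And>n x y. F n (cadd X x y) = cadd Y (F n x) (F n y)"
    and F_smult: "\<And>n k x. F n (csmult X k x) = csmult Y k (F n x)"
    and F_d: "\<And>n x. x \<in> ccar X n \<Longrightarrow> F (Suc n) (cdiff X n x) = cdiff Y n (F n x)"
    and F_norm: "\<And>n x. x \<in> ccar X n \<Longrightarrow> cnorm Y n (F n x) \<le> cnorm X n x"
    and R_closed: "\<And>n y. y \<in> ccar Y n \<Longrightarrow> R n y \<in> ccar X n"
    and R_add: "\<And>n x y. x \<in> ccar Y n \<Longrightarrow> y \<in> ccar Y n \<Longrightarrow> R n (cadd Y x y) = cadd X (R n x) (R n y)"
    and R_smult: "\<And>n k x. x \<in> ccar Y n \<Longrightarrow> R n (csmult Y k x) = csmult X k (R n x)"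
    and R_d: "\<And>n y. y \<in> ccar Y n \<Longrightarrow> R (Suc n) (cdiff Y n y) = cdiff X n (R n y)"
    and R_norm: "\<And>n y. y \<in> ccar Y n \<Longrightarrow> cnorm X n (R n y) \<le> cnorm Y n y"
    and F_R: "\<And>n y. y \<in> ccar Y n \<Longrightarrow> F n (R n y) = y"
    and R_F: "\<And>n z. z \<in> cocycles X n \<Longrightarrow> \<exists>b\<in>coboundaries X n. R n (F n z) = cadd X z b"
  shows "\<exists>T. top_iso X Y n T"
proof -
  interpret X: seminormed_cx X by fact
  interpret Y: seminormed_cx Y by fact
  have F_zero: "F m (czero X) = czero Y" for m
    by (metis F_add F_smult X.add_neg Y.add_neg)
  have R_zero: "R m (czero Y) = czero X" for m
    by (metis R_add R_smult X.add_neg Y.add_neg Y.smult_closed Y.zero_closed)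
  \<comment> \<open>Equality and not just inclusion: \<open>cdiff Y m y\<close> is the image of
    \<open>cdiff X m (R m y)\<close>. Hence \<open>F\<close> carries whole cosets onto whole
    cosets.\<close>
  have F_cob: "F n ` coboundaries X n = coboundaries Y n"
  proof (cases n)
    case 0
    then show ?thesis by (simp add: coboundaries_def F_zero)
  next
    case (Suc m)
    have "cdiff Y m y \<in> F n ` coboundaries X n" if "y \<in> ccar Y m" for y
      using that R_closed[OF that] F_d[of "R m y" m] F_R[OF that] Suc
      by (simp add: coboundaries_def image_image) (metis image_eqI)
    then show ?thesis
      using Suc F_d F_closed by (auto simp: coboundaries_def)
  qed
  have R_cob: "R n b \<in> coboundaries X n" if "b \<in> coboundaries Y n" for b
    using that R_closed by (cases n) (auto simp: coboundaries_def R_zero R_d)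
  have F_coset: "F n ` coh_coset X n z = coh_coset Y n (F n z)" for z
    unfolding coh_coset_def F_cob[symmetric] by (simp add: image_image F_add)
  have cocycles_closed: "z \<in> cocycles X n \<Longrightarrow> z \<in> ccar X n" for z
    by (simp add: cocycles_def)
  have F_cocycle: "F n z \<in> cocycles Y n" if "z \<in> cocycles X n" for z
    using that F_closed F_d F_zero unfolding cocycles_def by (metis (mono_tags) mem_Collect_eq)
  have R_cocycle: "R n z \<in> cocycles X n" if "z \<in> cocycles Y n" for z
    using that R_closed R_d R_zero unfolding cocycles_def by (metis (mono_tags) mem_Collect_eq)
  \<comment> \<open>\<open>R n\<close> may send a coset of \<open>Y\<close> into a proper part of a
    coset of \<open>X\<close>. What counts is that \<open>R n\<close> after \<open>F n\<close> stays
    in each class, by \<open>R_F\<close> and because both maps preserve coboundaries.\<close>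
  have RF: "R n (F n x) \<in> c" if c: "c \<in> cohom X n" and x: "x \<in> c" for c x
  proof -
    obtain z where z: "z \<in> cocycles X n" "c = coh_coset X n z"
      using c by (auto simp: cohom_def)
    then obtain b where b: "b \<in> coboundaries X n" "x = cadd X z b"
      using x by (auto simp: coh_coset_def)
    obtain b' where b': "b' \<in> coboundaries X n" "R n (F n z) = cadd X z b'"
      using R_F z by blast
    have "F n b \<in> coboundaries Y n"
      using b F_cob by blast
    moreover have "R n (F n x) = cadd X z (cadd X b' (R n (F n b)))"
      using b b' z cocycles_closed X.coboundaries_closed by (simp add: F_add R_add F_closed X.add_assoc)
    ultimately show ?thesis
      using z b' R_cob X.coboundaries_add by (auto simp: coh_coset_def)
  qed
  let ?T = "\<lambda>c. F n ` c"
  have maps: "?T c \<in> cohom Y n" if "c \<in> cohom X n" for c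
    using that F_cocycle by (auto simp: cohom_def F_coset)
  \<comment> \<open>A class is the coset of \<open>R n y\<close> for any point \<open>y\<close> of
    its image, which yields injectivity.\<close>
  have recover: "c = coh_coset X n (R n y)" if "c \<in> cohom X n" "y \<in> ?T c" for c y
    using that RF X.coh_coset_eq unfolding cohom_def by blast
  have nonempty: "c \<noteq> {}" if "c \<in> cohom X n" for c
    using that X.coh_coset_self by (auto simp: cohom_def)
  have "inj_on ?T (cohom X n)"
  proof (rule inj_onI)
    fix c d assume "c \<in> cohom X n" "d \<in> cohom X n" "?T c = ?T d"
    then show "c = d" using recover nonempty by (metis ex_in_conv image_is_empty)
  qed
  moreover have "cohom Y n \<subseteq> ?T ` cohom X n"
  proof
    fix e assume "e \<in> cohom Y n"
    then obtain y where y: "y \<in> cocycles Y n" "e = coh_coset Y n y"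
      by (auto simp: cohom_def)
    then have "e = ?T (coh_coset X n (R n y))"
      using F_R by (simp add: F_coset cocycles_def)
    then show "e \<in> ?T ` cohom X n"
      using R_cocycle y by (auto simp: cohom_def)
  qed
  ultimately have bij: "bij_betw ?T (cohom X n) (cohom Y n)"
    using maps by (auto simp: bij_betw_def)
  have add: "?T (qadd X c d) = qadd Y (?T c) (?T d)" for c d
    by (simp add: qadd_eq_UN image_UN image_image F_add)
  have smult: "?T (qsmult X n k c) = qsmult Y n k (?T c)" for k c
    unfolding qsmult_eq_UN F_cob[symmetric] image_UN image_image F_add F_smult by simp
  have le1: "qdist Y n (?T d) (?T c) \<le> qdist X n d c"
    if c: "c \<in> cohom X n" and d: "d \<in> cohom X n" for c d
    unfolding qdist_def
  proof (rule cInf_mono)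
    show "{cnorm X n (cadd X x (csmult X (- 1) y)) |x y. x \<in> d \<and> y \<in> c} \<noteq> {}"
      using nonempty[OF c] nonempty[OF d] by auto
    \<comment> \<open>Infima can be compared only for sets bounded below; nonnegativity of the norm
      on cochains provides the bound 0.\<close>
    show "bdd_below {cnorm Y n (cadd Y x (csmult Y (- 1) y)) |x y. x \<in> ?T d \<and> y \<in> ?T c}"
      using Y.norm_nonneg Y.diff_closed F_closed X.cohom_closed c d
      by (intro bdd_belowI[of _ 0]) blast
    fix r assume "r \<in> {cnorm X n (cadd X x (csmult X (- 1) y)) |x y. x \<in> d \<and> y \<in> c}"
    then obtain x y where xy: "x \<in> d" "y \<in> c" "r = cnorm X n (cadd X x (csmult X (- 1) y))"
      by blast
    have "cnorm Y n (cadd Y (F n x) (csmult Y (- 1) (F n y))) \<le> r"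
      using F_norm[OF X.diff_closed, OF X.cohom_closed[OF d] X.cohom_closed[OF c], of x y] xy
      by (simp add: F_add F_smult)
    then show "\<exists>r'\<in>{cnorm Y n (cadd Y x (csmult Y (- 1) y)) |x y. x \<in> ?T d \<and> y \<in> ?T c}. r' \<le> r"
      using xy by blast
  qed
  have le2: "qdist X n d c \<le> qdist Y n (?T d) (?T c)"
    if c: "c \<in> cohom X n" and d: "d \<in> cohom X n" for c d
    unfolding qdist_def
  proof (rule cInf_mono)
    show "{cnorm Y n (cadd Y x (csmult Y (- 1) y)) |x y. x \<in> ?T d \<and> y \<in> ?T c} \<noteq> {}"
      using nonempty[OF c] nonempty[OF d] by auto
    show "bdd_below {cnorm X n (cadd X x (csmult X (- 1) y)) |x y. x \<in> d \<and> y \<in> c}"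
      using X.norm_nonneg X.diff_closed X.cohom_closed c d
      by (intro bdd_belowI[of _ 0]) blast
    fix r assume "r \<in> {cnorm Y n (cadd Y x (csmult Y (- 1) y)) |x y. x \<in> ?T d \<and> y \<in> ?T c}"
    then obtain x y where xy: "x \<in> d" "y \<in> c" "r = cnorm Y n (cadd Y (F n x) (csmult Y (- 1) (F n y)))"
      by blast
    have closed: "F n x \<in> ccar Y n" "F n y \<in> ccar Y n"
      using xy F_closed X.cohom_closed c d by blast+
    have "cnorm X n (cadd X (R n (F n x)) (csmult X (- 1) (R n (F n y)))) \<le> r"
      using R_norm[OF Y.diff_closed, OF closed] xy closed
      by (simp add: R_add R_smult Y.smult_closed)
    then show "\<exists>r'\<in>{cnorm X n (cadd X x (csmult X (- 1) y)) |x y. x \<in> d \<and> y \<in> c}. r' \<le> r"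
      using xy RF c d by blast
  qed
  \<comment> \<open>Since distances do not grow in either direction, \<delta> = e serves in both
    continuity clauses.\<close>
  have "top_iso X Y n ?T"
    unfolding top_iso_def using bij add smult le1 le2 by (meson order_le_less_trans)
  then show ?thesis by (rule exI[of "top_iso X Y n"])
qed

section \<open>Summable families\<close>

definition delta :: "'a \<Rightarrow> 'a \<Rightarrow> complex"
  where "delta x = (\<lambda>y. if y = x then 1 else 0)"

lemma l1I: "(\<And>x. x \<notin> X \<Longrightarrow> f x = 0) \<Longrightarrow> (\<lambda>x. norm (f x)) summable_on X \<Longrightarrow> f \<in> l1 X"
  and l1_outside: "f \<in> l1 X \<Longrightarrow> x \<notin> X \<Longrightarrow> f x = 0"
  and l1_abs_summable: "f \<in> l1 X \<Longrightarrow> (\<lambda>x. norm (f x)) summable_on X"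
  by (auto simp: l1_def)

lemma l1_summable: "f \<in> l1 X \<Longrightarrow> f summable_on X"
  by (simp add: abs_summable_summable l1_abs_summable)

lemma l1_add: "f \<in> l1 X \<Longrightarrow> g \<in> l1 X \<Longrightarrow> (\<lambda>x. f x + g x) \<in> l1 X"
  by (rule l1I, simp add: l1_outside)
    (rule Infinite_Sum.abs_summable_on_comparison_test'[OF summable_on_add[OF l1_abs_summable[of f] l1_abs_summable[of g]]],
      auto intro: norm_triangle_ineq)

lemma l1_smult: "f \<in> l1 X \<Longrightarrow> (\<lambda>x. c * f x) \<in> l1 X"
  by (rule l1I) (auto simp: norm_mult l1_outside intro!: summable_on_cmult_right l1_abs_summable)

lemma l1_zero: "(\<lambda>x. 0) \<in> l1 X"
  by (simp add: l1_def)

lemma l1_linear: "f \<in> l1 X \<Longrightarrow> g \<in> l1 X \<Longrightarrow> (\<lambda>x. f x + c * g x) \<in> l1 X"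
  by (intro l1_add l1_smult)

lemma l1_mono: "f \<in> l1 X \<Longrightarrow> X \<subseteq> Y \<Longrightarrow> f \<in> l1 Y"
  using summable_on_cong_neutral[of Y X "\<lambda>x. norm (f x)" "\<lambda>x. norm (f x)"]
  by (auto simp: l1_def)

lemma l1norm_mono: "f \<in> l1 X \<Longrightarrow> X \<subseteq> Y \<Longrightarrow> l1norm Y f = l1norm X f"
  unfolding l1norm_def by (intro infsum_cong_neutral) (auto simp: l1_outside)

lemma augm_mono: "f \<in> l1 X \<Longrightarrow> X \<subseteq> Y \<Longrightarrow> augm Y f = augm X f"
  unfolding augm_def by (intro infsum_cong_neutral) (auto simp: l1_outside)

lemma l1norm_nonneg: "0 \<le> l1norm X f"
  by (simp add: l1norm_def infsum_nonneg)

lemma l1norm_smult: "l1norm X (\<lambda>x. c * f x) = norm c * l1norm X f"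
  by (simp add: l1norm_def norm_mult infsum_cmult_right')

lemma norm_augm_le: "f \<in> l1 X \<Longrightarrow> norm (augm X f) \<le> l1norm X f"
  unfolding augm_def l1norm_def by (simp add: l1_abs_summable norm_infsum_bound)

lemma augm_linear:
  "f \<in> l1 X \<Longrightarrow> g \<in> l1 X \<Longrightarrow> augm X (\<lambda>x. f x + c * g x) = augm X f + c * augm X g"
  unfolding augm_def
  by (simp add: infsum_add l1_summable summable_on_cmult_right infsum_cmult_right')

lemma delta_l1: "x \<in> X \<Longrightarrow> delta x \<in> l1 X"
  by (rule l1I, force simp: delta_def)
    (auto intro!: finite_nonzero_values_imp_summable_on finite_subset[of _ "{x}"] simp: delta_def split: if_splits)

lemma infsum_delta:
  fixes f :: "'a \<Rightarrow> 'b :: {semiring_1, topological_comm_monoid_add, t2_space}"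
  assumes "x \<in> X" and "\<And>y. y \<in> X \<Longrightarrow> y \<noteq> x \<Longrightarrow> f y = 0"
  shows "infsum f X = f x"
proof -
  have "infsum f X = infsum f {x}"
    using assms by (intro infsum_cong_neutral) auto
  then show ?thesis by simp
qed

lemma l1norm_delta: "x \<in> X \<Longrightarrow> l1norm X (delta x) = 1"
  unfolding l1norm_def by (subst infsum_delta[of x]) (auto simp: delta_def)

lemma augm_delta: "x \<in> X \<Longrightarrow> augm X (delta x) = 1"
  unfolding augm_def by (subst infsum_delta[of x]) (auto simp: delta_def)

text \<open>Finite linear combinations of point masses are dense in \<open>\<ell>\<^sup>1\<close>.\<close>

lemma l1_functional_eq_0:
  assumes f: "f \<in> l1 X"
    and lin: "\<And>f g c. f \<in> l1 X \<Longrightarrow> g \<in> l1 X \<Longrightarrow> u (\<lambda>x. f x + c * g x) = u f + c * u g"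
    and bound: "\<And>f. f \<in> l1 X \<Longrightarrow> norm (u f) \<le> C * l1norm X f"
    and zero: "\<And>x. x \<in> X \<Longrightarrow> u (delta x) = 0"
  shows "u f = (0 :: complex)"
proof (rule ccontr)
  assume neq: "u f \<noteq> 0"
  have u0: "u (\<lambda>x. 0) = 0"
    using lin[of "\<lambda>x. 0" "\<lambda>x. 0" 1] by (simp add: l1_zero)
  have fin: "u (\<lambda>x. if x \<in> F then f x else 0) = 0 \<and> (\<lambda>x. if x \<in> F then f x else 0) \<in> l1 X"
    if "finite F" "F \<subseteq> X" for F
    using that
  proof (induction rule: finite_induct)
    case empty
    then show ?case by (simp add: u0 l1_zero)
  next
    case (insert y F)
    have "(\<lambda>x. if x \<in> insert y F then f x else 0) = (\<lambda>x. (if x \<in> F then f x else 0) + f y * delta y x)"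
      using insert by (auto simp: delta_def)
    then show ?case
      using insert by (simp add: lin zero delta_l1 l1_linear)
  qed
  \<comment> \<open>Chosen so that \<open>(\<bar>C\<bar> + 1) * e\<close> is exactly
    \<open>norm (u f)\<close>, which a tail of norm below \<open>e\<close> then contradicts. The
    absolute value and the summand 1 keep the divisor positive. The approximation below is taken
    with \<open>e / 2\<close> because it is not strict.\<close>
  define e where "e = norm (u f) / (\<bar>C\<bar> + 1)"
  have "e > 0" using neq by (simp add: e_def add_pos_nonneg)
  then obtain F where F: "finite F" "F \<subseteq> X"
    and close: "dist (sum (\<lambda>x. norm (f x)) F) (l1norm X f) \<le> e / 2"
    using infsum_finite_approximation[OF l1_abs_summable[OF f], of "e / 2"]
    unfolding l1norm_def by auto
  define h where "h = (\<lambda>x. if x \<in> F then f x else 0)"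
  define r where "r = (\<lambda>x. f x + (-1) * h x)"
  have h: "u h = 0" "h \<in> l1 X" using fin[OF F] by (auto simp: h_def)
  have r: "r \<in> l1 X" unfolding r_def by (rule l1_linear[OF f h(2)])
  have "u r = u f" unfolding r_def using lin[OF f h(2), of "-1"] h by simp
  \<comment> \<open>\<open>h\<close> and \<open>r\<close> have disjoint supports, so the norms add
    exactly and the norm of the tail \<open>r\<close> is the error of the finite
    approximation.\<close>
  have "l1norm X f = (\<Sum>\<^sub>\<infinity>x\<in>X. norm (h x) + norm (r x))"
    unfolding l1norm_def by (intro infsum_cong) (auto simp: h_def r_def)
  also have "\<dots> = l1norm X h + l1norm X r"
    unfolding l1norm_def by (intro infsum_add l1_abs_summable h r)
  also have "l1norm X h = (\<Sum>x\<in>F. norm (f x))"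
  proof -
    have "l1norm X h = infsum (\<lambda>x. norm (f x)) F"
      unfolding l1norm_def using F by (intro infsum_cong_neutral) (auto simp: h_def)
    then show ?thesis using F by simp
  qed
  finally have "l1norm X r \<le> e / 2"
    using close by (simp add: dist_real_def)
  then have "l1norm X r < e" using \<open>e > 0\<close> by simp
  have "norm (u f) \<le> C * l1norm X r"
    using bound[OF r] \<open>u r = u f\<close> by simp
  also have "\<dots> \<le> (\<bar>C\<bar> + 1) * l1norm X r"
    by (intro mult_right_mono l1norm_nonneg) simp
  also have "\<dots> < (\<bar>C\<bar> + 1) * e"
    using \<open>l1norm X r < e\<close> by (intro mult_strict_left_mono) auto
  also have "\<dots> = norm (u f)"
    by (simp add: e_def add_nonneg_eq_0_iff)
  finally show False by simp
qed

section \<open>Absolute summability over products and finite powers\<close>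

lemma abs_summable_times:
  fixes f :: "'a \<Rightarrow> real" and g :: "'b \<Rightarrow> real"
  assumes "f summable_on A" and "g summable_on B"
    and "\<And>x. x \<in> A \<Longrightarrow> f x \<ge> 0" and "\<And>x. x \<in> B \<Longrightarrow> g x \<ge> 0"
  shows "(\<lambda>(x, y). f x * g y) summable_on A \<times> B"
    and "(\<Sum>\<^sub>\<infinity>(x, y)\<in>A \<times> B. f x * g y) = infsum f A * infsum g B"
proof -
  have "(\<lambda>p. norm (case p of (x, y) \<Rightarrow> f x * g y)) summable_on A \<times> B"
    unfolding Infinite_Sum.abs_summable_on_Sigma_iff
  proof (intro conjI ballI)
    fix x assume "x \<in> A"
    have "(\<lambda>y. f x * g y) summable_on B"
      by (intro summable_on_cmult_right assms)
    then show "(\<lambda>y. norm (case (x, y) of (x, y) \<Rightarrow> f x * g y)) summable_on B"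
      using summable_on_iff_abs_summable_on_real[of "\<lambda>y. f x * g y"] by simp
  next
    have "(\<lambda>x. f x * infsum g B) summable_on A"
      by (intro summable_on_cmult_left assms)
    then have "(\<lambda>x. \<Sum>\<^sub>\<infinity>y\<in>B. norm (f x * g y)) summable_on A"
      by (rule summable_on_cong[THEN iffD1, rotated])
        (use assms in \<open>auto simp: abs_mult infsum_cmult_right' intro!: infsum_cong\<close>)
    then show "(\<lambda>x. norm (\<Sum>\<^sub>\<infinity>y\<in>B. norm (case (x, y) of (x, y) \<Rightarrow> f x * g y))) summable_on A"
      using summable_on_iff_abs_summable_on_real by (auto simp: infsum_nonneg)
  qed
  then show s: "(\<lambda>(x, y). f x * g y) summable_on A \<times> B"
    using summable_on_iff_abs_summable_on_real by auto
  have "(\<Sum>\<^sub>\<infinity>(x, y)\<in>A \<times> B. f x * g y) = (\<Sum>\<^sub>\<infinity>x\<in>A. \<Sum>\<^sub>\<infinity>y\<in>B. f x * g y)"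
    using infsum_Sigma'_banach[OF s] by simp
  then show "(\<Sum>\<^sub>\<infinity>(x, y)\<in>A \<times> B. f x * g y) = infsum f A * infsum g B"
    by (simp add: infsum_cmult_right' infsum_cmult_left')
qed

text \<open>A finite set of tuples lies in the box formed by its coordinate projections. Over that
  box the sum of products is a product of finite sums, each at most the total
  \<open>infsum (f i) (B i)\<close>, and this bounds all partial sums at once.\<close>

lemma summable_prod_PiE:
  fixes f :: "nat \<Rightarrow> 'a \<Rightarrow> real"
  assumes "\<And>i. i < n \<Longrightarrow> f i summable_on B i" and "\<And>i x. i < n \<Longrightarrow> x \<in> B i \<Longrightarrow> f i x \<ge> 0"
  shows "(\<lambda>g. \<Prod>i<n. f i (g i)) summable_on (PiE {..<n} B)"
proof (rule nonneg_bdd_above_summable_on)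
  show "0 \<le> (\<Prod>i<n. f i (g i))" if "g \<in> PiE {..<n} B" for g
    using that assms(2) by (intro prod_nonneg) auto
  show "bdd_above (sum (\<lambda>g. \<Prod>i<n. f i (g i)) ` {F. F \<subseteq> PiE {..<n} B \<and> finite F})"
  proof (rule bdd_aboveI2)
    fix F assume F: "F \<in> {F. F \<subseteq> PiE {..<n} B \<and> finite F}"
    have FB: "h i \<in> B i" if "h \<in> F" "i < n" for h i
    proof -
      have "h \<in> PiE {..<n} B" using F that(1) by auto
      then show ?thesis by (rule PiE_mem) (simp add: that(2))
    qed
    let ?P = "PiE {..<n} (\<lambda>i. (\<lambda>g. g i) ` F)"
    have fin: "finite ?P" using F by (intro finite_PiE) auto
    have "(\<Sum>g\<in>F. \<Prod>i<n. f i (g i)) \<le> (\<Sum>g\<in>?P. \<Prod>i<n. f i (g i))"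
    proof (rule sum_mono2[OF fin])
      show "F \<subseteq> ?P" using F by (auto simp: PiE_def Pi_def)
      show "0 \<le> (\<Prod>i<n. f i (g i))" if "g \<in> ?P - F" for g
      proof (intro prod_nonneg ballI)
        fix i assume i: "i \<in> {..<n}"
        then have "g i \<in> (\<lambda>g. g i) ` F" using that PiE_mem[of g "{..<n}"] by blast
        then have "g i \<in> B i" using FB i by auto
        then show "0 \<le> f i (g i)" using assms(2) i by simp
      qed
    qed
    also have "\<dots> = (\<Prod>i<n. \<Sum>x\<in>(\<lambda>g. g i) ` F. f i x)"
      using F by (subst prod_sum_PiE) auto
    also have "\<dots> \<le> (\<Prod>i<n. infsum (f i) (B i))"
    proof (rule prod_mono)
      fix i assume i: "i \<in> {..<n}"
      have "(\<lambda>g. g i) ` F \<subseteq> B i" using FB i by auto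
      then show "0 \<le> (\<Sum>x\<in>(\<lambda>g. g i) ` F. f i x) \<and> (\<Sum>x\<in>(\<lambda>g. g i) ` F. f i x) \<le> infsum (f i) (B i)"
        using F i assms by (auto intro!: sum_nonneg finite_sum_le_infsum)
    qed
    finally show "(\<Sum>g\<in>F. \<Prod>i<n. f i (g i)) \<le> (\<Prod>i<n. infsum (f i) (B i))" .
  qed
qed

subsection \<open>The action on summable families\<close>

text \<open>This bijectivity is what the estimates for \<open>l1S_lact\<close> rest on. Left
  multiplication of a group on itself has it too, and there \<open>l1S_lact\<close> is convolution,
  so one set of lemmas serves both the module and the algebra.\<close>

locale bij_family =
  fixes G :: "('g, 'z) monoid_scheme" and S :: "'b set" and \<phi> :: "'g \<Rightarrow> 'b \<Rightarrow> 'b"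
  assumes bij: "g \<in> carrier G \<Longrightarrow> bij_betw (\<phi> (inv\<^bsub>G\<^esub> g)) S S"
begin

text \<open>The shear sending (g, t) to (g, inv g . t) permutes \<open>carrier G \<times> S\<close>
  and turns the family into a product of two summable families of norms.\<close>

lemma summable_act:
  assumes a: "a \<in> l1 (carrier G)" and \<xi>: "\<xi> \<in> l1 S"
  shows "(\<lambda>(g, t). norm (a g * \<xi> (\<phi> (inv\<^bsub>G\<^esub> g) t))) summable_on carrier G \<times> S"
    and "(\<Sum>\<^sub>\<infinity>(g, t)\<in>carrier G \<times> S. norm (a g * \<xi> (\<phi> (inv\<^bsub>G\<^esub> g) t))) = l1norm (carrier G) a * l1norm S \<xi>"
proof -
  let ?f = "\<lambda>(g, t). norm (a g) * norm (\<xi> t)" and ?h = "\<lambda>(g, t). (g, \<phi> (inv\<^bsub>G\<^esub> g) t)"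
  have bij2: "bij_betw ?h (carrier G \<times> S) (carrier G \<times> S)"
  proof -
    have "inj_on ?h (carrier G \<times> S)"
      using bij by (auto simp: inj_on_def bij_betw_def)
    moreover have "?h ` (carrier G \<times> S) = (\<Union>g\<in>carrier G. Pair g ` (\<phi> (inv\<^bsub>G\<^esub> g) ` S))"
      by auto
    moreover have "\<dots> = carrier G \<times> S"
      using bij by (simp add: bij_betw_def) auto
    ultimately show ?thesis by (simp add: bij_betw_def)
  qed
  have eq: "(\<lambda>(g, t). norm (a g * \<xi> (\<phi> (inv\<^bsub>G\<^esub> g) t))) = (\<lambda>p. ?f (?h p))"
    by (auto simp: norm_mult)
  show "(\<lambda>(g, t). norm (a g * \<xi> (\<phi> (inv\<^bsub>G\<^esub> g) t))) summable_on carrier G \<times> S"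
    unfolding eq summable_on_reindex_bij_betw[OF bij2, of ?f]
    by (intro abs_summable_times l1_abs_summable a \<xi>) auto
  show "(\<Sum>\<^sub>\<infinity>(g, t)\<in>carrier G \<times> S. norm (a g * \<xi> (\<phi> (inv\<^bsub>G\<^esub> g) t))) = l1norm (carrier G) a * l1norm S \<xi>"
    unfolding eq infsum_reindex_bij_betw[OF bij2, of ?f] l1norm_def
    by (intro abs_summable_times l1_abs_summable a \<xi>) auto
qed

lemma summable_act_at:
  assumes "a \<in> l1 (carrier G)" and "\<xi> \<in> l1 S" and "t \<in> S"
  shows "(\<lambda>g. norm (a g * \<xi> (\<phi> (inv\<^bsub>G\<^esub> g) t))) summable_on carrier G"
proof -
  have "(\<lambda>p. norm (case p of (t, g) \<Rightarrow> a g * \<xi> (\<phi> (inv\<^bsub>G\<^esub> g) t))) summable_on (S \<times> carrier G)"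
    using summable_act(1)[OF assms(1,2)] by (subst summable_on_swap) (simp add: case_prod_unfold)
  then show ?thesis
    unfolding Infinite_Sum.abs_summable_on_Sigma_iff using assms(3) by auto
qed

text \<open>The norm of the value at t is at most the row sum over g. By Tonelli the row sums are
  summable, with total the double sum of \<open>summable_act\<close>.\<close>

lemma l1S_lact_l1:
  assumes a: "a \<in> l1 (carrier G)" and \<xi>: "\<xi> \<in> l1 S"
  shows "l1S_lact G S \<phi> a \<xi> \<in> l1 S"
    and "l1norm S (l1S_lact G S \<phi> a \<xi>) \<le> l1norm (carrier G) a * l1norm S \<xi>"
proof -
  let ?N = "\<lambda>t g. norm (a g * \<xi> (\<phi> (inv\<^bsub>G\<^esub> g) t))"
  have s: "(\<lambda>(t, g). ?N t g) summable_on (S \<times> carrier G)"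
    using summable_act(1)[OF a \<xi>] by (subst summable_on_swap) (simp add: case_prod_unfold)
  have s': "(\<lambda>t. infsum (?N t) (carrier G)) summable_on S"
    using summable_on_Sigma_banach[OF s] by simp
  have le: "norm (l1S_lact G S \<phi> a \<xi> t) \<le> infsum (?N t) (carrier G)" if "t \<in> S" for t
    using that norm_infsum_bound[OF summable_act_at[OF a \<xi> that]] by (simp add: l1S_lact_def)
  show *: "l1S_lact G S \<phi> a \<xi> \<in> l1 S"
    by (rule l1I[OF _ Infinite_Sum.abs_summable_on_comparison_test'[OF s' le]]) (auto simp: l1S_lact_def)
  have "l1norm S (l1S_lact G S \<phi> a \<xi>) \<le> (\<Sum>\<^sub>\<infinity>t\<in>S. infsum (?N t) (carrier G))"
    unfolding l1norm_def by (intro infsum_mono l1_abs_summable * s' le)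
  also have "\<dots> = (\<Sum>\<^sub>\<infinity>(t, g)\<in>S \<times> carrier G. ?N t g)"
    using infsum_Sigma'_banach[OF s] by simp
  also have "\<dots> = (\<Sum>\<^sub>\<infinity>(g, t)\<in>carrier G \<times> S. ?N t g)"
    by (rule infsum_reindex_bij_witness[of _ prod.swap prod.swap]) auto
  finally show "l1norm S (l1S_lact G S \<phi> a \<xi>) \<le> l1norm (carrier G) a * l1norm S \<xi>"
    using summable_act(2)[OF a \<xi>] by simp
qed

lemma l1S_lact_linear_left:
  assumes "a \<in> l1 (carrier G)" "b \<in> l1 (carrier G)" "\<xi> \<in> l1 S"
  shows "l1S_lact G S \<phi> (\<lambda>g. a g + c * b g) \<xi> =
    (\<lambda>t. l1S_lact G S \<phi> a \<xi> t + c * l1S_lact G S \<phi> b \<xi> t)"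
proof
  fix t
  have s: "(\<lambda>g. a g * \<xi> (\<phi> (inv\<^bsub>G\<^esub> g) t)) summable_on carrier G"
    "(\<lambda>g. b g * \<xi> (\<phi> (inv\<^bsub>G\<^esub> g) t)) summable_on carrier G" if "t \<in> S"
    by (auto intro!: abs_summable_summable[OF summable_act_at] assms that)
  show "l1S_lact G S \<phi> (\<lambda>g. a g + c * b g) \<xi> t = l1S_lact G S \<phi> a \<xi> t + c * l1S_lact G S \<phi> b \<xi> t"
    using s by (auto simp: l1S_lact_def infsum_add summable_on_cmult_right algebra_simps
        simp flip: infsum_cmult_right')
qed

lemma l1S_lact_linear_right:
  assumes "a \<in> l1 (carrier G)" "\<xi> \<in> l1 S" "\<eta> \<in> l1 S"
  shows "l1S_lact G S \<phi> a (\<lambda>t. \<xi> t + c * \<eta> t) =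
    (\<lambda>t. l1S_lact G S \<phi> a \<xi> t + c * l1S_lact G S \<phi> a \<eta> t)"
proof
  fix t
  have s: "(\<lambda>g. a g * \<xi> (\<phi> (inv\<^bsub>G\<^esub> g) t)) summable_on carrier G"
    "(\<lambda>g. a g * \<eta> (\<phi> (inv\<^bsub>G\<^esub> g) t)) summable_on carrier G" if "t \<in> S"
    by (auto intro!: abs_summable_summable[OF summable_act_at] assms that)
  show "l1S_lact G S \<phi> a (\<lambda>t. \<xi> t + c * \<eta> t) t = l1S_lact G S \<phi> a \<xi> t + c * l1S_lact G S \<phi> a \<eta> t"
    using s by (auto simp: l1S_lact_def infsum_add summable_on_cmult_right algebra_simps
        simp flip: infsum_cmult_right')
qed

end

lemma (in group) bij_family_mult: "bij_family G (carrier G) (\<lambda>g h. g \<otimes> h)"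
  by unfold_locales (simp add: bij_betw_def inj_on_cmult surj_const_mult)

lemma conv_eq_l1S_lact: "conv G = l1S_lact G (carrier G) (\<lambda>g h. g \<otimes>\<^bsub>G\<^esub> h)"
  by (simp add: conv_def l1S_lact_def fun_eq_iff)

lemmas (in group) conv_l1 = bij_family.l1S_lact_l1[OF bij_family_mult, folded conv_eq_l1S_lact]
  and conv_linear_left = bij_family.l1S_lact_linear_left[OF bij_family_mult, folded conv_eq_l1S_lact]
  and conv_linear_right = bij_family.l1S_lact_linear_right[OF bij_family_mult, folded conv_eq_l1S_lact]

text \<open>\<open>conv G\<close> sums over all of \<open>carrier G\<close> even in
  \<open>l1alg G H\<close>. At a point outside \<open>H\<close> each term has a vanishing factor,
  because a product of two elements of \<open>H\<close> lies in \<open>H\<close>.\<close>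

lemma (in group) conv_l1_subgroup:
  assumes H: "subgroup H G" and a: "a \<in> l1 H" and b: "b \<in> l1 H"
  shows "conv G a b \<in> l1 H"
proof -
  have sub: "H \<subseteq> carrier G" by (rule subgroup.subset[OF H])
  have "conv G a b x = 0" if x: "x \<notin> H" for x
  proof -
    have "a h * b (inv h \<otimes> x) = 0" if "h \<in> carrier G" "x \<in> carrier G" for h
    proof (cases "h \<in> H \<and> inv h \<otimes> x \<in> H")
      case True
      then have "h \<otimes> (inv h \<otimes> x) \<in> H" using H by (meson subgroup.m_closed)
      then show ?thesis using x that by (simp flip: m_assoc)
    next
      case False
      then show ?thesis using l1_outside[OF a] l1_outside[OF b] by auto
    qed
    then show ?thesis by (simp add: conv_def infsum_0)
  qed
  moreover have "(\<lambda>x. norm (conv G a b x)) summable_on H"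
    by (rule summable_on_subset_banach[OF l1_abs_summable[OF conv_l1(1)[OF l1_mono[OF a sub] l1_mono[OF b sub]]] sub])
  ultimately show ?thesis by (rule l1I)
qed

lemma (in group) conv_delta:
  assumes "g \<in> carrier G" "h \<in> carrier G"
  shows "conv G (delta g) (delta h) = delta (g \<otimes> h)"
proof
  fix x
  have "(\<Sum>\<^sub>\<infinity>k\<in>carrier G. delta g k * delta h (inv k \<otimes> x)) = delta h (inv g \<otimes> x)"
    using assms by (subst infsum_delta[of g]) (auto simp: delta_def)
  moreover have "inv g \<otimes> x = h \<longleftrightarrow> x = g \<otimes> h" if "x \<in> carrier G"
    using assms that by (auto simp flip: m_assoc)
  ultimately show "conv G (delta g) (delta h) x = delta (g \<otimes> h) x"
    using assms by (auto simp: conv_def delta_def[of h] delta_def[of "g \<otimes> h"])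
qed

context group_action
begin

sublocale bij_family G E \<phi>
proof
  fix g assume "g \<in> carrier G"
  then have "inv g \<in> carrier G"
    using group_hom group_hom.axioms(1) group.inv_closed by metis
  then show "bij_betw (\<phi> (inv g)) E E"
    using bij_prop0 by (auto simp: Bij_def)
qed

lemma l1S_lact_delta:
  assumes "g \<in> carrier G" "s \<in> E"
  shows "l1S_lact G E \<phi> (delta g) (delta s) = delta (\<phi> g s)"
proof
  fix t
  have inv: "\<phi> (inv g) t = s \<longleftrightarrow> t = \<phi> g s" if "t \<in> E"
  proof -
    have "inv g \<in> carrier G" "inv (inv g) = g"
      using assms group_hom group_hom.axioms(1) group.inv_closed group.inv_inv by metis+
    then show ?thesis
      using assms that orbit_sym_aux element_image by metis
  qed
  have "(\<Sum>\<^sub>\<infinity>k\<in>carrier G. delta g k * delta s (\<phi> (inv k) t)) = delta s (\<phi> (inv g) t)"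
    using assms by (subst infsum_delta[of g]) (auto simp: delta_def)
  then show "l1S_lact G E \<phi> (delta g) (delta s) t = delta (\<phi> g s) t"
    using assms inv element_image[OF assms refl] by (auto simp: l1S_lact_def delta_def)
qed

text \<open>Elements of the stabilizer fix the point mass at \<open>x\<close>, so only the total
  mass of \<open>a\<close> remains. This is why evaluation at \<open>delta x\<close> turns the dual
  module into the augmentation module \<open>Cmod\<close>.\<close>

lemma l1S_lact_stabilizer:
  assumes "x \<in> E" "a \<in> l1 (stabilizer G \<phi> x)"
  shows "l1S_lact G E \<phi> a (delta x) = (\<lambda>t. augm (stabilizer G \<phi> x) a * delta x t)"
proof
  fix t
  have sub: "stabilizer G \<phi> x \<subseteq> carrier G" by (auto simp: stabilizer_def)
  have eq: "\<phi> (inv h) t = x \<longleftrightarrow> t = x" if "h \<in> stabilizer G \<phi> x" "t \<in> E" for h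
  proof -
    have h: "h \<in> carrier G" "\<phi> h x = x" using that by (auto simp: stabilizer_def)
    then have "inv h \<in> carrier G" "inv (inv h) = h"
      using group_hom group_hom.axioms(1) group.inv_closed group.inv_inv by metis+
    then show ?thesis
      using h assms that orbit_sym_aux by metis
  qed
  have "(\<Sum>\<^sub>\<infinity>k\<in>carrier G. a k * delta x (\<phi> (inv k) t)) =
      (\<Sum>\<^sub>\<infinity>k\<in>stabilizer G \<phi> x. a k * delta x t)" if "t \<in> E"
    using sub that l1_outside[OF assms(2)]
    by (intro infsum_cong_neutral) (auto simp: delta_def eq)
  then show "l1S_lact G E \<phi> a (delta x) t = augm (stabilizer G \<phi> x) a * delta x t"
    using assms by (auto simp: l1S_lact_def augm_def infsum_cmult_left' delta_def)
qed

end

section \<open>Bounded multilinear forms\<close>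

lemma tuples_cong: "(\<And>i. i < n \<Longrightarrow> a i = b i) \<Longrightarrow> a \<in> tuples A n \<longleftrightarrow> b \<in> tuples A n"
  by (auto simp: tuples_def)

lemma tuples_upd: "a \<in> tuples A n \<Longrightarrow> x \<in> A \<Longrightarrow> a(i := x) \<in> tuples A n"
  by (auto simp: tuples_def)

lemma tuples_delta: "(\<And>i. i < n \<Longrightarrow> g i \<in> H) \<Longrightarrow> (\<lambda>i. delta (g i)) \<in> tuples (l1 H) n"
  by (auto simp: tuples_def delta_l1)

lemma prod_upd:
  fixes N :: "'a \<Rightarrow> 'c :: comm_monoid_mult"
  assumes "i < (n :: nat)"
  shows "(\<Prod>j<n. N ((a(i := x)) j)) = N x * (\<Prod>j\<in>{..<n} - {i}. N (a j))"
proof -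
  have "(\<Prod>j<n. N ((a(i := x)) j)) = N ((a(i := x)) i) * (\<Prod>j\<in>{..<n} - {i}. N ((a(i := x)) j))"
    using assms by (intro prod.remove) auto
  also have "(\<Prod>j\<in>{..<n} - {i}. N ((a(i := x)) j)) = (\<Prod>j\<in>{..<n} - {i}. N (a j))"
    by (intro prod.cong) auto
  finally show ?thesis by simp
qed

text \<open>A form is only constrained on tuples of summable families.\<close>

definition bounded_form ::
    "'g set \<Rightarrow> 'b set \<Rightarrow> nat \<Rightarrow> ((nat \<Rightarrow> 'g \<Rightarrow> complex) \<Rightarrow> ('b \<Rightarrow> complex) \<Rightarrow> complex) \<Rightarrow> bool" where
  "bounded_form H S n u \<longleftrightarrow>
     (\<forall>a\<in>tuples (l1 H) n. \<forall>b. \<forall>\<xi>\<in>l1 S. (\<forall>i<n. a i = b i) \<longrightarrow> u a \<xi> = u b \<xi>)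
   \<and> (\<forall>a\<in>tuples (l1 H) n. \<forall>\<xi>\<in>l1 S. \<forall>\<eta>\<in>l1 S. \<forall>c. u a (\<lambda>t. \<xi> t + c * \<eta> t) = u a \<xi> + c * u a \<eta>)
   \<and> (\<forall>a\<in>tuples (l1 H) n. \<forall>i<n. \<forall>x\<in>l1 H. \<forall>y\<in>l1 H. \<forall>c. \<forall>\<xi>\<in>l1 S.
        u (a(i := (\<lambda>t. x t + c * y t))) \<xi> = u (a(i := x)) \<xi> + c * u (a(i := y)) \<xi>)
   \<and> (\<exists>C\<ge>0. \<forall>a\<in>tuples (l1 H) n. \<forall>\<xi>\<in>l1 S. norm (u a \<xi>) \<le> C * (\<Prod>i<n. l1norm H (a i)) * l1norm S \<xi>)"

lemma bounded_formI:
  assumes "\<And>a b \<xi>. a \<in> tuples (l1 H) n \<Longrightarrow> \<xi> \<in> l1 S \<Longrightarrow> (\<And>i. i < n \<Longrightarrow> a i = b i) \<Longrightarrow> u a \<xi> = u b \<xi>"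
    and "\<And>a \<xi> \<eta> c. a \<in> tuples (l1 H) n \<Longrightarrow> \<xi> \<in> l1 S \<Longrightarrow> \<eta> \<in> l1 S \<Longrightarrow>
      u a (\<lambda>t. \<xi> t + c * \<eta> t) = u a \<xi> + c * u a \<eta>"
    and "\<And>a i x y c \<xi>. a \<in> tuples (l1 H) n \<Longrightarrow> i < n \<Longrightarrow> x \<in> l1 H \<Longrightarrow> y \<in> l1 H \<Longrightarrow> \<xi> \<in> l1 S \<Longrightarrow>
      u (a(i := (\<lambda>t. x t + c * y t))) \<xi> = u (a(i := x)) \<xi> + c * u (a(i := y)) \<xi>"
    and "C \<ge> 0" and "\<And>a \<xi>. a \<in> tuples (l1 H) n \<Longrightarrow> \<xi> \<in> l1 S \<Longrightarrow>
      norm (u a \<xi>) \<le> C * (\<Prod>i<n. l1norm H (a i)) * l1norm S \<xi>"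
  shows "bounded_form H S n u"
  unfolding bounded_form_def
proof (intro conjI ballI allI impI exI[of _ C])
  fix a b \<xi> assume "a \<in> tuples (l1 H) n" "\<xi> \<in> l1 S" "\<forall>i<n. a i = b i"
  then show "u a \<xi> = u b \<xi>" by (intro assms(1)) auto
qed (simp_all add: assms(2-5) del: fun_upd_apply)

lemma
  assumes "bounded_form H S n u"
  shows bounded_form_cong: "a \<in> tuples (l1 H) n \<Longrightarrow> \<xi> \<in> l1 S \<Longrightarrow> (\<And>i. i < n \<Longrightarrow> a i = b i) \<Longrightarrow> u a \<xi> = u b \<xi>"
    and bounded_form_linear: "a \<in> tuples (l1 H) n \<Longrightarrow> \<xi> \<in> l1 S \<Longrightarrow> \<eta> \<in> l1 S \<Longrightarrow>
      u a (\<lambda>t. \<xi> t + c * \<eta> t) = u a \<xi> + c * u a \<eta>"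
    and bounded_form_multilinear: "a \<in> tuples (l1 H) n \<Longrightarrow> i < n \<Longrightarrow> x \<in> l1 H \<Longrightarrow> y \<in> l1 H \<Longrightarrow> \<xi> \<in> l1 S \<Longrightarrow>
      u (a(i := (\<lambda>t. x t + c * y t))) \<xi> = u (a(i := x)) \<xi> + c * u (a(i := y)) \<xi>"
    and bounded_form_bound: "\<exists>C\<ge>0. \<forall>a\<in>tuples (l1 H) n. \<forall>\<xi>\<in>l1 S.
      norm (u a \<xi>) \<le> C * (\<Prod>i<n. l1norm H (a i)) * l1norm S \<xi>"
  using assms unfolding bounded_form_def by blast+

lemma bounded_form_smult_arg:
  assumes "bounded_form H S n u" "a \<in> tuples (l1 H) n" "\<xi> \<in> l1 S"
  shows "u a (\<lambda>t. c * \<xi> t) = c * u a \<xi>"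
proof -
  have "u a (\<lambda>t. 0) = 0"
    using bounded_form_linear[OF assms(1,2) l1_zero l1_zero, of 1] by simp
  then show ?thesis
    using bounded_form_linear[OF assms(1,2) l1_zero assms(3), of c] by simp
qed

lemma bounded_form_add:
  assumes u: "bounded_form H S n u" and v: "bounded_form H S n v"
  shows "bounded_form H S n (\<lambda>a \<xi>. u a \<xi> + v a \<xi>)"
proof -
  obtain C D where C: "C \<ge> 0" "\<And>a \<xi>. a \<in> tuples (l1 H) n \<Longrightarrow> \<xi> \<in> l1 S \<Longrightarrow>
      norm (u a \<xi>) \<le> C * (\<Prod>i<n. l1norm H (a i)) * l1norm S \<xi>"
    and D: "D \<ge> 0" "\<And>a \<xi>. a \<in> tuples (l1 H) n \<Longrightarrow> \<xi> \<in> l1 S \<Longrightarrow>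
      norm (v a \<xi>) \<le> D * (\<Prod>i<n. l1norm H (a i)) * l1norm S \<xi>"
    using bounded_form_bound[OF u] bounded_form_bound[OF v] by blast
  show ?thesis
  proof (rule bounded_formI[where C = "C + D"])
    fix a \<xi> assume "a \<in> tuples (l1 H) n" "\<xi> \<in> l1 S"
    then show "norm (u a \<xi> + v a \<xi>) \<le> (C + D) * (\<Prod>i<n. l1norm H (a i)) * l1norm S \<xi>"
      using C(2)[of a \<xi>] D(2)[of a \<xi>] norm_triangle_ineq[of "u a \<xi>" "v a \<xi>"]
      by (simp add: ring_distribs)
  next
    fix a b \<xi> assume "a \<in> tuples (l1 H) n" "\<xi> \<in> l1 S" "\<And>i. i < n \<Longrightarrow> a i = b i"
    then show "u a \<xi> + v a \<xi> = u b \<xi> + v b \<xi>"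
      using bounded_form_cong[OF u] bounded_form_cong[OF v] by metis
  qed (use C(1) D(1) in \<open>simp_all add: bounded_form_linear[OF u] bounded_form_linear[OF v]
      bounded_form_multilinear[OF u] bounded_form_multilinear[OF v] algebra_simps\<close>)
qed

lemma bounded_form_smult:
  assumes u: "bounded_form H S n u"
  shows "bounded_form H S n (\<lambda>a \<xi>. k * u a \<xi>)"
proof -
  obtain C where C: "C \<ge> 0" "\<And>a \<xi>. a \<in> tuples (l1 H) n \<Longrightarrow> \<xi> \<in> l1 S \<Longrightarrow>
      norm (u a \<xi>) \<le> C * (\<Prod>i<n. l1norm H (a i)) * l1norm S \<xi>"
    using bounded_form_bound[OF u] by blast
  show ?thesis
  proof (rule bounded_formI[where C = "norm k * C"])
    fix a \<xi> assume "a \<in> tuples (l1 H) n" "\<xi> \<in> l1 S"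
    then show "norm (k * u a \<xi>) \<le> norm k * C * (\<Prod>i<n. l1norm H (a i)) * l1norm S \<xi>"
      using mult_left_mono[OF C(2)[of a \<xi>], of "norm k"] by (simp add: norm_mult mult.assoc)
  next
    fix a b \<xi> assume "a \<in> tuples (l1 H) n" "\<xi> \<in> l1 S" "\<And>i. i < n \<Longrightarrow> a i = b i"
    then show "k * u a \<xi> = k * u b \<xi>"
      using bounded_form_cong[OF u] by metis
  qed (use C(1) in \<open>simp_all add: bounded_form_linear[OF u] bounded_form_multilinear[OF u] algebra_simps\<close>)
qed

lemma bounded_form_0: "bounded_form H S n (\<lambda>a \<xi>. 0)"
  by (rule bounded_formI[where C = 0]) auto

lemma bounded_form_sum:
  assumes "finite J" "\<And>j. j \<in> J \<Longrightarrow> bounded_form H S n (u j)"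
  shows "bounded_form H S n (\<lambda>a \<xi>. \<Sum>j\<in>J. u j a \<xi>)"
  using assms by (induction J rule: finite_induct) (simp_all add: bounded_form_0 bounded_form_add)

text \<open>Density of the point masses, one argument at a time.\<close>

lemma multilinear_eq_0:
  assumes cong: "\<And>a b. (\<And>i. i < n \<Longrightarrow> a i = b i) \<Longrightarrow> u a = u b"
    and lin: "\<And>a i x y c. a \<in> tuples (l1 H) n \<Longrightarrow> i < n \<Longrightarrow> x \<in> l1 H \<Longrightarrow> y \<in> l1 H \<Longrightarrow>
      u (a(i := (\<lambda>t. x t + c * y t))) = u (a(i := x)) + c * u (a(i := y))"
    and bound: "\<And>a. a \<in> tuples (l1 H) n \<Longrightarrow> norm (u a) \<le> C * (\<Prod>i<n. l1norm H (a i))"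
    and zero: "\<And>g. (\<And>i. i < n \<Longrightarrow> g i \<in> H) \<Longrightarrow> u (\<lambda>i. delta (g i)) = 0"
    and a: "a \<in> tuples (l1 H) n"
  shows "u a = (0 :: complex)"
proof -
  \<comment> \<open>Induction on the number \<open>m\<close> of leading entries that are arbitrary,
    the others being point masses. \<open>m = 0\<close> is the hypothesis \<open>zero\<close>, and
    \<open>m = n\<close> is the claim.\<close>
  have "u a = 0" if "m \<le> n" "a \<in> tuples (l1 H) n" "\<And>i. m \<le> i \<Longrightarrow> i < n \<Longrightarrow> a i \<in> delta ` H" for m a
    using that
  proof (induction m arbitrary: a)
    case 0
    then have "\<forall>i. \<exists>h. i < n \<longrightarrow> h \<in> H \<and> a i = delta h" by blast
    then obtain g where "\<And>i. i < n \<Longrightarrow> g i \<in> H \<and> a i = delta (g i)" by metis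
    then show ?case using zero[of g] cong[of a "\<lambda>i. delta (g i)"] by auto
  next
    case (Suc m)
    have m: "m < n" using Suc.prems by simp
    have "u (a(m := a m)) = 0"
    \<comment> \<open>With the other entries frozen, \<open>u\<close> is a bounded functional of
      entry \<open>m\<close>, the bound being \<open>C\<close> times the norms of the remaining
      entries.\<close>
    proof (rule l1_functional_eq_0[where u = "\<lambda>x. u (a(m := x))"])
      show "a m \<in> l1 H" using Suc.prems m by (simp add: tuples_def)
      show "u (a(m := (\<lambda>t. x t + c * y t))) = u (a(m := x)) + c * u (a(m := y))"
        if "x \<in> l1 H" "y \<in> l1 H" for x y c
        using lin Suc.prems m that by simp
      show "norm (u (a(m := x))) \<le> C * (\<Prod>j\<in>{..<n} - {m}. l1norm H (a j)) * l1norm H x"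
        if "x \<in> l1 H" for x
        using bound[OF tuples_upd[OF Suc.prems(2) that, of m]] m
        unfolding prod_upd[OF m, of "l1norm H"] by (simp add: mult_ac)
      show "u (a(m := delta h)) = 0" if "h \<in> H" for h
      proof (rule Suc.IH)
        show "a(m := delta h) \<in> tuples (l1 H) n" by (simp add: Suc.prems tuples_upd delta_l1 that)
        show "(a(m := delta h)) i \<in> delta ` H" if "m \<le> i" "i < n" for i
          using Suc.prems(3)[of i] \<open>h \<in> H\<close> that by (cases "i = m") auto
      qed (use m in simp)
    qed
    then show ?case by simp
  qed
  from this[of n a] a show ?thesis by simp
qed

lemma bounded_form_eq_0:
  assumes u: "bounded_form H S n u"
    and zero: "\<And>g s. (\<And>i. i < n \<Longrightarrow> g i \<in> H) \<Longrightarrow> s \<in> S \<Longrightarrow> u (\<lambda>i. delta (g i)) (delta s) = 0"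
    and a: "a \<in> tuples (l1 H) n" and \<xi>: "\<xi> \<in> l1 S"
  shows "u a \<xi> = 0"
proof -
  obtain C where C: "\<And>a \<xi>. a \<in> tuples (l1 H) n \<Longrightarrow> \<xi> \<in> l1 S \<Longrightarrow>
      norm (u a \<xi>) \<le> C * (\<Prod>i<n. l1norm H (a i)) * l1norm S \<xi>"
    using bounded_form_bound[OF u] by blast
  have delta0: "u a (delta s) = 0" if s: "s \<in> S" for s
  proof -
    \<comment> \<open>\<open>multilinear_eq_0\<close> wants congruence for all tuples, while a form
      provides it on summable ones; the default value 0 elsewhere bridges the gap.\<close>
    let ?u = "\<lambda>a. if a \<in> tuples (l1 H) n then u a (delta s) else 0"
    have "?u a = 0"
    proof (rule multilinear_eq_0[OF _ _ _ _ a])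
      fix a b :: "nat \<Rightarrow> 'a \<Rightarrow> complex" assume ab: "\<And>i. i < n \<Longrightarrow> a i = b i"
      show "?u a = ?u b"
        using tuples_cong[of n a b] bounded_form_cong[OF u _ delta_l1[OF s], of a b] ab by auto
    next
      fix a assume "a \<in> tuples (l1 H) n"
      then show "norm (?u a) \<le> C * (\<Prod>i<n. l1norm H (a i))"
        using C[of a "delta s"] s by (simp add: delta_l1 l1norm_delta)
    qed (use s in \<open>auto simp: tuples_upd l1_linear tuples_delta zero delta_l1 bounded_form_multilinear[OF u]
        simp del: fun_upd_apply\<close>)
    then show ?thesis using a by simp
  qed
  show ?thesis
    by (rule l1_functional_eq_0[OF \<xi>]) (use delta0 C[OF a] bounded_form_linear[OF u a] in auto)
qed

subsection \<open>Extending bounded functions to multilinear forms\<close>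

text \<open>Integration of \<open>f\<close> against the tensor product of
  \<open>a 0, \<dots>, a (n - 1)\<close> and \<xi>. Indexing by \<open>PiE\<close> fixes the entries
  from \<open>n\<close> on, so that each n-tuple is counted once.\<close>

definition lift ::
    "'g set \<Rightarrow> 'b set \<Rightarrow> nat \<Rightarrow> ((nat \<Rightarrow> 'g) \<Rightarrow> 'b \<Rightarrow> complex) \<Rightarrow>
     (nat \<Rightarrow> 'g \<Rightarrow> complex) \<Rightarrow> ('b \<Rightarrow> complex) \<Rightarrow> complex" where
  "lift H S n f a \<xi> =
    (\<Sum>\<^sub>\<infinity>(g, s)\<in>PiE {..<n} (\<lambda>_. H) \<times> S. (\<Prod>i<n. a i (g i)) * \<xi> s * f g s)"

text \<open>A bounded function times a summable weight: the weight is the product of the absolute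
  values of all factors, and its total is the product of the l1-norms.\<close>

lemma
  assumes a: "a \<in> tuples (l1 H) n" and \<xi>: "\<xi> \<in> l1 S"
    and K: "\<And>g s. g \<in> PiE {..<n} (\<lambda>_. H) \<Longrightarrow> s \<in> S \<Longrightarrow> norm (f g s) \<le> K"
  shows lift_summable: "(\<lambda>(g, s). (\<Prod>i<n. a i (g i)) * \<xi> s * f g s) summable_on (PiE {..<n} (\<lambda>_. H) \<times> S)"
    and lift_bound: "norm (lift H S n f a \<xi>) \<le> K * (\<Prod>i<n. l1norm H (a i)) * l1norm S \<xi>"
proof -
  let ?P = "PiE {..<n} (\<lambda>_. H)"
  let ?w = "\<lambda>(g, s). (\<Prod>i<n. norm (a i (g i))) * norm (\<xi> s)"
  let ?f = "\<lambda>(g, s). (\<Prod>i<n. a i (g i)) * \<xi> s * f g s"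
  have ai: "(\<lambda>x. norm (a i x)) summable_on H" if "i < n" for i
    using a that by (intro l1_abs_summable) (simp add: tuples_def)
  have s: "(\<lambda>g. \<Prod>i<n. norm (a i (g i))) summable_on (PiE {..<n} (\<lambda>_. H))"
    using summable_prod_PiE[of n "\<lambda>i x. norm (a i x)" "\<lambda>_. H"] ai by simp
  have ws: "?w summable_on (?P \<times> S)"
    using abs_summable_times(1)[OF s l1_abs_summable[OF \<xi>]] by (simp add: prod_nonneg)
  have "infsum ?w (?P \<times> S) = (\<Sum>\<^sub>\<infinity>g\<in>?P. \<Prod>i<n. norm (a i (g i))) * l1norm S \<xi>"
    using abs_summable_times(2)[OF s l1_abs_summable[OF \<xi>]] by (simp add: l1norm_def prod_nonneg)
  also have "(\<Sum>\<^sub>\<infinity>g\<in>?P. \<Prod>i<n. norm (a i (g i))) = (\<Prod>i<n. l1norm H (a i))"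
    unfolding l1norm_def using ai s
    by (intro infsum_prod_PiE[of "{..<n}" "\<lambda>i x. norm (a i x)" "\<lambda>_. H"]) simp_all
  finally have wi: "infsum ?w (?P \<times> S) = (\<Prod>i<n. l1norm H (a i)) * l1norm S \<xi>" .
  have le: "norm (?f p) \<le> K * ?w p" if p': "p \<in> ?P \<times> S" for p
  proof -
    obtain g s where p: "p = (g, s)" "g \<in> ?P" "s \<in> S" using p' by blast
    have "norm (?f p) = ?w p * norm (f g s)"
      by (simp add: p norm_mult flip: prod_norm)
    also have "\<dots> \<le> ?w p * K"
      using K[OF p(2,3)] by (intro mult_left_mono) (auto simp: p intro!: prod_nonneg mult_nonneg_nonneg)
    finally show ?thesis by (simp add: mult.commute)
  qed
  have n: "(\<lambda>p. norm (?f p)) summable_on (?P \<times> S)"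
    by (rule Infinite_Sum.abs_summable_on_comparison_test'[OF summable_on_cmult_right[OF ws] le])
  then show "?f summable_on (?P \<times> S)" by (rule abs_summable_summable)
  have "norm (infsum ?f (?P \<times> S)) \<le> infsum (\<lambda>p. norm (?f p)) (?P \<times> S)"
    using n by (rule norm_infsum_bound)
  also have "\<dots> \<le> (\<Sum>\<^sub>\<infinity>p\<in>?P \<times> S. K * ?w p)"
    by (rule infsum_mono[OF n summable_on_cmult_right[OF ws] le])
  also have "\<dots> = K * (\<Prod>i<n. l1norm H (a i)) * l1norm S \<xi>"
    by (simp add: infsum_cmult_right' wi)
  finally show "norm (lift H S n f a \<xi>) \<le> K * (\<Prod>i<n. l1norm H (a i)) * l1norm S \<xi>"
    by (simp add: lift_def)
qed

lemma infsum_linear: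
  fixes f :: "'a \<Rightarrow> complex"
  assumes "f summable_on X" "g summable_on X" "\<And>x. x \<in> X \<Longrightarrow> h x = f x + c * g x"
  shows "infsum h X = infsum f X + c * infsum g X"
proof -
  have "infsum h X = (\<Sum>\<^sub>\<infinity>x\<in>X. f x + c * g x)" using assms(3) by (intro infsum_cong) auto
  then show ?thesis
    using assms by (simp add: infsum_add summable_on_cmult_right infsum_cmult_right')
qed

lemma bounded_form_lift:
  assumes "K \<ge> 0" and K: "\<And>g s. g \<in> PiE {..<n} (\<lambda>_. H) \<Longrightarrow> s \<in> S \<Longrightarrow> norm (f g s) \<le> K"
  shows "bounded_form H S n (lift H S n f)"
proof (rule bounded_formI[OF _ _ _ \<open>K \<ge> 0\<close>])
  fix a \<xi> \<eta> c assume a: "a \<in> tuples (l1 H) n" and \<xi>: "\<xi> \<in> l1 S" and \<eta>: "\<eta> \<in> l1 S"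
  show "lift H S n f a (\<lambda>t. \<xi> t + c * \<eta> t) = lift H S n f a \<xi> + c * lift H S n f a \<eta>"
    unfolding lift_def
    by (rule infsum_linear[OF lift_summable[OF a \<xi> K] lift_summable[OF a \<eta> K]])
      (auto simp: algebra_simps)
next
  fix a i x y c \<xi>
  assume *: "a \<in> tuples (l1 H) n" "i < n" "x \<in> l1 H" "y \<in> l1 H" and \<xi>: "\<xi> \<in> l1 S"
  \<comment> \<open>Only the factor at \<open>i\<close> depends on the varied entry, and it does so
    linearly.\<close>
  have upd: "(\<Prod>j<n. (a(i := z)) j (g j)) = z (g i) * (\<Prod>j\<in>{..<n} - {i}. a j (g j))" for z g
    using \<open>i < n\<close> by (subst prod.remove[of _ i]) auto
  show "lift H S n f (a(i := (\<lambda>t. x t + c * y t))) \<xi> =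
      lift H S n f (a(i := x)) \<xi> + c * lift H S n f (a(i := y)) \<xi>"
    unfolding lift_def
    by (rule infsum_linear[OF lift_summable[OF _ \<xi> K] lift_summable[OF _ \<xi> K]])
      (auto simp: upd algebra_simps * tuples_upd simp del: fun_upd_apply)
next
  fix a b :: "nat \<Rightarrow> 'a \<Rightarrow> complex" and \<xi> :: "'b \<Rightarrow> complex"
  assume "\<And>i. i < n \<Longrightarrow> a i = b i"
  then show "lift H S n f a \<xi> = lift H S n f b \<xi>"
    unfolding lift_def by (intro infsum_cong) auto
qed (rule lift_bound[OF _ _ K])

lemma lift_delta:
  assumes g: "\<And>i. i < n \<Longrightarrow> g i \<in> H" and s: "s \<in> S"
  shows "lift H S n f (\<lambda>i. delta (g i)) (delta s) = f (restrict g {..<n}) s"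
proof -
  \<comment> \<open>Tuples in \<open>PiE\<close> agree from \<open>n\<close> on, so one that is not
    \<open>restrict g {..<n}\<close> differs from \<open>g\<close> at some \<open>i < n\<close>,
    where its factor vanishes.\<close>
  have zero: "(\<Prod>i<n. delta (g i) (h i)) = 0" if "h \<in> PiE {..<n} (\<lambda>_. H)" "h \<noteq> restrict g {..<n}" for h
  proof -
    have "\<exists>i<n. h i \<noteq> g i"
      using that by (metis PiE_restrict lessThan_iff restrict_ext)
    then show ?thesis by (auto simp: delta_def)
  qed
  have "lift H S n f (\<lambda>i. delta (g i)) (delta s) =
      (\<Prod>i<n. delta (g i) (restrict g {..<n} i)) * delta s s * f (restrict g {..<n}) s"
    unfolding lift_def
  proof (subst infsum_delta[of "(restrict g {..<n}, s)"])
    fix p assume p: "p \<in> PiE {..<n} (\<lambda>_. H) \<times> S" "p \<noteq> (restrict g {..<n}, s)"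
    obtain h t where "p = (h, t)" by fastforce
    then show "(case p of (h, t) \<Rightarrow> (\<Prod>i<n. delta (g i) (h i)) * delta s t * f h t) = 0"
      using p zero[of h] by (cases "h = restrict g {..<n}") (simp_all add: delta_def[of s])
  qed (use g s in auto)
  then show ?thesis
    by (simp add: delta_def)
qed

section \<open>The prism operator\<close>

text \<open>The coface map of the simplex category: composing with it deletes vertex
  \<open>j\<close>.\<close>

definition skip :: "nat \<Rightarrow> nat \<Rightarrow> nat" where
  "skip j i = (if i < j then i else Suc i)"

definition face_sum :: "nat \<Rightarrow> ((nat \<Rightarrow> 'a) \<Rightarrow> complex) \<Rightarrow> (nat \<Rightarrow> 'a) \<Rightarrow> complex" where
  "face_sum n w k = (\<Sum>j\<le>n. (-1) ^ j * w (\<lambda>i. k (skip j i)))"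

text \<open>The simplex \<open>k 0, \<dots>, k i, \<sigma> (k i), \<sigma> (k (i + 1)),
  \<dots>\<close> in the standard triangulation of the prism from \<open>k\<close> to its image
  under \<sigma>. Vertex \<open>i\<close> is used twice, hence the shift.\<close>

definition prism :: "('a \<Rightarrow> 'a) \<Rightarrow> nat \<Rightarrow> (nat \<Rightarrow> 'a) \<Rightarrow> nat \<Rightarrow> 'a" where
  "prism \<sigma> i k = (\<lambda>p. if p \<le> i then k p else \<sigma> (k (p - 1)))"

definition prism_sum ::
    "('a \<Rightarrow> 'a) \<Rightarrow> nat \<Rightarrow> ((nat \<Rightarrow> 'a) \<Rightarrow> complex) \<Rightarrow> (nat \<Rightarrow> 'a) \<Rightarrow> complex" where
  "prism_sum \<sigma> n w k = (\<Sum>i<n. (-1) ^ i * w (prism \<sigma> i k))"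

lemma face_sum_cong:
  "(\<And>j. j \<le> n \<Longrightarrow> w (\<lambda>i. k (skip j i)) = w' (\<lambda>i. k' (skip j i))) \<Longrightarrow> face_sum n w k = face_sum n w' k'"
  by (simp add: face_sum_def)

text \<open>The faces \<open>j\<close> of prism simplex \<open>i\<close> are of two kinds. For
  \<open>j < i\<close> or \<open>j > i + 1\<close> the face is a prism simplex over a face of
  \<open>k\<close>, and these cancel against the first summand. For \<open>j = i\<close> and
  \<open>j = i + 1\<close> it is a wall \<open>Q i\<close> or \<open>Q (i + 1)\<close>, and the
  walls telescope to the two ends of the prism.\<close>

lemma prism_homotopy:
  assumes cong: "\<And>k k'. (\<And>i. i \<le> n \<Longrightarrow> k i = k' i) \<Longrightarrow> w k = w k'"
  shows "face_sum n (prism_sum \<sigma> n w) k + prism_sum \<sigma> (Suc n) (face_sum (Suc n) w) k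
    = w (\<lambda>i. \<sigma> (k i)) - w k"
proof -
  define A where "A i j = w (prism \<sigma> i (\<lambda>p. k (skip j p)))" for i j
  define Q where "Q i = w (\<lambda>p. if p < i then k p else \<sigma> (k p))" for i
  let ?B = "\<lambda>i j. w (\<lambda>p. prism \<sigma> i k (skip j p))"
  have B_less: "?B (Suc i) j = A i j" if "j \<le> i" for i j
    unfolding A_def by (rule arg_cong[of _ _ w]) (use that in \<open>auto simp: prism_def skip_def fun_eq_iff\<close>)
  have B_greater: "?B i (Suc j) = A i j" if "i < j" for i j
  proof -
    have "prism \<sigma> i k (skip (Suc j) p) = prism \<sigma> i (\<lambda>p. k (skip j p)) p" for p
      using that by (cases p) (auto simp: prism_def skip_def)
    then show ?thesis by (simp add: A_def)
  qed
  have B_diag: "?B i i = Q i" "?B i (Suc i) = Q (Suc i)" for i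
    unfolding Q_def by (auto simp: prism_def skip_def fun_eq_iff intro!: arg_cong[of _ _ w])
  have split: "(\<Sum>j\<le>Suc n. f j) = (\<Sum>j<i. f j) + f i + f (Suc i) + (\<Sum>j=Suc i..n. f (Suc j))"
    if "i \<le> n" for i and f :: "nat \<Rightarrow> complex"
  proof -
    have "{..Suc n} = {..<i} \<union> ({i, Suc i} \<union> {Suc (Suc i)..Suc n})"
      using that by auto
    then have "(\<Sum>j\<le>Suc n. f j) = (\<Sum>j<i. f j) + ((\<Sum>j\<in>{i, Suc i}. f j) + (\<Sum>j=Suc (Suc i)..Suc n. f j))"
      by (simp only:) (subst sum.union_disjoint; auto)+
    then show ?thesis
      by (simp only: sum.shift_bounds_cl_Suc_ivl) simp
  qed
  let ?a = "\<lambda>i j. (-1) ^ (i + j) * A i j"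
  \<comment> \<open>Faces above the diagonal come from faces of \<open>k\<close> with index one
    less, which flips their sign; those below belong to prism simplex \<open>i - 1\<close>. The
    truncated subtraction is harmless, since for \<open>i = 0\<close> that sum is empty.\<close>
  have row: "(\<Sum>j\<le>Suc n. (-1) ^ (i + j) * ?B i j) =
      Q i - Q (Suc i) + (\<Sum>j<i. (-1) ^ (i + j) * A (i - 1) j) - (\<Sum>j=Suc i..n. ?a i j)" if "i \<le> n" for i
  proof -
    have "(\<Sum>j<i. (-1) ^ (i + j) * ?B i j) = (\<Sum>j<i. (-1) ^ (i + j) * A (i - 1) j)"
      by (intro sum.cong refl) (use B_less[of _ "i - 1"] in auto)
    moreover have "(\<Sum>j=Suc i..n. (-1) ^ (i + Suc j) * ?B i (Suc j)) = - (\<Sum>j=Suc i..n. ?a i j)"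
      unfolding sum_negf[symmetric] by (intro sum.cong refl) (use B_greater[of i] in auto)
    ultimately show ?thesis
      unfolding split[OF that] B_diag by (simp add: power_add flip: power2_eq_square power_mult)
  qed
  have "prism_sum \<sigma> (Suc n) (face_sum (Suc n) w) k = (\<Sum>i\<le>n. \<Sum>j\<le>Suc n. (-1) ^ (i + j) * ?B i j)"
    by (simp add: prism_sum_def face_sum_def lessThan_Suc_atMost sum_distrib_left power_add mult.assoc
        del: sum.atMost_Suc)
  also have "\<dots> = (\<Sum>i\<le>n. Q i - Q (Suc i)) + (\<Sum>i\<le>n. \<Sum>j<i. (-1) ^ (i + j) * A (i - 1) j)
      - (\<Sum>i\<le>n. \<Sum>j=Suc i..n. ?a i j)"
    unfolding sum.distrib[symmetric] sum_subtractf[symmetric] by (intro sum.cong refl row) simp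
  also have "(\<Sum>i\<le>n. Q i - Q (Suc i)) = Q 0 - Q (Suc n)"
    by (rule sum_telescope)
  \<comment> \<open>Row 0 is empty; shifting the others down by one changes the sign.\<close>
  also have "(\<Sum>i\<le>n. \<Sum>j<i. (-1) ^ (i + j) * A (i - 1) j) = - (\<Sum>i<n. \<Sum>j\<le>i. ?a i j)"
    by (subst sum.atMost_shift) (simp add: sum_negf lessThan_Suc_atMost del: sum.lessThan_Suc sum.atMost_Suc)
  \<comment> \<open>Row \<open>n\<close> is empty. Both triangles now run over \<open>i < n\<close>
    and together cover every \<open>j \<le> n\<close>.\<close>
  also have "(\<Sum>i\<le>n. \<Sum>j=Suc i..n. ?a i j) = (\<Sum>i<n. \<Sum>j=Suc i..n. ?a i j)"
    by (simp add: lessThan_Suc_atMost[symmetric] sum.lessThan_Suc)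
  finally have "prism_sum \<sigma> (Suc n) (face_sum (Suc n) w) k =
      Q 0 - Q (Suc n) - (\<Sum>i<n. (\<Sum>j\<le>i. ?a i j) + (\<Sum>j=Suc i..n. ?a i j))"
    by (simp add: sum.distrib)
  also have "(\<Sum>i<n. (\<Sum>j\<le>i. ?a i j) + (\<Sum>j=Suc i..n. ?a i j)) = (\<Sum>i<n. \<Sum>j\<le>n. ?a i j)"
  proof (intro sum.cong refl)
    fix i assume "i \<in> {..<n}"
    then have "{..n} = {..i} \<union> {Suc i..n}" by auto
    then show "(\<Sum>j\<le>i. ?a i j) + (\<Sum>j=Suc i..n. ?a i j) = (\<Sum>j\<le>n. ?a i j)"
      by (simp only:) (subst sum.union_disjoint; auto)
  qed
  also have "\<dots> = (\<Sum>j\<le>n. \<Sum>i<n. ?a i j)"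
    by (rule sum.swap)
  also have "\<dots> = face_sum n (prism_sum \<sigma> n w) k"
    by (simp add: prism_sum_def face_sum_def A_def sum_distrib_left power_add mult_ac)
  finally have "prism_sum \<sigma> (Suc n) (face_sum (Suc n) w) k =
      Q 0 - Q (Suc n) - face_sum n (prism_sum \<sigma> n w) k" .
  moreover have "Q 0 = w (\<lambda>i. \<sigma> (k i))" by (simp add: Q_def)
  \<comment> \<open>\<open>Q (Suc n)\<close> alters \<open>k\<close> only beyond vertex
    \<open>n\<close>, where \<open>w\<close> does not look.\<close>
  moreover have "Q (Suc n) = w k" unfolding Q_def by (rule cong) simp
  ultimately show ?thesis by simp
qed

section \<open>Hochschild cochains as bounded forms\<close>

lemma Sup_insert_0_le: "K \<ge> 0 \<Longrightarrow> (\<And>x. x \<in> B \<Longrightarrow> x \<le> K) \<Longrightarrow> Sup (insert 0 B) \<le> (K :: real)"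
  by (rule cSup_least) auto

lemma cochain_norm_le:
  assumes "K \<ge> 0"
    and "\<And>a. a \<in> tuples (acar A) n \<Longrightarrow> (\<And>i. i < n \<Longrightarrow> anorm A (a i) \<le> 1) \<Longrightarrow> mnorm M (\<psi> a) \<le> K"
  shows "cochain_norm A M n \<psi> \<le> K"
  unfolding cochain_norm_def using assms by (intro Sup_insert_0_le) auto

text \<open>The suprema defining the norms are junk values unless the set is bounded; for cochains it is.\<close>

lemma
  assumes \<psi>: "\<psi> \<in> cochains A M n" and pos: "\<And>x. 0 \<le> anorm A x"
  shows cochain_norm_upper: "a \<in> tuples (acar A) n \<Longrightarrow> (\<And>i. i < n \<Longrightarrow> anorm A (a i) \<le> 1) \<Longrightarrow>
      mnorm M (\<psi> a) \<le> cochain_norm A M n \<psi>"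
    and cochain_norm_nonneg: "0 \<le> cochain_norm A M n \<psi>"
proof -
  obtain C where C: "\<And>a. a \<in> tuples (acar A) n \<Longrightarrow> mnorm M (\<psi> a) \<le> C * (\<Prod>i<n. anorm A (a i))"
    using \<psi> unfolding cochains_def by blast
  let ?B = "insert 0 {mnorm M (\<psi> a) |a. a \<in> tuples (acar A) n \<and> (\<forall>i<n. anorm A (a i) \<le> 1)}"
  have bdd: "bdd_above ?B"
  proof (rule bdd_aboveI)
    fix r assume "r \<in> ?B"
    then consider "r = 0" | a where "r = mnorm M (\<psi> a)" "a \<in> tuples (acar A) n" "\<forall>i<n. anorm A (a i) \<le> 1"
      by blast
    then show "r \<le> \<bar>C\<bar>"
    proof cases
      case 2
      have "(\<Prod>i<n. anorm A (a i)) \<le> 1" "0 \<le> (\<Prod>i<n. anorm A (a i))"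
        using 2 pos by (auto intro: prod_le_1 prod_nonneg)
      then have "C * (\<Prod>i<n. anorm A (a i)) \<le> \<bar>C\<bar> * 1"
        by (intro mult_mono) auto
      then show ?thesis using C[of a] 2 by simp
    qed simp
  qed
  show "0 \<le> cochain_norm A M n \<psi>"
    unfolding cochain_norm_def by (rule cSup_upper[OF _ bdd]) simp
  show "mnorm M (\<psi> a) \<le> cochain_norm A M n \<psi>"
    if "a \<in> tuples (acar A) n" "\<And>i. i < n \<Longrightarrow> anorm A (a i) \<le> 1"
    unfolding cochain_norm_def by (rule cSup_upper[OF _ bdd]) (use that in blast)
qed

lemma l1alg_simps [simp]:
  "acar (l1alg G H) = l1 H" "aadd (l1alg G H) = (\<lambda>f g x. f x + g x)"
  "asmult (l1alg G H) = (\<lambda>c f x. c * f x)" "amult (l1alg G H) = conv G"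
  "anorm (l1alg G H) = l1norm H"
  by (simp_all add: l1alg_def)

lemma Cmod_simps [simp]:
  "mcar (Cmod H) = UNIV" "madd (Cmod H) = (+)" "msmult (Cmod H) = (*)" "mzero (Cmod H) = 0"
  "mnorm (Cmod H) = norm" "lact (Cmod H) = (\<lambda>a z. augm H a * z)" "ract (Cmod H) = (\<lambda>z a. z * augm H a)"
  by (simp_all add: Cmod_def)

lemma dual_l1S_simps [simp]:
  "madd (dual_l1S G S \<phi>) = (\<lambda>f g x. f x + g x)"
  "msmult (dual_l1S G S \<phi>) = (\<lambda>c f x. c * f x)"
  "mzero (dual_l1S G S \<phi>) = (\<lambda>x. 0)"
  "lact (dual_l1S G S \<phi>) = (\<lambda>a f \<xi>. if \<xi> \<in> l1 S then f (l1S_ract G \<xi> a) else 0)"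
  "ract (dual_l1S G S \<phi>) = (\<lambda>f a \<xi>. if \<xi> \<in> l1 S then f (l1S_lact G S \<phi> a \<xi>) else 0)"
  by (simp_all add: dual_l1S_def)

lemma dual_norm_le:
  assumes "K \<ge> 0" and "\<And>\<xi>. \<xi> \<in> l1 S \<Longrightarrow> l1norm S \<xi> \<le> 1 \<Longrightarrow> norm (f \<xi>) \<le> K"
  shows "mnorm (dual_l1S G S \<phi>) f \<le> K"
  unfolding dual_l1S_def using assms by (auto intro!: Sup_insert_0_le)

lemma
  assumes f: "f \<in> mcar (dual_l1S G S \<phi>)"
  shows dual_norm_nonneg: "0 \<le> mnorm (dual_l1S G S \<phi>) f"
    and dual_norm_upper: "\<xi> \<in> l1 S \<Longrightarrow> norm (f \<xi>) \<le> mnorm (dual_l1S G S \<phi>) f * l1norm S \<xi>"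
proof -
  have lin: "f (\<lambda>t. x t + c * y t) = f x + c * f y" if "x \<in> l1 S" "y \<in> l1 S" for x y c
    using f that by (simp add: dual_l1S_def)
  have "\<exists>C. \<forall>x\<in>l1 S. norm (f x) \<le> C * l1norm S x"
    using f by (simp add: dual_l1S_def)
  then obtain C where C: "\<And>x. x \<in> l1 S \<Longrightarrow> norm (f x) \<le> C * l1norm S x"
    by blast
  let ?B = "insert 0 {norm (f x) |x. x \<in> l1 S \<and> l1norm S x \<le> 1}"
  have norm: "mnorm (dual_l1S G S \<phi>) f = Sup ?B"
    by (simp add: dual_l1S_def)
  have bdd: "bdd_above ?B"
  proof (rule bdd_aboveI)
    fix r assume "r \<in> ?B"
    then consider "r = 0" | x where "r = norm (f x)" "x \<in> l1 S" "l1norm S x \<le> 1" by blast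
    then show "r \<le> \<bar>C\<bar>"
    proof cases
      case 2
      have "C * l1norm S x \<le> \<bar>C\<bar> * 1"
        using 2 by (intro mult_mono) (auto simp: l1norm_nonneg)
      then show ?thesis using C[of x] 2 by simp
    qed simp
  qed
  show "0 \<le> mnorm (dual_l1S G S \<phi>) f"
    unfolding norm by (rule cSup_upper[OF _ bdd]) simp
  assume \<xi>: "\<xi> \<in> l1 S"
  have f0: "f (\<lambda>t. 0) = 0"
    using lin[OF l1_zero l1_zero, of 1] by simp
  show "norm (f \<xi>) \<le> mnorm (dual_l1S G S \<phi>) f * l1norm S \<xi>"
  \<comment> \<open>A null vector cannot be rescaled to norm 1; there the continuity constant forces
    \<open>f \<xi> = 0\<close>.\<close>
  proof (cases "l1norm S \<xi> = 0")
    case True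
    then show ?thesis using C[OF \<xi>] by simp
  next
    case False
    then have pos: "l1norm S \<xi> > 0" using l1norm_nonneg[of S \<xi>] by simp
    define c where "c = complex_of_real (inverse (l1norm S \<xi>))"
    have "l1norm S (\<lambda>t. c * \<xi> t) = 1"
      using pos by (simp add: c_def l1norm_smult norm_inverse)
    then have "norm (f (\<lambda>t. c * \<xi> t)) \<le> Sup ?B"
      using l1_smult[OF \<xi>, of c] by (intro cSup_upper[OF _ bdd]) force
    moreover have "f (\<lambda>t. c * \<xi> t) = c * f \<xi>"
      using lin[OF l1_zero \<xi>, of c] f0 by simp
    ultimately have "norm c * norm (f \<xi>) \<le> Sup ?B"
      by (simp add: norm_mult)
    moreover have "norm c = inverse (l1norm S \<xi>)"
      using pos unfolding c_def norm_of_real by simp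
    ultimately show ?thesis
      using pos unfolding norm by (simp add: field_simps)
  qed
qed

text \<open>Cochains and functionals carry the default value 0 outside their domains, so that
  agreement on the domain is equality of functions. Forms are built freely and then cut down to this
  convention.\<close>

definition trunc ::
    "'g set \<Rightarrow> 'b set \<Rightarrow> nat \<Rightarrow> ((nat \<Rightarrow> 'g \<Rightarrow> complex) \<Rightarrow> ('b \<Rightarrow> complex) \<Rightarrow> complex) \<Rightarrow>
     (nat \<Rightarrow> 'g \<Rightarrow> complex) \<Rightarrow> ('b \<Rightarrow> complex) \<Rightarrow> complex" where
  "trunc H S n u a \<xi> = (if a \<in> tuples (l1 H) n \<and> \<xi> \<in> l1 S then u a \<xi> else 0)"

lemma bounded_form_trunc: "bounded_form H S n u \<Longrightarrow> bounded_form H S n (trunc H S n u)"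
proof -
  assume u: "bounded_form H S n u"
  then obtain C where C: "C \<ge> 0" "\<And>a \<xi>. a \<in> tuples (l1 H) n \<Longrightarrow> \<xi> \<in> l1 S \<Longrightarrow>
      norm (u a \<xi>) \<le> C * (\<Prod>i<n. l1norm H (a i)) * l1norm S \<xi>"
    using bounded_form_bound by blast
  show ?thesis
  proof (rule bounded_formI[OF _ _ _ C(1)])
    fix a b \<xi> assume *: "a \<in> tuples (l1 H) n" "\<xi> \<in> l1 S" "\<And>i. i < n \<Longrightarrow> a i = b i"
    then have "b \<in> tuples (l1 H) n" using tuples_cong[of n a b] by blast
    moreover have "u a \<xi> = u b \<xi>" using * by (rule bounded_form_cong[OF u])
    ultimately show "trunc H S n u a \<xi> = trunc H S n u b \<xi>"
      using * by (simp add: trunc_def)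
  qed (simp_all add: trunc_def C(2) bounded_form_linear[OF u] bounded_form_multilinear[OF u]
      l1_linear tuples_upd del: fun_upd_apply)
qed

lemma cochains_cong:
  assumes "\<psi> \<in> cochains A M n" and "\<And>i. i < n \<Longrightarrow> a i = b i"
  shows "\<psi> a = \<psi> b"
proof -
  have "\<forall>a b. (\<forall>i<n. a i = b i) \<longrightarrow> \<psi> a = \<psi> b"
    using assms(1) unfolding cochains_def by blast
  then show ?thesis using assms(2) by blast
qed

text \<open>Currying: a bounded multilinear map into a dual space is a bounded form with one more
  argument, the norm of the functional being traded for a factor
  \<open>l1norm S \<xi>\<close>.\<close>

lemma cochains_dual_iff:
  "\<psi> \<in> cochains (l1alg G H) (dual_l1S G S \<phi>) n \<longleftrightarrow>
    bounded_form H S n \<psi> \<and> (\<forall>a \<xi>. a \<notin> tuples (l1 H) n \<or> \<xi> \<notin> l1 S \<longrightarrow> \<psi> a \<xi> = 0)"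
  (is "_ \<longleftrightarrow> ?R")
proof
  assume *: "\<psi> \<in> cochains (l1alg G H) (dual_l1S G S \<phi>) n"
  have car: "\<psi> a \<in> mcar (dual_l1S G S \<phi>)" if "a \<in> tuples (l1 H) n" for a
    using * that by (simp add: cochains_def)
  have "\<exists>C. \<forall>a\<in>tuples (l1 H) n. mnorm (dual_l1S G S \<phi>) (\<psi> a) \<le> C * (\<Prod>i<n. l1norm H (a i))"
    using * by (simp add: cochains_def)
  then obtain C where C: "\<And>a. a \<in> tuples (l1 H) n \<Longrightarrow>
      mnorm (dual_l1S G S \<phi>) (\<psi> a) \<le> C * (\<Prod>i<n. l1norm H (a i))"
    by blast
  have "bounded_form H S n \<psi>"
  proof (rule bounded_formI[of H n S \<psi> "\<bar>C\<bar>"])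
    fix a \<xi> assume a: "a \<in> tuples (l1 H) n" and \<xi>: "\<xi> \<in> l1 S"
    \<comment> \<open>The constant of a cochain may be negative, that of a form may not.\<close>
    have "C * (\<Prod>i<n. l1norm H (a i)) \<le> \<bar>C\<bar> * (\<Prod>i<n. l1norm H (a i))"
      by (intro mult_right_mono prod_nonneg) (auto simp: l1norm_nonneg)
    then have "mnorm (dual_l1S G S \<phi>) (\<psi> a) * l1norm S \<xi> \<le> \<bar>C\<bar> * (\<Prod>i<n. l1norm H (a i)) * l1norm S \<xi>"
      using C[OF a] by (intro mult_right_mono l1norm_nonneg) simp
    then show "norm (\<psi> a \<xi>) \<le> \<bar>C\<bar> * (\<Prod>i<n. l1norm H (a i)) * l1norm S \<xi>"
      using dual_norm_upper[OF car[OF a] \<xi>] by simp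
  next
    fix a b :: "nat \<Rightarrow> 'a \<Rightarrow> complex" and \<xi> :: "'b \<Rightarrow> complex"
    assume "\<And>i. i < n \<Longrightarrow> a i = b i"
    then have "\<psi> a = \<psi> b" by (rule cochains_cong[OF *])
    then show "\<psi> a \<xi> = \<psi> b \<xi>" by simp
  next
    fix a \<xi> \<eta> c assume a: "a \<in> tuples (l1 H) n" and "\<xi> \<in> l1 S" "\<eta> \<in> l1 S"
    then show "\<psi> a (\<lambda>t. \<xi> t + c * \<eta> t) = \<psi> a \<xi> + c * \<psi> a \<eta>"
      using car[OF a] by (simp add: dual_l1S_def)
  next
    fix a i x y c \<xi>
    assume "a \<in> tuples (l1 H) n" "i < n" "x \<in> l1 H" "y \<in> l1 H" "\<xi> \<in> l1 S"
    then have "\<psi> (a(i := (\<lambda>t. x t + c * y t))) = (\<lambda>\<xi>. \<psi> (a(i := x)) \<xi> + c * \<psi> (a(i := y)) \<xi>)"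
      using * by (simp add: cochains_def)
    then show "\<psi> (a(i := (\<lambda>t. x t + c * y t))) \<xi> = \<psi> (a(i := x)) \<xi> + c * \<psi> (a(i := y)) \<xi>"
      by simp
  qed simp
  moreover have "\<psi> a \<xi> = 0" if "a \<notin> tuples (l1 H) n \<or> \<xi> \<notin> l1 S" for a \<xi>
  proof (cases "a \<in> tuples (l1 H) n")
    case True
    then show ?thesis using car[OF True] that by (simp add: dual_l1S_def)
  next
    case False
    then show ?thesis using * by (simp add: cochains_def)
  qed
  ultimately show ?R by blast
next
  assume R: ?R
  then have u: "bounded_form H S n \<psi>" by blast
  then obtain C where C: "C \<ge> 0" "\<And>a \<xi>. a \<in> tuples (l1 H) n \<Longrightarrow> \<xi> \<in> l1 S \<Longrightarrow>
      norm (\<psi> a \<xi>) \<le> C * (\<Prod>i<n. l1norm H (a i)) * l1norm S \<xi>"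
    using bounded_form_bound by blast
  have "\<psi> a \<in> mcar (dual_l1S G S \<phi>)" if a: "a \<in> tuples (l1 H) n" for a
    using R C(2)[OF a] bounded_form_linear[OF u a] unfolding dual_l1S_def by auto
  moreover have "\<psi> a = \<psi> b" if ab: "\<forall>i<n. a i = b i" for a b
  proof
    fix \<xi>
    show "\<psi> a \<xi> = \<psi> b \<xi>"
      using R bounded_form_cong[OF u, of a \<xi> b] tuples_cong[of n a b] ab by metis
  qed
  moreover have "\<psi> (a(i := (\<lambda>t. x t + c * y t))) = (\<lambda>\<xi>. \<psi> (a(i := x)) \<xi> + c * \<psi> (a(i := y)) \<xi>)"
    if "a \<in> tuples (l1 H) n" "i < n" "x \<in> l1 H" "y \<in> l1 H" for a i x y c
  proof
    fix \<xi>
    show "\<psi> (a(i := (\<lambda>t. x t + c * y t))) \<xi> = \<psi> (a(i := x)) \<xi> + c * \<psi> (a(i := y)) \<xi>"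
      using R bounded_form_multilinear[OF u, of a i x y \<xi> c] that by (cases "\<xi> \<in> l1 S") auto
  qed
  moreover have "\<exists>C. \<forall>a\<in>tuples (l1 H) n. mnorm (dual_l1S G S \<phi>) (\<psi> a) \<le> C * (\<Prod>i<n. l1norm H (a i))"
  proof (intro exI[of _ C] ballI)
    fix a assume a: "a \<in> tuples (l1 H) n"
    have *: "0 \<le> C * (\<Prod>i<n. l1norm H (a i))"
      using C(1) by (intro mult_nonneg_nonneg prod_nonneg) (auto simp: l1norm_nonneg)
    show "mnorm (dual_l1S G S \<phi>) (\<psi> a) \<le> C * (\<Prod>i<n. l1norm H (a i))"
    proof (rule dual_norm_le[OF *])
      fix \<xi> assume \<xi>: "\<xi> \<in> l1 S" "l1norm S \<xi> \<le> 1"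
      have "C * (\<Prod>i<n. l1norm H (a i)) * l1norm S \<xi> \<le> C * (\<Prod>i<n. l1norm H (a i)) * 1"
        using \<xi>(2) * by (rule mult_left_mono)
      then show "norm (\<psi> a \<xi>) \<le> C * (\<Prod>i<n. l1norm H (a i))"
        using C(2)[OF a \<xi>(1)] by simp
    qed
  qed
  ultimately show "\<psi> \<in> cochains (l1alg G H) (dual_l1S G S \<phi>) n"
    using R unfolding cochains_def by (auto simp: fun_eq_iff simp del: fun_upd_apply)
qed

lemma cochains_dual_trunc:
  "bounded_form H S n u \<Longrightarrow> trunc H S n u \<in> cochains (l1alg G H) (dual_l1S G S \<phi>) n"
  unfolding cochains_dual_iff using bounded_form_trunc by (auto simp: trunc_def)

lemma cochains_dual_eqI:
  assumes \<psi>: "\<psi> \<in> cochains (l1alg G H) (dual_l1S G S \<phi>) n"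
    and \<theta>: "\<theta> \<in> cochains (l1alg G H) (dual_l1S G S \<phi>) n"
    and eq: "\<And>g s. (\<And>i. i < n \<Longrightarrow> g i \<in> H) \<Longrightarrow> s \<in> S \<Longrightarrow>
      \<psi> (\<lambda>i. delta (g i)) (delta s) = \<theta> (\<lambda>i. delta (g i)) (delta s)"
  shows "\<psi> = \<theta>"
proof (intro ext)
  fix a \<xi>
  show "\<psi> a \<xi> = \<theta> a \<xi>"
  proof (cases "a \<in> tuples (l1 H) n \<and> \<xi> \<in> l1 S")
    case True
    have "bounded_form H S n (\<lambda>a \<xi>. \<psi> a \<xi> + (-1) * \<theta> a \<xi>)"
      using \<psi> \<theta> unfolding cochains_dual_iff by (intro bounded_form_add bounded_form_smult) auto
    from bounded_form_eq_0[OF this, of a \<xi>] True eq show ?thesis by simp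
  next
    case False
    then show ?thesis using \<psi> \<theta> unfolding cochains_dual_iff by metis
  qed
qed

lemma cochains_Cmod_eqI:
  assumes \<psi>: "\<psi> \<in> cochains (l1alg G H) (Cmod K) n" and \<theta>: "\<theta> \<in> cochains (l1alg G H) (Cmod K) n"
    and eq: "\<And>g. (\<And>i. i < n \<Longrightarrow> g i \<in> H) \<Longrightarrow> \<psi> (\<lambda>i. delta (g i)) = \<theta> (\<lambda>i. delta (g i))"
  shows "\<psi> = \<theta>"
proof
  fix a
  have "\<exists>C. \<forall>a\<in>tuples (l1 H) n. norm (\<psi> a) \<le> C * (\<Prod>i<n. l1norm H (a i))"
    "\<exists>C. \<forall>a\<in>tuples (l1 H) n. norm (\<theta> a) \<le> C * (\<Prod>i<n. l1norm H (a i))"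
    using \<psi> \<theta> by (simp_all add: cochains_def)
  then obtain C D where C: "\<And>a. a \<in> tuples (l1 H) n \<Longrightarrow> norm (\<psi> a) \<le> C * (\<Prod>i<n. l1norm H (a i))"
    and D: "\<And>a. a \<in> tuples (l1 H) n \<Longrightarrow> norm (\<theta> a) \<le> D * (\<Prod>i<n. l1norm H (a i))"
    by blast
  show "\<psi> a = \<theta> a"
  proof (cases "a \<in> tuples (l1 H) n")
    case True
    have "\<psi> a - \<theta> a = 0"
    proof (rule multilinear_eq_0[OF _ _ _ _ True, where u = "\<lambda>a. \<psi> a - \<theta> a"])
      fix a b :: "nat \<Rightarrow> 'a \<Rightarrow> complex" assume "\<And>i. i < n \<Longrightarrow> a i = b i"
      then have "\<psi> a = \<psi> b" "\<theta> a = \<theta> b" using cochains_cong[OF \<psi>] cochains_cong[OF \<theta>] by blast+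
      then show "\<psi> a - \<theta> a = \<psi> b - \<theta> b" by simp
    next
      fix a i x y c
      assume "a \<in> tuples (l1 H) n" "i < n" "x \<in> l1 H" "y \<in> l1 H"
      then show "\<psi> (a(i := (\<lambda>t. x t + c * y t))) - \<theta> (a(i := (\<lambda>t. x t + c * y t))) =
          \<psi> (a(i := x)) - \<theta> (a(i := x)) + c * (\<psi> (a(i := y)) - \<theta> (a(i := y)))"
        using \<psi> \<theta> by (simp add: cochains_def algebra_simps del: fun_upd_apply)
    next
      fix a assume "a \<in> tuples (l1 H) n"
      then show "norm (\<psi> a - \<theta> a) \<le> (C + D) * (\<Prod>i<n. l1norm H (a i))"
        using C[of a] D[of a] norm_triangle_ineq4[of "\<psi> a" "\<theta> a"] by (simp add: ring_distribs)
    qed (use eq in simp)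
    then show ?thesis by simp
  next
    case False
    then show ?thesis using \<psi> \<theta> by (simp add: cochains_def)
  qed
qed

subsection \<open>The coboundary\<close>

text \<open>Norm bookkeeping for \<open>merge_at\<close>: submultiplicativity of convolution bounds
  the norms of a merged tuple by the product on the left, which is the product for the original
  tuple.\<close>

lemma prod_merge:
  fixes p :: "nat \<Rightarrow> 'a :: comm_monoid_mult"
  assumes "k < n"
  shows "(\<Prod>i<n. if i < k then p i else if i = k then p k * p (Suc k) else p (Suc i)) = (\<Prod>i<Suc n. p i)"
  using assms
proof (induction n)
  case (Suc n)
  show ?case
  proof (cases "k = n")
    case False
    then show ?thesis using Suc by simp
  qed (simp add: mult.assoc)
qed simp

lemma sum_list_msum: "msum (dual_l1S G S \<phi>) f js = (\<lambda>\<xi>. \<Sum>j\<leftarrow>js. f j \<xi>)"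
  by (induction js) (auto simp: msum_def)

lemma sum_list_msum_Cmod: "msum (Cmod H) f js = (\<Sum>j\<leftarrow>js. f j)"
  by (induction js) (auto simp: msum_def)

lemma sum_list_interval: "(\<Sum>j\<leftarrow>[1..<Suc n]. f j) = (\<Sum>k<n. f (Suc k))" for f :: "nat \<Rightarrow> complex"
  unfolding interv_sum_list_conv_sum_set_nat set_upt One_nat_def sum.shift_bounds_Suc_ivl
  by (simp add: lessThan_atLeast0)

context group_action
begin

sublocale group G
  using group_hom group_hom.axioms(1) by blast

abbreviation X_cochains where
  "X_cochains \<equiv> cochains (l1alg G (carrier G)) (dual_l1S G E \<phi>)"

abbreviation X_d where
  "X_d \<equiv> hoch_d (l1alg G (carrier G)) (dual_l1S G E \<phi>)"

text \<open>The coboundary without default values. The right action on l1(S) is by the augmentation,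
  so the left action on the dual is a scalar; the right action on the dual moves the argument \<xi>
  by \<open>a n\<close>.\<close>

definition form_d where
  "form_d n u = (\<lambda>a \<xi>. augm (carrier G) (a 0) * u (\<lambda>i. a (Suc i)) \<xi>
    + (\<Sum>k<n. (-1) ^ Suc k * u (merge_at (l1alg G (carrier G)) a (Suc k)) \<xi>)
    + (-1) ^ Suc n * u a (l1S_lact G E \<phi> (a n) \<xi>))"

lemma merge_tuples:
  assumes "a \<in> tuples (l1 (carrier G)) (Suc n)" "k < n"
  shows "merge_at (l1alg G (carrier G)) a (Suc k) \<in> tuples (l1 (carrier G)) n"
  using assms by (auto simp: tuples_def merge_at_def intro: conv_l1)

lemma hoch_d_dual:
  assumes "\<psi> \<in> X_cochains n"
  shows "X_d n \<psi> = trunc (carrier G) E (Suc n) (form_d n \<psi>)"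
proof (intro ext)
  have form: "bounded_form (carrier G) E n \<psi>"
    using assms unfolding cochains_dual_iff by blast
  have zero: "\<psi> b \<xi> = 0" if "\<xi> \<notin> l1 E" for b \<xi>
    using assms that unfolding cochains_dual_iff by blast
  fix a \<xi>
  have msum: "(\<Sum>j\<leftarrow>[1..<Suc n]. (-1) ^ j * \<psi> (merge_at (l1alg G (carrier G)) a j) \<xi>) =
      (\<Sum>k<n. (-1) ^ Suc k * \<psi> (merge_at (l1alg G (carrier G)) a (Suc k)) \<xi>)"
    by (rule sum_list_interval)
  show "X_d n \<psi> a \<xi> = trunc (carrier G) E (Suc n) (form_d n \<psi>) a \<xi>"
  proof (cases "a \<in> tuples (l1 (carrier G)) (Suc n)")
    case a: True
    show ?thesis
    proof (cases "\<xi> \<in> l1 E")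
      case \<xi>: True
      have "(\<lambda>i. a (Suc i)) \<in> tuples (l1 (carrier G)) n"
        using a by (simp add: tuples_def)
      from bounded_form_smult_arg[OF form this \<xi>]
      have ract: "\<psi> (\<lambda>i. a (Suc i)) (l1S_ract G \<xi> (a 0)) = augm (carrier G) (a 0) * \<psi> (\<lambda>i. a (Suc i)) \<xi>"
        by (simp only: l1S_ract_def)
      have "X_d n \<psi> a \<xi> = \<psi> (\<lambda>i. a (Suc i)) (l1S_ract G \<xi> (a 0)) +
          ((\<Sum>j\<leftarrow>[1..<Suc n]. (-1) ^ j * \<psi> (merge_at (l1alg G (carrier G)) a j) \<xi>) +
           (-1) ^ Suc n * \<psi> a (l1S_lact G E \<phi> (a n) \<xi>))"
        using a \<xi> by (simp add: hoch_d_def sum_list_msum del: upt_Suc power_Suc)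
      then show ?thesis
        unfolding ract msum using a \<xi> by (simp add: trunc_def form_d_def del: power_Suc)
    next
      case False
      then have "(\<Sum>j\<leftarrow>[1..<Suc n]. (-1) ^ j * \<psi> (merge_at (l1alg G (carrier G)) a j) \<xi>) = 0"
        unfolding msum by (simp add: zero)
      then show ?thesis
        using a False by (simp add: hoch_d_def sum_list_msum trunc_def del: upt_Suc power_Suc)
    qed
  qed (simp add: hoch_d_def trunc_def)
qed

text \<open>The augmentation, convolution and the action on l1(S) are contractive, so each summand,
  up to its sign, is a bounded form with the constant \<open>C\<close> of \<open>u\<close>.\<close>

lemma bounded_form_d:
  assumes u: "bounded_form (carrier G) E n u"
  shows "bounded_form (carrier G) E (Suc n) (form_d n u)"
proof -
  let ?T = "tuples (l1 (carrier G))" and ?N = "l1norm (carrier G)"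
  obtain C where C: "C \<ge> 0" "\<And>a \<xi>. a \<in> ?T n \<Longrightarrow> \<xi> \<in> l1 E \<Longrightarrow>
      norm (u a \<xi>) \<le> C * (\<Prod>i<n. ?N (a i)) * l1norm E \<xi>"
    using bounded_form_bound[OF u] by blast
  have T: "a \<in> ?T n" "(\<lambda>i. a (Suc i)) \<in> ?T n" "a i \<in> l1 (carrier G)"
    if "a \<in> ?T (Suc n)" "i \<le> n" for a i
    using that by (auto simp: tuples_def)
  have "bounded_form (carrier G) E (Suc n) (\<lambda>a \<xi>. augm (carrier G) (a 0) * u (\<lambda>i. a (Suc i)) \<xi>)"
  proof (rule bounded_formI[OF _ _ _ C(1)])
    fix a b \<xi> assume *: "a \<in> ?T (Suc n)" "\<xi> \<in> l1 E" "\<And>i. i < Suc n \<Longrightarrow> a i = b i"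
    then have "u (\<lambda>i. a (Suc i)) \<xi> = u (\<lambda>i. b (Suc i)) \<xi>"
      by (intro bounded_form_cong[OF u] T(2)[of _ 0]) auto
    then show "augm (carrier G) (a 0) * u (\<lambda>i. a (Suc i)) \<xi> = augm (carrier G) (b 0) * u (\<lambda>i. b (Suc i)) \<xi>"
      using * by simp
  next
    fix a \<xi> \<eta> c assume *: "a \<in> ?T (Suc n)" "\<xi> \<in> l1 E" "\<eta> \<in> l1 E"
    show "augm (carrier G) (a 0) * u (\<lambda>i. a (Suc i)) (\<lambda>t. \<xi> t + c * \<eta> t) =
      augm (carrier G) (a 0) * u (\<lambda>i. a (Suc i)) \<xi> + c * (augm (carrier G) (a 0) * u (\<lambda>i. a (Suc i)) \<eta>)"
      using bounded_form_linear[OF u T(2)[OF *(1), of 0] *(2,3)] by (simp add: algebra_simps)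
  next
    fix a i x y c \<xi>
    assume *: "a \<in> ?T (Suc n)" "i < Suc n" "x \<in> l1 (carrier G)" "y \<in> l1 (carrier G)" "\<xi> \<in> l1 E"
    show "augm (carrier G) ((a(i := (\<lambda>t. x t + c * y t))) 0) * u (\<lambda>j. (a(i := (\<lambda>t. x t + c * y t))) (Suc j)) \<xi> =
      augm (carrier G) ((a(i := x)) 0) * u (\<lambda>j. (a(i := x)) (Suc j)) \<xi> +
      c * (augm (carrier G) ((a(i := y)) 0) * u (\<lambda>j. (a(i := y)) (Suc j)) \<xi>)"
    proof (cases i)
      case 0
      then show ?thesis using augm_linear[OF *(3,4)] by (simp add: algebra_simps)
    next
      case (Suc k)
      have "(\<lambda>j. (a(i := z)) (Suc j)) = (\<lambda>j. a (Suc j))(k := z)" for z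
        using Suc by auto
      then show ?thesis
        using Suc * bounded_form_multilinear[OF u T(2)[OF *(1), of 0], of k x y \<xi> c]
        by (simp add: algebra_simps del: fun_upd_apply) (simp add: algebra_simps)
    qed
  next
    fix a \<xi> assume *: "a \<in> ?T (Suc n)" "\<xi> \<in> l1 E"
    have "norm (augm (carrier G) (a 0) * u (\<lambda>i. a (Suc i)) \<xi>) \<le>
        ?N (a 0) * (C * (\<Prod>i<n. ?N (a (Suc i))) * l1norm E \<xi>)"
      unfolding norm_mult using T[OF *(1), of 0] *(2)
      by (intro mult_mono norm_augm_le C(2)) (auto simp: l1norm_nonneg)
    then show "norm (augm (carrier G) (a 0) * u (\<lambda>i. a (Suc i)) \<xi>) \<le> C * (\<Prod>i<Suc n. ?N (a i)) * l1norm E \<xi>"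
      unfolding prod.lessThan_Suc_shift by (simp add: mult_ac)
  qed
  moreover have "bounded_form (carrier G) E (Suc n)
      (\<lambda>a \<xi>. u (merge_at (l1alg G (carrier G)) a (Suc k)) \<xi>)" if k: "k < n" for k
  proof -
    let ?m = "\<lambda>a. merge_at (l1alg G (carrier G)) a (Suc k)"
    show ?thesis
    proof (rule bounded_formI[OF _ _ _ C(1)])
      fix a b \<xi> assume *: "a \<in> ?T (Suc n)" "\<xi> \<in> l1 E" "\<And>i. i < Suc n \<Longrightarrow> a i = b i"
      then show "u (?m a) \<xi> = u (?m b) \<xi>"
        using k by (intro bounded_form_cong[OF u] merge_tuples) (auto simp: merge_at_def)
    next
      fix a \<xi> \<eta> c assume *: "a \<in> ?T (Suc n)" "\<xi> \<in> l1 E" "\<eta> \<in> l1 E"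
      then show "u (?m a) (\<lambda>t. \<xi> t + c * \<eta> t) = u (?m a) \<xi> + c * u (?m a) \<eta>"
        using k by (intro bounded_form_linear[OF u] merge_tuples)
    next
      fix a i x y c \<xi>
      assume *: "a \<in> ?T (Suc n)" "i < Suc n" "x \<in> l1 (carrier G)" "y \<in> l1 (carrier G)" "\<xi> \<in> l1 E"
      note lin = bounded_form_multilinear[OF u merge_tuples[OF *(1) k] _ _ _ *(5)]
      have ak: "a k \<in> l1 (carrier G)" "a (Suc k) \<in> l1 (carrier G)"
        using * k T by auto
      \<comment> \<open>The varied entry lies before the merged pair, is its first or its second
        member, or lies after it, in which case merging moves it down by one place.\<close>
      consider "i < k" | "i = k" | "i = Suc k" | "i > Suc k" by linarith
      then show "u (?m (a(i := (\<lambda>t. x t + c * y t)))) \<xi> = u (?m (a(i := x))) \<xi> + c * u (?m (a(i := y))) \<xi>"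
      proof cases
        case 1
        then have "?m (a(i := z)) = (?m a)(i := z)" for z by (auto simp: merge_at_def)
        then show ?thesis using lin[of i x y c] 1 k * by simp
      next
        case 2
        then have "?m (a(i := z)) = (?m a)(k := conv G z (a (Suc k)))" for z by (auto simp: merge_at_def)
        then show ?thesis
          using lin[of k "conv G x (a (Suc k))" "conv G y (a (Suc k))" c] k *
          by (simp add: conv_linear_left conv_l1 ak)
      next
        case 3
        then have "?m (a(i := z)) = (?m a)(k := conv G (a k) z)" for z by (auto simp: merge_at_def)
        then show ?thesis
          using lin[of k "conv G (a k) x" "conv G (a k) y" c] k *
          by (simp add: conv_linear_right conv_l1 ak)
      next
        case 4
        then have "?m (a(i := z)) = (?m a)(i - 1 := z)" for z
          by (cases i) (auto simp: merge_at_def fun_eq_iff)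
        then show ?thesis using lin[of "i - 1" x y c] 4 k * by simp
      qed
    next
      fix a \<xi> assume *: "a \<in> ?T (Suc n)" "\<xi> \<in> l1 E"
      have a: "a i \<in> l1 (carrier G)" if "i \<le> n" for i using T * that by blast
      have "(\<Prod>i<n. ?N (?m a i)) \<le>
          (\<Prod>i<n. if i < k then ?N (a i) else if i = k then ?N (a k) * ?N (a (Suc k)) else ?N (a (Suc i)))"
        using k a by (intro prod_mono) (auto simp: merge_at_def l1norm_nonneg intro!: conv_l1)
      also have "\<dots> = (\<Prod>i<Suc n. ?N (a i))"
        by (rule prod_merge[OF k])
      finally have "C * (\<Prod>i<n. ?N (?m a i)) * l1norm E \<xi> \<le> C * (\<Prod>i<Suc n. ?N (a i)) * l1norm E \<xi>"
        using C(1) by (intro mult_right_mono mult_left_mono) (auto simp: l1norm_nonneg)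
      then show "norm (u (?m a) \<xi>) \<le> C * (\<Prod>i<Suc n. ?N (a i)) * l1norm E \<xi>"
        using C(2)[OF merge_tuples[OF *(1) k] *(2)] by linarith
    qed
  qed
  moreover have "bounded_form (carrier G) E (Suc n) (\<lambda>a \<xi>. u a (l1S_lact G E \<phi> (a n) \<xi>))"
  proof (rule bounded_formI[OF _ _ _ C(1)])
    fix a b \<xi> assume *: "a \<in> ?T (Suc n)" "\<xi> \<in> l1 E" "\<And>i. i < Suc n \<Longrightarrow> a i = b i"
    have "u a (l1S_lact G E \<phi> (a n) \<xi>) = u b (l1S_lact G E \<phi> (a n) \<xi>)"
      using * T[OF *(1), of n] by (intro bounded_form_cong[OF u] l1S_lact_l1) auto
    then show "u a (l1S_lact G E \<phi> (a n) \<xi>) = u b (l1S_lact G E \<phi> (b n) \<xi>)"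
      using * by simp
  next
    fix a \<xi> \<eta> c assume *: "a \<in> ?T (Suc n)" "\<xi> \<in> l1 E" "\<eta> \<in> l1 E"
    show "u a (l1S_lact G E \<phi> (a n) (\<lambda>t. \<xi> t + c * \<eta> t)) =
        u a (l1S_lact G E \<phi> (a n) \<xi>) + c * u a (l1S_lact G E \<phi> (a n) \<eta>)"
      using * T[OF *(1), of n]
      by (simp add: l1S_lact_linear_right bounded_form_linear[OF u] l1S_lact_l1)
  next
    fix a i x y c \<xi>
    assume *: "a \<in> ?T (Suc n)" "i < Suc n" "x \<in> l1 (carrier G)" "y \<in> l1 (carrier G)" "\<xi> \<in> l1 E"
    show "u (a(i := (\<lambda>t. x t + c * y t))) (l1S_lact G E \<phi> ((a(i := (\<lambda>t. x t + c * y t))) n) \<xi>) =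
        u (a(i := x)) (l1S_lact G E \<phi> ((a(i := x)) n) \<xi>) + c * u (a(i := y)) (l1S_lact G E \<phi> ((a(i := y)) n) \<xi>)"
    \<comment> \<open>\<open>u\<close> reads only the entries below \<open>n\<close>, so entry
      \<open>n\<close> enters through the action alone.\<close>
    proof (cases "i = n")
      case True
      have "u (a(i := z)) \<eta> = u a \<eta>" if "z \<in> l1 (carrier G)" "\<eta> \<in> l1 E" for z \<eta>
        using that True T[OF *(1), of n] by (intro bounded_form_cong[OF u] tuples_upd) auto
      then show ?thesis
        using * True T[OF *(1), of n]
        by (simp add: l1S_lact_linear_left bounded_form_linear[OF u] l1S_lact_l1 l1_linear)
    next
      case False
      then show ?thesis
        using * T[OF *(1), of n] bounded_form_multilinear[OF u, of a i x y _ c]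
        by (simp add: l1S_lact_l1)
    qed
  next
    fix a \<xi> assume *: "a \<in> ?T (Suc n)" "\<xi> \<in> l1 E"
    have an: "a n \<in> l1 (carrier G)" using T[OF *(1), of n] by simp
    have "norm (u a (l1S_lact G E \<phi> (a n) \<xi>)) \<le> C * (\<Prod>i<n. ?N (a i)) * l1norm E (l1S_lact G E \<phi> (a n) \<xi>)"
      using * T[OF *(1), of n] by (intro C(2) l1S_lact_l1) auto
    also have "\<dots> \<le> C * (\<Prod>i<n. ?N (a i)) * (?N (a n) * l1norm E \<xi>)"
      using C(1) * an by (intro mult_left_mono l1S_lact_l1 mult_nonneg_nonneg prod_nonneg) (auto simp: l1norm_nonneg)
    finally show "norm (u a (l1S_lact G E \<phi> (a n) \<xi>)) \<le> C * (\<Prod>i<Suc n. ?N (a i)) * l1norm E \<xi>"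
      by (simp add: mult_ac)
  qed
  ultimately show ?thesis
    unfolding form_d_def
    by (intro bounded_form_add bounded_form_smult bounded_form_sum) auto
qed

lemma X_d_closed: "\<psi> \<in> X_cochains n \<Longrightarrow> X_d n \<psi> \<in> X_cochains (Suc n)"
  using cochains_dual_trunc[OF bounded_form_d] by (simp add: hoch_d_dual cochains_dual_iff)

end

section \<open>Homogeneous cochains\<close>

lemma sum_face_split:
  "(\<Sum>j\<le>Suc n. f j) = f 0 + (\<Sum>m<n. f (Suc m)) + f (Suc n :: nat)" for f :: "nat \<Rightarrow> complex"
  by (simp add: sum.atMost_shift)

context group_action
begin

text \<open>The value of a cochain on the simplex with vertices \<open>k 0 \<cdot> s, \<dots>, k n \<cdot> s\<close>, whose edges
  are labelled by the quotients of consecutive entries of \<open>k\<close>.\<close>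

definition hval where
  "hval n \<psi> k s = \<psi> (\<lambda>i. delta (k i \<otimes> inv k (Suc i))) (delta (\<phi> (k n) s))"

text \<open>The counterpart of \<open>hval\<close> over one stabilizer. This groupoid has a single
  object, so no base point is recorded.\<close>

definition hval_scalar where
  "hval_scalar y k = y (\<lambda>i. delta (k i \<otimes> inv k (Suc i)))"

lemma inv_mult_cancel: "a \<in> carrier G \<Longrightarrow> b \<in> carrier G \<Longrightarrow> inv a \<otimes> (a \<otimes> b) = b"
  using m_assoc[of "inv a" a b] by simp

lemma quot_mult: "a \<in> carrier G \<Longrightarrow> b \<in> carrier G \<Longrightarrow> c \<in> carrier G \<Longrightarrow>
    (a \<otimes> inv b) \<otimes> (b \<otimes> inv c) = a \<otimes> inv c"
  by (simp add: m_assoc inv_mult_cancel)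

lemma quot_cancel: "a \<in> carrier G \<Longrightarrow> b \<in> carrier G \<Longrightarrow> c \<in> carrier G \<Longrightarrow>
    (a \<otimes> inv c) \<otimes> inv (b \<otimes> inv c) = a \<otimes> inv b"
  by (simp add: inv_mult_group m_assoc inv_mult_cancel)

lemma act_quot: "a \<in> carrier G \<Longrightarrow> b \<in> carrier G \<Longrightarrow> s \<in> E \<Longrightarrow> \<phi> (a \<otimes> inv b) (\<phi> b s) = \<phi> a s"
  using composition_rule[of s "a \<otimes> inv b" b] by (simp add: m_assoc)

lemma hval_cong:
  assumes "\<psi> \<in> X_cochains n" "\<And>i. i \<le> n \<Longrightarrow> k i = k' i"
  shows "hval n \<psi> k s = hval n \<psi> k' s"
  unfolding hval_def using assms(2) by (subst cochains_cong[OF assms(1)]) auto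

text \<open>Neither the edge labels nor the end point \<open>\<phi> (k n) s\<close> notice a change
  of origin. By \<open>homlift_closed\<close> and \<open>hval_homlift\<close>, a bounded function of
  \<open>n + 1\<close> vertices with this invariance comes from a cochain.\<close>

lemma hval_translate:
  assumes "range k \<subseteq> carrier G" "s \<in> E" "c \<in> carrier G"
  shows "hval n \<psi> (\<lambda>i. k i \<otimes> inv c) (\<phi> c s) = hval n \<psi> k s"
proof -
  have k: "k i \<in> carrier G" for i using assms(1) by blast
  show ?thesis using assms k by (simp add: hval_def quot_cancel act_quot)
qed

text \<open>Each term of the Hochschild coboundary deletes one vertex. The augmentation deletes
  vertex 0, the product of adjacent labels deletes their common vertex, and the action deletes the
  last one, because label \<open>n\<close> carries \<open>\<phi> (k (Suc n)) s\<close> to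
  \<open>\<phi> (k n) s\<close>.\<close>

lemma hval_d:
  assumes \<psi>: "\<psi> \<in> X_cochains n" and k: "range k \<subseteq> carrier G" and s: "s \<in> E"
  shows "hval (Suc n) (X_d n \<psi>) k s = face_sum (Suc n) (\<lambda>k. hval n \<psi> k s) k"
proof -
  have kc [simp]: "k i \<in> carrier G" for i using k by blast
  have sc [simp]: "\<phi> (k i) s \<in> E" for i using element_image[OF kc s] by blast
  define a where "a = (\<lambda>i. delta (k i \<otimes> inv k (Suc i)))"
  have a: "a \<in> tuples (l1 (carrier G)) (Suc n)" unfolding a_def by (rule tuples_delta) simp
  have "hval (Suc n) (X_d n \<psi>) k s = form_d n \<psi> a (delta (\<phi> (k (Suc n)) s))"
    unfolding hval_def hoch_d_dual[OF \<psi>] using a by (simp add: trunc_def a_def delta_l1)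
  moreover have "augm (carrier G) (a 0) = 1"
    by (simp add: a_def augm_delta)
  moreover have "\<psi> (\<lambda>i. a (Suc i)) (delta (\<phi> (k (Suc n)) s)) = hval n \<psi> (\<lambda>i. k (skip 0 i)) s"
    by (simp add: a_def hval_def skip_def)
  moreover have "\<psi> (merge_at (l1alg G (carrier G)) a (Suc m)) (delta (\<phi> (k (Suc n)) s)) =
      hval n \<psi> (\<lambda>i. k (skip (Suc m) i)) s" if "m < n" for m
  proof -
    have "merge_at (l1alg G (carrier G)) a (Suc m) =
        (\<lambda>i. delta (k (skip (Suc m) i) \<otimes> inv k (skip (Suc m) (Suc i))))"
      by (auto simp: merge_at_def a_def skip_def conv_delta quot_mult fun_eq_iff less_Suc_eq)
    then show ?thesis using that by (simp add: hval_def skip_def)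
  qed
  moreover have "\<psi> a (l1S_lact G E \<phi> (a n) (delta (\<phi> (k (Suc n)) s))) =
      hval n \<psi> (\<lambda>i. k (skip (Suc n) i)) s"
  proof -
    have "l1S_lact G E \<phi> (a n) (delta (\<phi> (k (Suc n)) s)) = delta (\<phi> (k n) s)"
      using s by (simp add: a_def l1S_lact_delta act_quot)
    moreover have "\<psi> a = \<psi> (\<lambda>i. delta (k (skip (Suc n) i) \<otimes> inv k (skip (Suc n) (Suc i))))"
      by (rule cochains_cong[OF \<psi>]) (simp add: a_def skip_def)
    ultimately show ?thesis by (simp add: hval_def skip_def)
  qed
  ultimately show ?thesis
    unfolding face_sum_def sum_face_split form_d_def by simp
qed

lemma hoch_d_Cmod:
  assumes "a \<in> tuples (l1 H) (Suc n)"
  shows "hoch_d (l1alg G H) (Cmod H) n y a = augm H (a 0) * y (\<lambda>i. a (Suc i))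
    + (\<Sum>k<n. (-1) ^ Suc k * y (merge_at (l1alg G H) a (Suc k))) + (-1) ^ Suc n * y a * augm H (a n)"
  using assms unfolding hoch_d_def sum_list_msum_Cmod sum_list_interval Cmod_simps l1alg_simps if_P[OF assms]
  by (simp add: mult.assoc)

text \<open>Membership in \<open>H\<close> is asked of the quotients and not of the
  \<open>k i\<close>: straightened vertices all carry \<open>s\<close> to its representative, so
  they lie in a coset of the stabilizer.\<close>

lemma hval_scalar_d:
  assumes H: "H \<subseteq> carrier G" and y: "y \<in> cochains (l1alg G H) (Cmod H) n"
    and k: "range k \<subseteq> carrier G" and kH: "\<And>i j. k i \<otimes> inv k j \<in> H"
  shows "hval_scalar (hoch_d (l1alg G H) (Cmod H) n y) k = face_sum (Suc n) (hval_scalar y) k"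
proof -
  have kc [simp]: "k i \<in> carrier G" for i using k by blast
  define a where "a = (\<lambda>i. delta (k i \<otimes> inv k (Suc i)))"
  have a: "a \<in> tuples (l1 H) (Suc n)" unfolding a_def by (rule tuples_delta) (simp add: kH)
  have "y (merge_at (l1alg G H) a (Suc m)) = hval_scalar y (\<lambda>i. k (skip (Suc m) i))" for m
  proof -
    have "merge_at (l1alg G H) a (Suc m) =
        (\<lambda>i. delta (k (skip (Suc m) i) \<otimes> inv k (skip (Suc m) (Suc i))))"
      by (auto simp: merge_at_def a_def skip_def conv_delta quot_mult fun_eq_iff less_Suc_eq)
    then show ?thesis by (simp add: hval_scalar_def)
  qed
  moreover have "y a = hval_scalar y (\<lambda>i. k (skip (Suc n) i))"
    unfolding hval_scalar_def by (rule cochains_cong[OF y]) (simp add: a_def skip_def)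
  moreover have "y (\<lambda>i. a (Suc i)) = hval_scalar y (\<lambda>i. k (skip 0 i))"
    by (simp add: a_def hval_scalar_def skip_def)
  moreover have "augm H (a i) = 1" for i
    by (simp add: a_def augm_delta kH)
  moreover have "hval_scalar (hoch_d (l1alg G H) (Cmod H) n y) k = hoch_d (l1alg G H) (Cmod H) n y a"
    by (simp add: hval_scalar_def a_def)
  ultimately show ?thesis
    unfolding face_sum_def sum_face_split hoch_d_Cmod[OF a] by simp
qed

section \<open>Passing between vertices and edge labels\<close>

primrec suffix_prod :: "(nat \<Rightarrow> 'a) \<Rightarrow> nat list \<Rightarrow> 'a" where
  "suffix_prod g [] = \<one>"
| "suffix_prod g (j # js) = g j \<otimes> suffix_prod g js"

text \<open>The vertices of the simplex with edges \<open>g 0, \<dots>, g (n - 1)\<close>, normalised to end in \<open>\<one>\<close>.\<close>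

definition vertices :: "nat \<Rightarrow> (nat \<Rightarrow> 'a) \<Rightarrow> nat \<Rightarrow> 'a" where
  "vertices n g i = suffix_prod g [i..<n]"

lemma vertices_Suc: "i < n \<Longrightarrow> vertices n g i = g i \<otimes> vertices n g (Suc i)"
  by (simp add: vertices_def upt_conv_Cons)

lemma vertices_end: "n \<le> i \<Longrightarrow> vertices n g i = \<one>"
  by (simp add: vertices_def)

lemma vertices_closed:
  assumes "subgroup H G" "\<And>i. i < n \<Longrightarrow> g i \<in> H"
  shows "vertices n g i \<in> H"
proof (cases "i \<le> n")
  case True
  then show ?thesis
    by (induction i rule: inc_induct)
      (simp_all add: vertices_end vertices_Suc assms subgroup.m_closed[OF assms(1)] subgroup.one_closed[OF assms(1)])
qed (simp add: vertices_end subgroup.one_closed[OF assms(1)])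

lemma range_vertices:
  "(\<And>i. i < n \<Longrightarrow> g i \<in> carrier G) \<Longrightarrow> range (vertices n g) \<subseteq> carrier G"
  by (intro image_subsetI vertices_closed[OF subgroup_self])

lemma vertices_quot:
  assumes "\<And>i. i < n \<Longrightarrow> g i \<in> carrier G" "i < n"
  shows "vertices n g i \<otimes> inv vertices n g (Suc i) = g i"
proof -
  have "vertices n g (Suc i) \<in> carrier G"
    by (rule vertices_closed[OF subgroup_self assms(1)])
  then show ?thesis
    unfolding vertices_Suc[OF assms(2)] using assms by (simp add: m_assoc)
qed

text \<open>The product of the labels telescopes; the result is \<open>k\<close> translated so as to
  end in \<one>.\<close>

lemma quot_vertices:
  assumes "range k \<subseteq> carrier G" "i \<le> n" "\<And>i. i < n \<Longrightarrow> g i = k i \<otimes> inv k (Suc i)"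
  shows "vertices n g i = k i \<otimes> inv k n"
proof -
  have kc: "k i \<in> carrier G" for i using assms(1) by blast
  show ?thesis
    using assms(2) by (induction i rule: inc_induct) (simp_all add: vertices_end vertices_Suc assms(3) kc quot_mult)
qed

lemma hval_vertices:
  assumes "\<psi> \<in> X_cochains n" "\<And>i. i < n \<Longrightarrow> g i \<in> carrier G" "s \<in> E"
  shows "hval n \<psi> (vertices n g) s = \<psi> (\<lambda>i. delta (g i)) (delta s)"
proof -
  have "\<phi> \<one> s = s" using assms(3) id_eq_one by (metis restrict_apply')
  moreover have "\<psi> (\<lambda>i. delta (vertices n g i \<otimes> inv vertices n g (Suc i))) = \<psi> (\<lambda>i. delta (g i))"
    by (rule cochains_cong[OF assms(1)]) (simp add: vertices_quot assms)
  ultimately show ?thesis by (simp add: hval_def vertices_end)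
qed

text \<open>By \<open>hval_vertices\<close> every tuple of labels comes from vertices, so
  \<open>hval\<close> sees all values on point masses, and these determine a cochain.\<close>

lemma X_cochains_eqI:
  assumes "\<psi> \<in> X_cochains n" "\<theta> \<in> X_cochains n"
    and "\<And>k s. range k \<subseteq> carrier G \<Longrightarrow> s \<in> E \<Longrightarrow> hval n \<psi> k s = hval n \<theta> k s"
  shows "\<psi> = \<theta>"
proof (rule cochains_dual_eqI[OF assms(1,2)])
  fix g s assume "\<And>i. i < n \<Longrightarrow> g i \<in> carrier G" "s \<in> E"
  then show "\<psi> (\<lambda>i. delta (g i)) (delta s) = \<theta> (\<lambda>i. delta (g i)) (delta s)"
    using assms(3)[OF range_vertices] hval_vertices[OF assms(1)] hval_vertices[OF assms(2)] by metis
qed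

lemma X_cochain_norm_upper:
  assumes "\<psi> \<in> X_cochains n" "a \<in> tuples (l1 (carrier G)) n" "\<And>i. i < n \<Longrightarrow> l1norm (carrier G) (a i) \<le> 1"
    and "\<xi> \<in> l1 E" "l1norm E \<xi> \<le> 1"
  shows "norm (\<psi> a \<xi>) \<le> cochain_norm (l1alg G (carrier G)) (dual_l1S G E \<phi>) n \<psi>"
proof -
  have car: "\<psi> a \<in> mcar (dual_l1S G E \<phi>)" using assms(1,2) by (simp add: cochains_def)
  have "norm (\<psi> a \<xi>) \<le> mnorm (dual_l1S G E \<phi>) (\<psi> a) * l1norm E \<xi>"
    by (rule dual_norm_upper[OF car assms(4)])
  also have "\<dots> \<le> mnorm (dual_l1S G E \<phi>) (\<psi> a) * 1"
    by (rule mult_left_mono[OF assms(5) dual_norm_nonneg[OF car]])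
  also have "\<dots> \<le> cochain_norm (l1alg G (carrier G)) (dual_l1S G E \<phi>) n \<psi>"
    using cochain_norm_upper[OF assms(1), of a] assms by (simp add: l1norm_nonneg)
  finally show ?thesis .
qed

lemma hval_bound:
  assumes "\<psi> \<in> X_cochains n" "range k \<subseteq> carrier G" "s \<in> E"
  shows "norm (hval n \<psi> k s) \<le> cochain_norm (l1alg G (carrier G)) (dual_l1S G E \<phi>) n \<psi>"
proof -
  have k: "k i \<in> carrier G" for i using assms(2) by blast
  have "\<phi> (k n) s \<in> E" using element_image[OF k assms(3)] by blast
  then show ?thesis
    unfolding hval_def using k
    by (intro X_cochain_norm_upper[OF assms(1)] tuples_delta delta_l1) (simp_all add: l1norm_delta)
qed

text \<open>The cochain whose values on simplices are prescribed by a bounded translation invariant \<open>f\<close>.\<close>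

definition homlift where
  "homlift n f = trunc (carrier G) E n (lift (carrier G) E n (\<lambda>g. f (vertices n g)))"

lemma homlift_closed:
  assumes "K \<ge> 0" and "\<And>k s. range k \<subseteq> carrier G \<Longrightarrow> s \<in> E \<Longrightarrow> norm (f k s) \<le> K"
  shows "homlift n f \<in> X_cochains n"
    and "cochain_norm (l1alg G (carrier G)) (dual_l1S G E \<phi>) n (homlift n f) \<le> K"
proof -
  have K: "norm (f (vertices n g) s) \<le> K" if "g \<in> PiE {..<n} (\<lambda>_. carrier G)" "s \<in> E" for g s
    using that by (intro assms(2) range_vertices) auto
  show "homlift n f \<in> X_cochains n"
    unfolding homlift_def by (intro cochains_dual_trunc bounded_form_lift[OF assms(1) K])
  show "cochain_norm (l1alg G (carrier G)) (dual_l1S G E \<phi>) n (homlift n f) \<le> K"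
  proof (intro cochain_norm_le dual_norm_le assms(1))
    fix a \<xi> assume a: "a \<in> tuples (acar (l1alg G (carrier G))) n"
      "\<And>i. i < n \<Longrightarrow> anorm (l1alg G (carrier G)) (a i) \<le> 1"
      and \<xi>: "\<xi> \<in> l1 E" "l1norm E \<xi> \<le> 1"
    have "norm (homlift n f a \<xi>) \<le> K * (\<Prod>i<n. l1norm (carrier G) (a i)) * l1norm E \<xi>"
      unfolding homlift_def trunc_def using a \<xi> lift_bound[OF _ \<xi>(1) K] by simp
    also have "\<dots> \<le> K * 1 * 1"
      using a \<xi> assms(1)
      by (intro mult_mono mult_left_mono prod_le_1 mult_nonneg_nonneg prod_nonneg) (auto simp: l1norm_nonneg)
    finally show "norm (homlift n f a \<xi>) \<le> K" by simp
  qed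
qed

text \<open>Passing from \<open>k\<close> to labels and back gives \<open>k\<close> translated by
  \<open>c = k n\<close>, which the invariance undoes. The hypothesis \<open>cong\<close> absorbs
  the indices beyond \<open>n\<close>, where \<open>vertices\<close> is constantly \<one>.\<close>

lemma hval_homlift:
  assumes translate: "\<And>k s c. range k \<subseteq> carrier G \<Longrightarrow> s \<in> E \<Longrightarrow> c \<in> carrier G \<Longrightarrow>
      f (\<lambda>i. k i \<otimes> inv c) (\<phi> c s) = f k s"
    and cong: "\<And>k k' s. (\<And>i. i \<le> n \<Longrightarrow> k i = k' i) \<Longrightarrow> f k s = f k' s"
    and k: "range k \<subseteq> carrier G" and s: "s \<in> E"
  shows "hval n (homlift n f) k s = f k s"
proof -
  have kc: "k i \<in> carrier G" for i using k by blast
  have sc: "\<phi> (k n) s \<in> E" using element_image[OF kc s] by blast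
  let ?q = "\<lambda>i. k i \<otimes> inv k (Suc i)"
  have "hval n (homlift n f) k s = f (vertices n (restrict ?q {..<n})) (\<phi> (k n) s)"
    unfolding hval_def homlift_def trunc_def
    using lift_delta[of n ?q "carrier G" "\<phi> (k n) s" E "\<lambda>g. f (vertices n g)"] kc sc
    by (simp add: tuples_delta delta_l1)
  also have "\<dots> = f (\<lambda>i. k i \<otimes> inv k n) (\<phi> (k n) s)"
    by (rule cong) (rule quot_vertices[OF k], simp_all)
  also have "\<dots> = f k s"
    by (rule translate[OF k s kc])
  finally show ?thesis .
qed

end

section \<open>Restriction to the stabilizers\<close>

lemma seminormed_cx_dual:
  "group_action G S \<phi> \<Longrightarrow> seminormed_cx (hoch_cx (l1alg G (carrier G)) (dual_l1S G S \<phi>))"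
proof -
  assume "group_action G S \<phi>"
  then interpret group_action G S \<phi> .
  show ?thesis
  proof
    fix n x y and k :: complex
    let ?X = "hoch_cx (l1alg G (carrier G)) (dual_l1S G S \<phi>)"
    show "cdiff ?X n (cadd ?X x y) = cadd ?X (cdiff ?X n x) (cdiff ?X n y)"
      by (simp add: hoch_cx_def hoch_d_def sum_list_msum fun_eq_iff sum_list_addf algebra_simps del: upt_Suc power_Suc)
    show "cdiff ?X n (csmult ?X k x) = csmult ?X k (cdiff ?X n x)"
      by (simp add: hoch_cx_def hoch_d_def sum_list_msum fun_eq_iff sum_list_const_mult distrib_left
          mult.left_commute[of _ k] del: upt_Suc power_Suc)
    assume x: "x \<in> ccar ?X n"
    then show "cdiff ?X n x \<in> ccar ?X (Suc n)"
      by (simp add: hoch_cx_def X_d_closed)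
    show "csmult ?X k x \<in> ccar ?X n"
      using x by (simp add: hoch_cx_def cochains_dual_iff bounded_form_smult)
    show "0 \<le> cnorm ?X n x"
      using cochain_norm_nonneg[of x] x by (simp add: hoch_cx_def l1norm_nonneg)
    assume "y \<in> ccar ?X n"
    then show "cadd ?X x y \<in> ccar ?X n"
      using x by (simp add: hoch_cx_def cochains_dual_iff bounded_form_add)
  qed (simp_all add: hoch_cx_def algebra_simps fun_eq_iff cochains_dual_iff bounded_form_0)
qed

section \<open>A transversal of the orbits and the straightening of vertices\<close>

locale orbit_transversal = group_action G E \<phi> for G (structure) and E and \<phi> +
  fixes \<Lambda>
  assumes transversal_subset: "\<Lambda> \<subseteq> E"
    and transversal_unique: "\<forall>Orb\<in>orbits G E \<phi>. \<exists>!x. x \<in> \<Lambda> \<and> x \<in> Orb"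
begin

definition rep where
  "rep s = (THE x. x \<in> \<Lambda> \<and> x \<in> orbit G \<phi> s)"

text \<open>The value \<one> on \<Lambda> makes straightening fix the stabilizer of a
  representative, so that spreading is an exact right inverse of restriction.\<close>

definition transport where
  "transport s = (if s \<in> \<Lambda> then \<one> else SOME g. g \<in> carrier G \<and> \<phi> g (rep s) = s)"

text \<open>The retraction of groupoids in homogeneous form. It acts on single vertices; the
  quotient of two straightened vertices carries the transports at both ends and is the retraction of
  the arrow between them.\<close>

definition straighten where
  "straighten s k = inv transport (\<phi> k s) \<otimes> k"

lemma ex1_rep:
  assumes "s \<in> E"
  shows "\<exists>!x. x \<in> \<Lambda> \<and> x \<in> orbit G \<phi> s"
proof -
  have "orbit G \<phi> s \<in> orbits G E \<phi>" using assms by (auto simp: orbits_def)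
  then show ?thesis by (rule bspec[OF transversal_unique])
qed

lemma rep: "s \<in> E \<Longrightarrow> rep s \<in> \<Lambda> \<and> rep s \<in> orbit G \<phi> s"
  unfolding rep_def by (rule theI'[OF ex1_rep])

lemma rep_closed: "s \<in> E \<Longrightarrow> rep s \<in> E"
  using rep transversal_subset by blast

lemma rep_eqI: "s \<in> E \<Longrightarrow> x \<in> \<Lambda> \<Longrightarrow> x \<in> orbit G \<phi> s \<Longrightarrow> rep s = x"
  unfolding rep_def by (rule the1_equality[OF ex1_rep]) auto

lemma rep_transversal: "x \<in> \<Lambda> \<Longrightarrow> rep x = x"
  using transversal_subset by (intro rep_eqI orbit_refl) auto

lemma rep_act:
  assumes "g \<in> carrier G" "s \<in> E"
  shows "rep (\<phi> g s) = rep s"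
proof (rule rep_eqI)
  show gs: "\<phi> g s \<in> E" using element_image assms by blast
  show "rep s \<in> \<Lambda>" using rep assms by blast
  have "\<phi> g s \<in> orbit G \<phi> s" using assms by (auto simp: orbit_def)
  then have "s \<in> orbit G \<phi> (\<phi> g s)" using orbit_sym assms gs by blast
  then show "rep s \<in> orbit G \<phi> (\<phi> g s)"
    using orbit_trans[OF gs assms(2) rep_closed[OF assms(2)]] rep assms by blast
qed

lemma transport:
  assumes "s \<in> E"
  shows "transport s \<in> carrier G \<and> \<phi> (transport s) (rep s) = s"
proof (cases "s \<in> \<Lambda>")
  case True
  then show ?thesis
    using assms id_eq_one by (simp add: transport_def rep_transversal) (metis restrict_apply')
next
  case False
  have "s \<in> orbit G \<phi> (rep s)"
    using orbit_sym rep rep_closed assms by blast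
  then have "\<exists>g. g \<in> carrier G \<and> \<phi> g (rep s) = s" by (auto simp: orbit_def)
  from someI_ex[OF this] False show ?thesis by (simp add: transport_def)
qed

lemma
  assumes k: "k \<in> carrier G" and s: "s \<in> E"
  shows straighten_closed: "straighten s k \<in> carrier G"
    and straighten_act: "\<phi> (straighten s k) s = rep s"
proof -
  have ks: "\<phi> k s \<in> E" using element_image assms by blast
  note t = transport[OF ks]
  show "straighten s k \<in> carrier G" using t k by (simp add: straighten_def)
  have "\<phi> (straighten s k) s = \<phi> (inv transport (\<phi> k s)) (\<phi> k s)"
    unfolding straighten_def using t k s by (intro composition_rule) auto
  also have "\<dots> = rep (\<phi> k s)"
    using t rep_closed[OF ks] by (intro orbit_sym_aux) auto
  finally show "\<phi> (straighten s k) s = rep s"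
    using rep_act[OF k s] by simp
qed

text \<open>The vertex \<open>\<phi> k s\<close> does not change with the origin, hence neither does
  its transport. This equivariance makes the functions behind \<open>spread\<close> and
  \<open>homotopy\<close> translation invariant.\<close>

lemma straighten_translate:
  assumes "k \<in> carrier G" "s \<in> E" "c \<in> carrier G"
  shows "straighten (\<phi> c s) (k \<otimes> inv c) = straighten s k \<otimes> inv c"
proof -
  have "transport (\<phi> k s) \<in> carrier G" using transport element_image assms by blast
  then show ?thesis using assms by (simp add: straighten_def act_quot m_assoc)
qed

lemma straighten_stabilizer:
  "x \<in> \<Lambda> \<Longrightarrow> k \<in> stabilizer G \<phi> x \<Longrightarrow> straighten x k = k"
  by (simp add: straighten_def transport_def stabilizer_def)

text \<open>Straightened elements all carry \<open>s\<close> to \<open>rep s\<close>, so a quotient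
  of two of them fixes \<open>rep s\<close>.\<close>

lemma straighten_quot:
  assumes "k \<in> carrier G" "l \<in> carrier G" "s \<in> E"
  shows "straighten s k \<otimes> inv straighten s l \<in> stabilizer G \<phi> (rep s)"
proof -
  have "\<phi> (straighten s k \<otimes> inv straighten s l) (\<phi> (straighten s l) s) = \<phi> (straighten s k) s"
    using straighten_closed assms by (intro act_quot) auto
  then show ?thesis
    using straighten_closed assms by (simp add: straighten_act stabilizer_def)
qed

section \<open>The two complexes and the restriction map\<close>

abbreviation stab where "stab \<equiv> stabilizer G \<phi>"
abbreviation X_cx where "X_cx \<equiv> hoch_cx (l1alg G (carrier G)) (dual_l1S G E \<phi>)"
abbreviation Y_cx where "Y_cx \<equiv> linf_sum_cx \<Lambda> (\<lambda>x. l1alg G (stab x)) (\<lambda>x. Cmod (stab x))"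

lemma X_cx_simps [simp]:
  "ccar X_cx = X_cochains" "cdiff X_cx = X_d"
  "cadd X_cx = (\<lambda>\<psi> \<theta> a \<xi>. \<psi> a \<xi> + \<theta> a \<xi>)" "csmult X_cx = (\<lambda>c \<psi> a \<xi>. c * \<psi> a \<xi>)"
  "czero X_cx = (\<lambda>a \<xi>. 0)"
  "cnorm X_cx = cochain_norm (l1alg G (carrier G)) (dual_l1S G E \<phi>)"
  by (simp_all add: hoch_cx_def)

lemma Y_cx_simps [simp]:
  "cdiff Y_cx = (\<lambda>n \<Phi> x. if x \<in> \<Lambda> then hoch_d (l1alg G (stab x)) (Cmod (stab x)) n (\<Phi> x) else (\<lambda>a. 0))"
  "cadd Y_cx = (\<lambda>\<Phi> \<Psi> x a. \<Phi> x a + \<Psi> x a)" "csmult Y_cx = (\<lambda>c \<Phi> x a. c * \<Phi> x a)"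
  "czero Y_cx = (\<lambda>x a. 0)"
  by (simp_all add: linf_sum_cx_def cong: if_cong)

lemma Y_carD:
  assumes "\<Phi> \<in> ccar Y_cx n"
  shows "x \<in> \<Lambda> \<Longrightarrow> \<Phi> x \<in> cochains (l1alg G (stab x)) (Cmod (stab x)) n"
    and "x \<notin> \<Lambda> \<Longrightarrow> \<Phi> x = (\<lambda>a. 0)"
    and "x \<in> \<Lambda> \<Longrightarrow> cochain_norm (l1alg G (stab x)) (Cmod (stab x)) n (\<Phi> x) \<le> cnorm Y_cx n \<Phi>"
    and "0 \<le> cnorm Y_cx n \<Phi>"
proof -
  let ?N = "(\<lambda>x. cochain_norm (l1alg G (stab x)) (Cmod (stab x)) n (\<Phi> x)) ` \<Lambda>"
  have bdd: "bdd_above (insert 0 ?N)" and norm: "cnorm Y_cx n \<Phi> = Sup (insert 0 ?N)"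
    using assms by (simp_all add: linf_sum_cx_def)
  show "x \<in> \<Lambda> \<Longrightarrow> \<Phi> x \<in> cochains (l1alg G (stab x)) (Cmod (stab x)) n"
    and "x \<notin> \<Lambda> \<Longrightarrow> \<Phi> x = (\<lambda>a. 0)"
    using assms by (simp_all add: linf_sum_cx_def)
  show "x \<in> \<Lambda> \<Longrightarrow> cochain_norm (l1alg G (stab x)) (Cmod (stab x)) n (\<Phi> x) \<le> cnorm Y_cx n \<Phi>"
    and "0 \<le> cnorm Y_cx n \<Phi>"
    unfolding norm by (auto intro: cSup_upper[OF _ bdd])
qed

lemma stab_subgroup: "x \<in> \<Lambda> \<Longrightarrow> subgroup (stab x) G"
  using stabilizer_subgroup transversal_subset by blast

lemma stab_subset: "stab x \<subseteq> carrier G"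
  by (auto simp: stabilizer_def)

lemma tuples_stab: "a \<in> tuples (l1 (stab x)) n \<Longrightarrow> a \<in> tuples (l1 (carrier G)) n"
  using l1_mono[OF _ stab_subset] by (auto simp: tuples_def)

text \<open>The test on \<open>a\<close> reinstates the default value 0 for tuples that are summable
  over the group but not supported on \<open>stab x\<close>.\<close>

definition restr where
  "restr n \<psi> = (\<lambda>x a. if x \<in> \<Lambda> \<and> a \<in> tuples (l1 (stab x)) n then \<psi> a (delta x) else 0)"

lemma restr_cochain:
  assumes \<psi>: "\<psi> \<in> X_cochains n" and x: "x \<in> \<Lambda>"
  shows "restr n \<psi> x \<in> cochains (l1alg G (stab x)) (Cmod (stab x)) n"
    and "cochain_norm (l1alg G (stab x)) (Cmod (stab x)) n (restr n \<psi> x)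
      \<le> cochain_norm (l1alg G (carrier G)) (dual_l1S G E \<phi>) n \<psi>"
proof -
  let ?T = "tuples (l1 (stab x)) n"
  have xE: "x \<in> E" using x transversal_subset by blast
  have form: "bounded_form (carrier G) E n \<psi>" using \<psi> by (simp add: cochains_dual_iff)
  obtain C where C: "C \<ge> 0" "\<And>a \<xi>. a \<in> tuples (l1 (carrier G)) n \<Longrightarrow> \<xi> \<in> l1 E \<Longrightarrow>
      norm (\<psi> a \<xi>) \<le> C * (\<Prod>i<n. l1norm (carrier G) (a i)) * l1norm E \<xi>"
    using bounded_form_bound[OF form] by blast
  have norm: "l1norm (carrier G) (a i) = l1norm (stab x) (a i)" if "a \<in> ?T" "i < n" for a i
    using that by (intro l1norm_mono stab_subset) (simp add: tuples_def)
  have "norm (restr n \<psi> x a) \<le> C * (\<Prod>i<n. l1norm (stab x) (a i))" if "a \<in> ?T" for a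
    using C(2)[OF tuples_stab[OF that] delta_l1[OF xE]] that x xE norm[OF that]
    by (simp add: restr_def l1norm_delta)
  then have "\<exists>C. \<forall>a\<in>?T. norm (restr n \<psi> x a) \<le> C * (\<Prod>i<n. l1norm (stab x) (a i))"
    by blast
  moreover have "restr n \<psi> x a = 0" if "a \<notin> ?T" for a
    using that by (simp add: restr_def)
  moreover have "restr n \<psi> x a = restr n \<psi> x b" if "\<forall>i<n. a i = b i" for a b
    using tuples_cong[of n a b] cochains_cong[OF \<psi>, of a b] that by (simp add: restr_def)
  moreover have "restr n \<psi> x (a(i := (\<lambda>t. y t + c * z t))) =
      restr n \<psi> x (a(i := y)) + c * restr n \<psi> x (a(i := z))"
    if "a \<in> ?T" "i < n" "y \<in> l1 (stab x)" "z \<in> l1 (stab x)" for a i y z c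
    using that x xE bounded_form_multilinear[OF form, of a i y z "delta x" c] l1_mono[OF _ stab_subset]
    by (simp add: restr_def tuples_upd l1_linear tuples_stab delta_l1 del: fun_upd_apply)
  ultimately show "restr n \<psi> x \<in> cochains (l1alg G (stab x)) (Cmod (stab x)) n"
    unfolding cochains_def by (auto simp del: fun_upd_apply)
  show "cochain_norm (l1alg G (stab x)) (Cmod (stab x)) n (restr n \<psi> x)
      \<le> cochain_norm (l1alg G (carrier G)) (dual_l1S G E \<phi>) n \<psi>"
  proof (rule cochain_norm_le)
    show "0 \<le> cochain_norm (l1alg G (carrier G)) (dual_l1S G E \<phi>) n \<psi>"
      using cochain_norm_nonneg[OF \<psi>] by (simp add: l1norm_nonneg)
    fix a assume a: "a \<in> tuples (acar (l1alg G (stab x))) n" "\<And>i. i < n \<Longrightarrow> anorm (l1alg G (stab x)) (a i) \<le> 1"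
    then have "norm (\<psi> a (delta x)) \<le> cochain_norm (l1alg G (carrier G)) (dual_l1S G E \<phi>) n \<psi>"
      using norm[of a] xE by (intro X_cochain_norm_upper[OF \<psi>]) (simp_all add: tuples_stab delta_l1 l1norm_delta)
    then show "mnorm (Cmod (stab x)) (restr n \<psi> x a)
        \<le> cochain_norm (l1alg G (carrier G)) (dual_l1S G E \<phi>) n \<psi>"
      using a x by (simp add: restr_def)
  qed
qed

lemma restr_closed:
  assumes "\<psi> \<in> X_cochains n"
  shows "restr n \<psi> \<in> ccar Y_cx n"
proof -
  have "bdd_above ((\<lambda>x. cochain_norm (l1alg G (stab x)) (Cmod (stab x)) n (restr n \<psi> x)) ` \<Lambda>)"
    using restr_cochain(2)[OF assms] by (rule bdd_aboveI2)
  moreover have "restr n \<psi> x = (\<lambda>a. 0)" if "x \<notin> \<Lambda>" for x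
    using that by (simp add: restr_def)
  ultimately show ?thesis
    using restr_cochain(1)[OF assms] by (simp add: linf_sum_cx_def)
qed

lemma restr_norm: "\<psi> \<in> X_cochains n \<Longrightarrow>
    cnorm Y_cx n (restr n \<psi>) \<le> cochain_norm (l1alg G (carrier G)) (dual_l1S G E \<phi>) n \<psi>"
  using restr_cochain(2) cochain_norm_nonneg[of \<psi>]
  by (auto simp: linf_sum_cx_def l1norm_nonneg intro!: Sup_insert_0_le)

text \<open>Merged tuples stay over the subgroup, and in the last term the action on
  \<open>delta x\<close> is multiplication by the augmentation, by
  \<open>l1S_lact_stabilizer\<close>.\<close>

lemma restr_d:
  assumes "\<psi> \<in> X_cochains n"
  shows "restr (Suc n) (X_d n \<psi>) = cdiff Y_cx n (restr n \<psi>)"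
proof (intro ext)
  fix x a
  show "restr (Suc n) (X_d n \<psi>) x a = cdiff Y_cx n (restr n \<psi>) x a"
  proof (cases "x \<in> \<Lambda> \<and> a \<in> tuples (l1 (stab x)) (Suc n)")
    case True
    then have x: "x \<in> \<Lambda>" and a: "a \<in> tuples (l1 (stab x)) (Suc n)" by auto
    have xE: "x \<in> E" using x transversal_subset by blast
    have form: "bounded_form (carrier G) E n \<psi>" using assms by (simp add: cochains_dual_iff)
    have ai: "a i \<in> l1 (stab x)" if "i \<le> n" for i using a that by (simp add: tuples_def)
    have aT: "a \<in> tuples (l1 (stab x)) n" "(\<lambda>i. a (Suc i)) \<in> tuples (l1 (stab x)) n"
      using a by (auto simp: tuples_def)
    have merge: "merge_at (l1alg G (carrier G)) a = merge_at (l1alg G (stab x)) a"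
      by (simp add: merge_at_def fun_eq_iff)
    have mT: "merge_at (l1alg G (stab x)) a (Suc k) \<in> tuples (l1 (stab x)) n" if "k < n" for k
      using that ai conv_l1_subgroup[OF stab_subgroup[OF x]] by (auto simp: tuples_def merge_at_def)
    have augm: "augm (carrier G) (a 0) = augm (stab x) (a 0)"
      using ai[of 0] by (intro augm_mono stab_subset) simp
    have "l1S_lact G E \<phi> (a n) (delta x) = (\<lambda>t. augm (stab x) (a n) * delta x t)"
      using ai[of n] xE by (intro l1S_lact_stabilizer) auto
    then have lact: "\<psi> a (l1S_lact G E \<phi> (a n) (delta x)) = augm (stab x) (a n) * \<psi> a (delta x)"
      using bounded_form_smult_arg[OF form tuples_stab[OF aT(1)] delta_l1[OF xE]] by simp
    have "restr (Suc n) (X_d n \<psi>) x a = form_d n \<psi> a (delta x)"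
      using x a xE unfolding hoch_d_dual[OF assms] by (simp add: restr_def trunc_def tuples_stab delta_l1)
    also have "\<dots> = hoch_d (l1alg G (stab x)) (Cmod (stab x)) n (restr n \<psi> x) a"
      unfolding hoch_d_Cmod[OF a] form_d_def merge augm lact using x aT mT by (simp add: restr_def)
    finally show ?thesis using x by simp
  next
    case False
    then show ?thesis by (auto simp: restr_def hoch_d_def)
  qed
qed

section \<open>The section: pulling cochains back along the straightening\<close>

definition spread where
  "spread n \<Phi> = homlift n (\<lambda>k s. hval_scalar (\<Phi> (rep s)) (\<lambda>i. straighten s (k i)))"

text \<open>At base point \<open>s\<close> only the coordinate \<open>rep s\<close> is evaluated,
  and on point masses of norm 1, so the sup norm over \<Lambda> bounds all values
  simultaneously.\<close>

lemma spread_bound: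
  assumes \<Phi>: "\<Phi> \<in> ccar Y_cx n" and k: "range k \<subseteq> carrier G" and s: "s \<in> E"
  shows "norm (hval_scalar (\<Phi> (rep s)) (\<lambda>i. straighten s (k i))) \<le> cnorm Y_cx n \<Phi>"
proof -
  have x: "rep s \<in> \<Lambda>" using rep s by blast
  have q: "straighten s (k i) \<otimes> inv straighten s (k j) \<in> stab (rep s)" for i j
    using straighten_quot k s by blast
  let ?a = "\<lambda>i. delta (straighten s (k i) \<otimes> inv straighten s (k (Suc i)))"
  have "?a \<in> tuples (l1 (stab (rep s))) n"
    by (rule tuples_delta) (rule q)
  then have "norm (hval_scalar (\<Phi> (rep s)) (\<lambda>i. straighten s (k i))) \<le>
      cochain_norm (l1alg G (stab (rep s))) (Cmod (stab (rep s))) n (\<Phi> (rep s))"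
    using cochain_norm_upper[OF Y_carD(1)[OF \<Phi> x], of ?a] q
    by (simp add: hval_scalar_def l1norm_nonneg l1norm_delta)
  also have "\<dots> \<le> cnorm Y_cx n \<Phi>"
    by (rule Y_carD(3)[OF \<Phi> x])
  finally show ?thesis .
qed

lemma
  assumes "\<Phi> \<in> ccar Y_cx n"
  shows spread_closed: "spread n \<Phi> \<in> X_cochains n"
    and spread_norm: "cochain_norm (l1alg G (carrier G)) (dual_l1S G E \<phi>) n (spread n \<Phi>) \<le> cnorm Y_cx n \<Phi>"
  unfolding spread_def
  by (rule homlift_closed[OF Y_carD(4)[OF assms] spread_bound[OF assms]]; assumption)+

lemma hval_spread:
  assumes \<Phi>: "\<Phi> \<in> ccar Y_cx n" and k: "range k \<subseteq> carrier G" and s: "s \<in> E"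
  shows "hval n (spread n \<Phi>) k s = hval_scalar (\<Phi> (rep s)) (\<lambda>i. straighten s (k i))"
  unfolding spread_def
proof (rule hval_homlift[OF _ _ k s])
  fix k :: "nat \<Rightarrow> 'a" and s c assume *: "range k \<subseteq> carrier G" "s \<in> E" "c \<in> carrier G"
  then have k: "k i \<in> carrier G" for i by blast
  show "hval_scalar (\<Phi> (rep (\<phi> c s))) (\<lambda>i. straighten (\<phi> c s) (k i \<otimes> inv c)) =
      hval_scalar (\<Phi> (rep s)) (\<lambda>i. straighten s (k i))"
    using * k by (simp add: hval_scalar_def rep_act straighten_translate quot_cancel straighten_closed)
next
  fix k k' :: "nat \<Rightarrow> 'a" and s assume eq: "\<And>i. i \<le> n \<Longrightarrow> k i = k' i"
  show "hval_scalar (\<Phi> (rep s)) (\<lambda>i. straighten s (k i)) = hval_scalar (\<Phi> (rep s)) (\<lambda>i. straighten s (k' i))"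
  \<comment> \<open>Congruence is demanded for every \<open>s\<close>, also outside
    \<open>E\<close>, where nothing is known of \<open>rep s\<close>; coordinates off \<Lambda> are
    0.\<close>
  proof (cases "rep s \<in> \<Lambda>")
    case True
    show ?thesis
      unfolding hval_scalar_def by (rule cochains_cong[OF Y_carD(1)[OF \<Phi> True]]) (simp add: eq)
  qed (simp add: Y_carD(2)[OF \<Phi>] hval_scalar_def)
qed

text \<open>A simplex with labels in \<open>stab x\<close> and last vertex \<one> has all its
  vertices in \<open>stab x\<close>, and straightening at \<open>x\<close> leaves these
  alone.\<close>

lemma restr_spread:
  assumes \<Phi>: "\<Phi> \<in> ccar Y_cx n"
  shows "restr n (spread n \<Phi>) = \<Phi>"
proof
  fix x
  show "restr n (spread n \<Phi>) x = \<Phi> x"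
  proof (cases "x \<in> \<Lambda>")
    case x: True
    show ?thesis
    proof (rule cochains_Cmod_eqI[OF restr_cochain(1)[OF spread_closed[OF \<Phi>] x] Y_carD(1)[OF \<Phi> x]])
      fix g assume g: "\<And>i. i < n \<Longrightarrow> g i \<in> stab x"
      have xE: "x \<in> E" using x transversal_subset by blast
      have gc: "g i \<in> carrier G" if "i < n" for i using g[OF that] stab_subset by blast
      have v: "straighten x (vertices n g i) = vertices n g i" for i
        by (rule straighten_stabilizer[OF x vertices_closed[OF stab_subgroup[OF x] g]])
      have "restr n (spread n \<Phi>) x (\<lambda>i. delta (g i)) = hval n (spread n \<Phi>) (vertices n g) x"
        using x g hval_vertices[OF spread_closed[OF \<Phi>] gc xE] by (simp add: restr_def tuples_delta)
      also have "\<dots> = hval_scalar (\<Phi> x) (vertices n g)"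
        using hval_spread[OF \<Phi> range_vertices[OF gc] xE] x by (simp add: v rep_transversal)
      also have "\<dots> = \<Phi> x (\<lambda>i. delta (g i))"
        unfolding hval_scalar_def
        by (rule cochains_cong[OF Y_carD(1)[OF \<Phi> x]]) (simp add: vertices_quot gc)
      finally show "restr n (spread n \<Phi>) x (\<lambda>i. delta (g i)) = \<Phi> x (\<lambda>i. delta (g i))" .
    qed
  next
    case False
    then show ?thesis using Y_carD(2)[OF \<Phi>] by (simp add: restr_def fun_eq_iff)
  qed
qed

text \<open>The bound on the coboundaries that is uniform in \<open>x\<close> is read off from the
  dual complex, by writing \<Phi> as the restriction of \<open>spread n \<Phi>\<close>.\<close>

lemma Y_d_closed:
  assumes "\<Phi> \<in> ccar Y_cx n"
  shows "cdiff Y_cx n \<Phi> \<in> ccar Y_cx (Suc n)"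
  using restr_closed[OF X_d_closed[OF spread_closed[OF assms]]]
  by (simp only: restr_d[OF spread_closed[OF assms]] restr_spread[OF assms])

text \<open>Straightening acts vertex by vertex and hence commutes with deleting a vertex.\<close>

lemma spread_d:
  assumes \<Phi>: "\<Phi> \<in> ccar Y_cx n"
  shows "spread (Suc n) (cdiff Y_cx n \<Phi>) = X_d n (spread n \<Phi>)"
proof (rule X_cochains_eqI[OF spread_closed[OF Y_d_closed[OF \<Phi>]] X_d_closed[OF spread_closed[OF \<Phi>]]])
  fix k :: "nat \<Rightarrow> 'a" and s assume k: "range k \<subseteq> carrier G" and s: "s \<in> E"
  have kc: "k i \<in> carrier G" for i using k by blast
  have x: "rep s \<in> \<Lambda>" using rep s by blast
  let ?k = "\<lambda>i. straighten s (k i)"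
  have "hval (Suc n) (spread (Suc n) (cdiff Y_cx n \<Phi>)) k s = hval_scalar (cdiff Y_cx n \<Phi> (rep s)) ?k"
    by (rule hval_spread[OF Y_d_closed[OF \<Phi>] k s])
  also have "\<dots> = face_sum (Suc n) (hval_scalar (\<Phi> (rep s))) ?k"
    using hval_scalar_d[OF stab_subset Y_carD(1)[OF \<Phi> x], of ?k] x straighten_closed[OF kc s]
      straighten_quot[OF kc kc s] by (simp add: image_subset_iff)
  also have "\<dots> = face_sum (Suc n) (\<lambda>k. hval n (spread n \<Phi>) k s) k"
    by (rule face_sum_cong) (use kc s in \<open>subst hval_spread[OF \<Phi>], auto\<close>)
  also have "\<dots> = hval (Suc n) (X_d n (spread n \<Phi>)) k s"
    by (rule hval_d[OF spread_closed[OF \<Phi>] k s, symmetric])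
  finally show "hval (Suc n) (spread (Suc n) (cdiff Y_cx n \<Phi>)) k s = hval (Suc n) (X_d n (spread n \<Phi>)) k s" .
qed

section \<open>The prism homotopy between the identity and spreading after restriction\<close>

definition homotopy where
  "homotopy n z = homlift (n - 1) (\<lambda>k s. prism_sum (straighten s) n (\<lambda>k. hval n z k s) k)"

lemma prism_closed:
  assumes "range k \<subseteq> carrier G" "s \<in> E"
  shows "range (prism (straighten s) i k) \<subseteq> carrier G"
proof -
  have "k i \<in> carrier G" for i using assms(1) by blast
  then show ?thesis using straighten_closed assms(2) by (auto simp: prism_def)
qed

text \<open>The factor \<open>n\<close> in the bound counts the simplices of the triangulated prism.
  In degree 0 there are none and the homotopy is zero, so the truncated \<open>n - 1\<close> does no
  harm.\<close>

lemma homotopy_closed: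
  assumes z: "z \<in> X_cochains n"
  shows "homotopy n z \<in> X_cochains (n - 1)"
  unfolding homotopy_def
proof (rule homlift_closed)
  let ?K = "cochain_norm (l1alg G (carrier G)) (dual_l1S G E \<phi>) n z"
  show "0 \<le> real n * ?K"
    using cochain_norm_nonneg[OF z] by (simp add: l1norm_nonneg)
  fix k :: "nat \<Rightarrow> 'a" and s assume "range k \<subseteq> carrier G" "s \<in> E"
  then have "norm (prism_sum (straighten s) n (\<lambda>k. hval n z k s) k) \<le> (\<Sum>i<n. ?K)"
    unfolding prism_sum_def
    by (intro order_trans[OF norm_sum] sum_mono)
      (simp add: norm_mult norm_power hval_bound[OF z] prism_closed)
  then show "norm (prism_sum (straighten s) n (\<lambda>k. hval n z k s) k) \<le> real n * ?K"
    by simp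
qed

lemma hval_homotopy:
  assumes z: "z \<in> X_cochains n" and n: "n \<noteq> 0" and k: "range k \<subseteq> carrier G" and s: "s \<in> E"
  shows "hval (n - 1) (homotopy n z) k s = prism_sum (straighten s) n (\<lambda>k. hval n z k s) k"
  unfolding homotopy_def
proof (rule hval_homlift[OF _ _ k s])
  fix k :: "nat \<Rightarrow> 'a" and s c assume *: "range k \<subseteq> carrier G" "s \<in> E" "c \<in> carrier G"
  then have kc: "k i \<in> carrier G" for i by blast
  have "prism (straighten (\<phi> c s)) i (\<lambda>i. k i \<otimes> inv c) = (\<lambda>p. prism (straighten s) i k p \<otimes> inv c)" for i
    using * kc by (simp add: prism_def fun_eq_iff straighten_translate)
  then show "prism_sum (straighten (\<phi> c s)) n (\<lambda>k. hval n z k (\<phi> c s)) (\<lambda>i. k i \<otimes> inv c) =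
      prism_sum (straighten s) n (\<lambda>k. hval n z k s) k"
    using * by (simp add: prism_sum_def hval_translate prism_closed)
next
  \<comment> \<open>The prism has vertices up to index \<open>n\<close>, but its last one is read
    from \<open>k\<close> one place earlier, so \<open>k\<close> matters only up to
    \<open>n - 1\<close>.\<close>
  fix k k' :: "nat \<Rightarrow> 'a" and s assume eq: "\<And>i. i \<le> n - 1 \<Longrightarrow> k i = k' i"
  have "hval n z (prism (straighten s) i k) s = hval n z (prism (straighten s) i k') s" if "i < n" for i
    by (rule hval_cong[OF z]) (use that eq in \<open>auto simp: prism_def\<close>)
  then show "prism_sum (straighten s) n (\<lambda>k. hval n z k s) k = prism_sum (straighten s) n (\<lambda>k. hval n z k s) k'"
    by (simp add: prism_sum_def)
qed

text \<open>In homogeneous form the composite is precomposition with straightening. The prism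
  identity writes its difference from \<open>z\<close> as the coboundary of
  \<open>homotopy n z\<close> plus a term in the coboundary of \<open>z\<close>, which vanishes on
  cocycles.\<close>

lemma spread_restr:
  assumes "z \<in> cocycles X_cx n"
  shows "\<exists>b\<in>coboundaries X_cx n. spread n (restr n z) = cadd X_cx z b"
proof -
  have z: "z \<in> X_cochains n" and dz: "X_d n z = (\<lambda>a \<xi>. 0)"
    using assms by (auto simp: cocycles_def)
  interpret X: seminormed_cx X_cx
    by (rule seminormed_cx_dual) (rule group_action_axioms)
  \<comment> \<open>In degree 0 the only coboundary is 0.\<close>
  define b where "b = (if n = 0 then (\<lambda>a \<xi>. 0) else X_d (n - 1) (homotopy n z))"
  have b: "b \<in> coboundaries X_cx n"
    using homotopy_closed[OF z] by (auto simp: b_def coboundaries_def)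
  have hb: "hval n b k s = face_sum n (prism_sum (straighten s) n (\<lambda>k. hval n z k s)) k"
    if k: "range k \<subseteq> carrier G" and s: "s \<in> E" for k s
  proof (cases n)
    case 0
    then show ?thesis by (simp add: b_def hval_def face_sum_def prism_sum_def)
  next
    case (Suc m)
    have "hval n b k s = face_sum n (\<lambda>k. hval m (homotopy n z) k s) k"
      using hval_d[OF _ k s, of "homotopy n z" m] homotopy_closed[OF z] Suc by (simp add: b_def)
    also have "\<dots> = face_sum n (prism_sum (straighten s) n (\<lambda>k. hval n z k s)) k"
      using hval_homotopy[OF z _ _ s] Suc k by (intro face_sum_cong) (simp add: image_subset_iff)
    finally show ?thesis .
  qed
  have "spread n (restr n z) = cadd X_cx z b"
  proof (rule X_cochains_eqI)
    show "spread n (restr n z) \<in> X_cochains n"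
      by (rule spread_closed[OF restr_closed[OF z]])
    show "cadd X_cx z b \<in> X_cochains n"
      using X.add_closed[of z n b] X.coboundaries_closed[OF b] z by simp
    fix k :: "nat \<Rightarrow> 'a" and s assume k: "range k \<subseteq> carrier G" and s: "s \<in> E"
    have kc: "k i \<in> carrier G" for i using k by blast
    let ?w = "\<lambda>k. hval n z k s"
    have "hval n (spread n (restr n z)) k s = hval_scalar (restr n z (rep s)) (\<lambda>i. straighten s (k i))"
      by (rule hval_spread[OF restr_closed[OF z] k s])
    \<comment> \<open>The straightened simplex has all its labels in the stabilizer and ends at the
      point \<open>rep s\<close>, so it is one of the arguments that restriction keeps.\<close>
    also have "\<dots> = ?w (\<lambda>i. straighten s (k i))"
      using rep[OF s] kc s straighten_quot
      by (simp add: hval_scalar_def restr_def hval_def straighten_act tuples_delta)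
    also have "\<dots> = ?w k + (face_sum n (prism_sum (straighten s) n ?w) k
        + prism_sum (straighten s) (Suc n) (face_sum (Suc n) ?w) k)"
      by (subst prism_homotopy) (auto intro: hval_cong[OF z])
    also have "prism_sum (straighten s) (Suc n) (face_sum (Suc n) ?w) k = 0"
    proof -
      have "face_sum (Suc n) ?w k' = 0" if "range k' \<subseteq> carrier G" for k'
        using hval_d[OF z that s] by (simp add: dz hval_def)
      then show ?thesis using prism_closed[OF k s] by (simp add: prism_sum_def)
    qed
    finally have "hval n (spread n (restr n z)) k s = hval n z k s + hval n b k s"
      by (simp add: hb[OF k s])
    then show "hval n (spread n (restr n z)) k s = hval n (cadd X_cx z b) k s"
      by (simp add: hval_def)
  qed
  then show ?thesis using b by blast
qed

text \<open>The comparison goes through \<open>hval\<close>, where spreading is a pointwise formula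
  instead of an infinite sum; for that the sum must already be known to be a cochain.\<close>

lemma spread_add:
  assumes "\<Phi> \<in> ccar Y_cx n" "\<Psi> \<in> ccar Y_cx n" "cadd Y_cx \<Phi> \<Psi> \<in> ccar Y_cx n"
  shows "spread n (cadd Y_cx \<Phi> \<Psi>) = cadd X_cx (spread n \<Phi>) (spread n \<Psi>)"
proof (rule X_cochains_eqI[OF spread_closed[OF assms(3)]])
  show "cadd X_cx (spread n \<Phi>) (spread n \<Psi>) \<in> X_cochains n"
    using spread_closed[OF assms(1)] spread_closed[OF assms(2)]
    by (simp add: cochains_dual_iff bounded_form_add)
  fix k :: "nat \<Rightarrow> 'a" and s assume "range k \<subseteq> carrier G" "s \<in> E"
  note h = hval_spread[OF assms(1) this] hval_spread[OF assms(2) this] hval_spread[OF assms(3) this]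
  show "hval n (spread n (cadd Y_cx \<Phi> \<Psi>)) k s = hval n (cadd X_cx (spread n \<Phi>) (spread n \<Psi>)) k s"
    unfolding h using h(1,2) by (simp add: hval_def hval_scalar_def)
qed

lemma spread_smult:
  assumes "\<Phi> \<in> ccar Y_cx n" "csmult Y_cx c \<Phi> \<in> ccar Y_cx n"
  shows "spread n (csmult Y_cx c \<Phi>) = csmult X_cx c (spread n \<Phi>)"
proof (rule X_cochains_eqI[OF spread_closed[OF assms(2)]])
  show "csmult X_cx c (spread n \<Phi>) \<in> X_cochains n"
    using spread_closed[OF assms(1)] by (simp add: cochains_dual_iff bounded_form_smult)
  fix k :: "nat \<Rightarrow> 'a" and s assume "range k \<subseteq> carrier G" "s \<in> E"
  note h = hval_spread[OF assms(1) this] hval_spread[OF assms(2) this]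
  show "hval n (spread n (csmult Y_cx c \<Phi>)) k s = hval n (csmult X_cx c (spread n \<Phi>)) k s"
    unfolding h using h(1) by (simp add: hval_def hval_scalar_def)
qed

lemma restr_add: "restr n (cadd X_cx \<psi> \<theta>) = cadd Y_cx (restr n \<psi>) (restr n \<theta>)"
  by (simp add: restr_def fun_eq_iff)

lemma restr_smult: "restr n (csmult X_cx c \<psi>) = csmult Y_cx c (restr n \<psi>)"
  by (simp add: restr_def fun_eq_iff)

text \<open>Closure properties of the target complex are inherited through the retraction.\<close>

lemma Y_add_closed:
  assumes "\<Phi> \<in> ccar Y_cx n" "\<Psi> \<in> ccar Y_cx n"
  shows "cadd Y_cx \<Phi> \<Psi> \<in> ccar Y_cx n"
proof -
  interpret X: seminormed_cx X_cx
    by (rule seminormed_cx_dual) (rule group_action_axioms)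
  have "cadd X_cx (spread n \<Phi>) (spread n \<Psi>) \<in> X_cochains n"
    using X.add_closed spread_closed assms by simp
  from restr_closed[OF this] show ?thesis
    unfolding restr_add by (simp only: restr_spread assms)
qed

lemma Y_smult_closed:
  assumes "\<Phi> \<in> ccar Y_cx n"
  shows "csmult Y_cx c \<Phi> \<in> ccar Y_cx n"
proof -
  interpret X: seminormed_cx X_cx
    by (rule seminormed_cx_dual) (rule group_action_axioms)
  have "csmult X_cx c (spread n \<Phi>) \<in> X_cochains n"
    using X.smult_closed spread_closed assms by simp
  from restr_closed[OF this] show ?thesis
    unfolding restr_smult by (simp only: restr_spread assms)
qed

lemma seminormed_cx_sum: "seminormed_cx Y_cx"
proof
  have hoch_add: "hoch_d (l1alg G H) (Cmod H) n (\<lambda>a. y a + z a) a =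
      hoch_d (l1alg G H) (Cmod H) n y a + hoch_d (l1alg G H) (Cmod H) n z a" for H n y z a
  proof (cases "a \<in> tuples (l1 H) (Suc n)")
    case True
    show ?thesis unfolding hoch_d_Cmod[OF True] by (simp add: algebra_simps sum.distrib del: power_Suc)
  qed (simp add: hoch_d_def)
  have hoch_smult: "hoch_d (l1alg G H) (Cmod H) n (\<lambda>a. c * y a) a =
      c * hoch_d (l1alg G H) (Cmod H) n y a" for H n y c a
  proof (cases "a \<in> tuples (l1 H) (Suc n)")
    case True
    show ?thesis unfolding hoch_d_Cmod[OF True] by (simp add: distrib_left sum_distrib_left mult_ac del: power_Suc)
  qed (simp add: hoch_d_def)
  fix n \<Phi> \<Psi> c
  show "cdiff Y_cx n (cadd Y_cx \<Phi> \<Psi>) = cadd Y_cx (cdiff Y_cx n \<Phi>) (cdiff Y_cx n \<Psi>)"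
    by (simp add: fun_eq_iff hoch_add)
  show "cdiff Y_cx n (csmult Y_cx c \<Phi>) = csmult Y_cx c (cdiff Y_cx n \<Phi>)"
    by (simp add: fun_eq_iff hoch_smult)
  have "(\<lambda>a \<xi>. 0) \<in> X_cochains n"
    by (simp add: cochains_dual_iff bounded_form_0)
  from restr_closed[OF this] show "czero Y_cx \<in> ccar Y_cx n"
    by (simp add: restr_def)
qed (simp_all add: fun_eq_iff algebra_simps Y_add_closed[simplified] Y_smult_closed[simplified]
    Y_d_closed[simplified] Y_carD(4))

lemma top_iso_restr: "\<exists>T. top_iso X_cx Y_cx n T"
proof (rule top_iso_retract[where F = restr and R = spread])
  show "seminormed_cx X_cx"
    by (rule seminormed_cx_dual) (rule group_action_axioms)
  show "seminormed_cx Y_cx"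
    by (rule seminormed_cx_sum)
qed (simp_all only: X_cx_simps(1,2,6) restr_closed restr_add restr_smult restr_d restr_norm spread_closed
    spread_add spread_smult Y_add_closed Y_smult_closed spread_d spread_norm restr_spread spread_restr)

end

theorem theorem4p1:
  fixes G :: "('g, 'z) monoid_scheme" (structure)
    and S :: "'b set" and \<phi> :: "'g \<Rightarrow> 'b \<Rightarrow> 'b" and \<Lambda> :: "'b set" and n :: nat
  assumes "group_action G S \<phi>"
    and "\<Lambda> \<subseteq> S"
    and "\<forall>Orb\<in>orbits G S \<phi>. \<exists>!x. x \<in> \<Lambda> \<and> x \<in> Orb"
  shows "\<exists>T. top_iso (hoch_cx (l1alg G (carrier G)) (dual_l1S G S \<phi>))
                     (linf_sum_cx \<Lambda> (\<lambda>x. l1alg G (stabilizer G \<phi> x)) (\<lambda>x. Cmod (stabilizer G \<phi> x)))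
                     n T"
proof -
  interpret orbit_transversal G S \<phi> \<Lambda>
    using assms by (simp add: orbit_transversal_def orbit_transversal_axioms_def)
  show ?thesis by (rule top_iso_restr)
qed

end
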